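(* Suppose the pair of functions $(u(x,t), s(t))$ is a classical solution of Problem $P$ with data $\lambda,\sigma,b,f,\varphi$ (i.e. it satisfies (i), (ii), (iii) of the context). If $s \in C^{m+2}((0,T])$, where $m\in\mathbb{N}$ and $T>0$, then $f \in C^m((0,T])$. Moreover, if $s \in C^\infty((0,\infty))$, then $f \in C^\infty((0,\infty))$.
   Context: Problem $P$. Let $\lambda>0$, $\sigma>0$, $b>0$ be constants, and let $f:[0,\infty)\to\mathbb{R}$ and $\varphi:[0,b]\to\mathbb{R}$ be given functions with $\varphi(0)=f(0)$. Find $s(t)>0$ and $u(x,t)$ such that (P1) $u_t = u_{xx}-\lambda u$ for $0<x<s(t)$, $t>0$; (P2) $u(0,t)=f(t)$ for $t\ge 0$; (P3) $u(x,0)=\varphi(x)$ for $x\in[0,b]$, and $s(0)=b$; (P4) $u_x(s(t),t)=0$ for $t>0$; (P5) $s'(t)=\int_0^{s(t)}(u(x,t)-\sigma)\,dx$ for $t>0$. A classical solution of Problem $P$ is a pair $(u,s)$ such that: (i) $u(x,t)$ is defined, continuous and has continuous partial derivatives $u_x,u_t,u_{xx}$ in the domain $\{(x,t): 0\le x\le s(t),\ t\ge 0\}$ (one-sided derivatives at the boundary); (ii) $s\in C^1([0,\infty))$ and $s(t)>0$ for $t\ge 0$; (iii) conditions (P1)–(P5) hold. $\mathbb{N}=\{1,2,\dots\}$. $C^m((0,T])$ denotes the functions having continuous derivatives up to order $m$ on $(0,T]$ (one-sided at $T$). *)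

theory Defs
  imports "HOL-Analysis.Analysis"
begin

(* Derivatives are taken within S, so they are one-sided at those endpoints of an interval S
   that belong to S; d i is the i-th derivative of g on S. *)
definition C_diff_on :: "nat \<Rightarrow> (real \<Rightarrow> real) \<Rightarrow> real set \<Rightarrow> bool" where
  "C_diff_on k g S \<longleftrightarrow>
     (\<exists>d :: nat \<Rightarrow> real \<Rightarrow> real.
        (\<forall>x\<in>S. d 0 x = g x) \<and>
        (\<forall>i<k. \<forall>x\<in>S. (d i has_real_derivative d (Suc i) x) (at x within S)) \<and>
        (\<forall>i\<le>k. continuous_on S (d i)))"

definition C_infinity_on :: "(real \<Rightarrow> real) \<Rightarrow> real set \<Rightarrow> bool" where
  "C_infinity_on g S \<longleftrightarrow> (\<forall>k. C_diff_on k g S)"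

definition free_domain :: "(real \<Rightarrow> real) \<Rightarrow> (real \<times> real) set" where
  "free_domain s = {(x, t). 0 \<le> x \<and> x \<le> s t \<and> 0 \<le> t}"

(* ux, ut, uxx are the partial derivatives of u on the closed domain, continuous up to the
   boundary; each is the derivative along the slice of the domain through the point, hence
   one-sided where the slice is.  At a boundary point (s t, t) the vertical slice
   {r. 0 <= r, s t <= s r} may have t as an isolated point; the difference quotient then imposes
   nothing, and ut is determined there by its continuity on the domain. *)
definition has_partials ::
  "(real \<Rightarrow> real \<Rightarrow> real) \<Rightarrow> (real \<Rightarrow> real) \<Rightarrow> (real \<Rightarrow> real \<Rightarrow> real) \<Rightarrow>
   (real \<Rightarrow> real \<Rightarrow> real) \<Rightarrow> (real \<Rightarrow> real \<Rightarrow> real) \<Rightarrow> bool" where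
  "has_partials u s ux ut uxx \<longleftrightarrow>
     continuous_on (free_domain s) (\<lambda>(x, t). ux x t) \<and>
     continuous_on (free_domain s) (\<lambda>(x, t). ut x t) \<and>
     continuous_on (free_domain s) (\<lambda>(x, t). uxx x t) \<and>
     (\<forall>(x, t)\<in>free_domain s.
        ((\<lambda>y. u y t) has_real_derivative ux x t) (at x within {y. (y, t) \<in> free_domain s}) \<and>
        ((\<lambda>r. u x r) has_real_derivative ut x t) (at t within {r. (x, r) \<in> free_domain s}) \<and>
        ((\<lambda>y. ux y t) has_real_derivative uxx x t) (at x within {y. (y, t) \<in> free_domain s}))"

(* The data f and \<phi> enter only through their values on [0,\<infinity>) and [0,b], and u only
   through its values on the closed domain. *)
definition classical_solution ::
  "real \<Rightarrow> real \<Rightarrow> real \<Rightarrow> (real \<Rightarrow> real) \<Rightarrow> (real \<Rightarrow> real) \<Rightarrow>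
   (real \<Rightarrow> real \<Rightarrow> real) \<Rightarrow> (real \<Rightarrow> real) \<Rightarrow> bool" where
  "classical_solution lam sig b f \<phi> u s \<longleftrightarrow>
     C_diff_on 1 s {0..} \<and> (\<forall>t\<ge>0. s t > 0) \<and>
     continuous_on (free_domain s) (\<lambda>(x, t). u x t) \<and>
     (\<exists>ux ut uxx. has_partials u s ux ut uxx \<and>
        (\<forall>t>0. \<forall>x. 0 < x \<and> x < s t \<longrightarrow> ut x t = uxx x t - lam * u x t) \<and>
        (\<forall>t>0. ux (s t) t = 0)) \<and>
     (\<forall>t\<ge>0. u 0 t = f t) \<and>
     (\<forall>x\<in>{0..b}. u x 0 = \<phi> x) \<and> s 0 = b \<and>
     (\<forall>t>0. (s has_real_derivative integral {0..s t} (\<lambda>x. u x t - sig)) (at t))"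

end

theory Submission
  imports Defs
begin

text \<open>
  Write \<open>g t = u (s t) t\<close> for the temperature at the front and \<open>n t = ux 0 t\<close> for the flux at the fixed wall.
  Differentiating the total mass, which equals \<open>s' + sig * s\<close>, and integrating the heat equation gives
  \<open>n = s' * g - lam * (s' + sig * s) - (s'' + sig * s')\<close> (lemma \<open>mass_balance\<close>).  So if \<open>s\<close> has \<open>m + 2\<close>
  continuous derivatives and \<open>g\<close> has \<open>m\<close>, then \<open>n\<close> has \<open>m\<close>.  What remains is one regularity
  principle for the heat equation, used at the front (zero flux, moving boundary) to get \<open>g\<close> and at the wall
  (flux \<open>n\<close>, fixed boundary) to get \<open>f\<close>: on a boundary curve of class \<open>C^(k+1)\<close> carrying
  flux of class \<open>C^k\<close>, the boundary temperature is of class \<open>C^k\<close> at all positive times, whatever the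
  initial values.  This is theorem \<open>neumann_to_dirichlet\<close>.

  Its proof is classical potential theory.  After multiplication by \<open>exp (lam * t)\<close> the solution satisfies
  the pure heat equation.  Green's identity with the heat kernel centred at a boundary point expresses the boundary
  temperature \<open>w\<close> by an Abel type Volterra equation of the second kind.  Its data are the potential of the
  initial values, the potential of a far curve at distance \<open>d\<close>, and a weakly singular integral of the flux; its kernel
  is \<open>1 / sqrt (t - \<tau>)\<close> times a smooth function of the difference quotients of the boundary curve.

  The substitution \<open>\<tau> = t * (cos \<phi>)\<^sup>2\<close> removes the singularity, and for \<open>x t = sqrt t * w t\<close> the
  equation becomes \<open>x = volterra_op \<kappa> x + q\<close>, where the operator averages dilates of \<open>x\<close>.
  Dilations commute with the Euler derivative \<open>t * d/dt\<close>, so the Euler derivative of \<open>x\<close> solves the same equation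
  with a new right-hand side, and induction on the order gives all of them (theorem \<open>volterra_regular\<close>).
  Working with \<open>t * d/dt\<close> instead of \<open>d/dt\<close> is what makes cut-off functions unnecessary: the potential of the initial
  values is in general not differentiable at \<open>t = 0\<close>, but \<open>sqrt t\<close> times it has continuous Euler derivatives of
  all the orders that the curve permits.
\<close>

section \<open>Functions of class $C^k$\<close>

text \<open>This recursion replaces the explicit list of derivatives in the definition, so that closure properties
  can be proved by induction on the order.\<close>

lemma C_diff_on_Suc_iff:
  "C_diff_on (Suc k) g S \<longleftrightarrow>
     (\<exists>g'. (\<forall>x\<in>S. (g has_real_derivative g' x) (at x within S)) \<and> C_diff_on k g' S)"
proof
  assume "C_diff_on (Suc k) g S"
  then obtain d where d0: "\<forall>x\<in>S. d 0 x = g x"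
    and d: "\<forall>i<Suc k. \<forall>x\<in>S. (d i has_real_derivative d (Suc i) x) (at x within S)"
    and c: "\<forall>i\<le>Suc k. continuous_on S (d i)"
    unfolding C_diff_on_def by blast
  have "(g has_real_derivative d 1 x) (at x within S)" if "x \<in> S" for x
  proof (rule has_field_derivative_transform_within[where d=1])
    show "(d 0 has_real_derivative d 1 x) (at x within S)" using d that by auto
  qed (use d0 that in auto)
  moreover have "C_diff_on k (d 1) S"
    unfolding C_diff_on_def by (rule exI[of _ "\<lambda>i. d (Suc i)"]) (use d c in auto)
  ultimately show "\<exists>g'. (\<forall>x\<in>S. (g has_real_derivative g' x) (at x within S)) \<and> C_diff_on k g' S"
    by blast
next
  assume "\<exists>g'. (\<forall>x\<in>S. (g has_real_derivative g' x) (at x within S)) \<and> C_diff_on k g' S"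
  then obtain g' d where g': "\<forall>x\<in>S. (g has_real_derivative g' x) (at x within S)"
    and d0: "\<forall>x\<in>S. d 0 x = g' x"
    and d: "\<forall>i<k. \<forall>x\<in>S. (d i has_real_derivative d (Suc i) x) (at x within S)"
    and c: "\<forall>i\<le>k. continuous_on S (d i)"
    unfolding C_diff_on_def by blast
  define e where "e = (\<lambda>i. case i of 0 \<Rightarrow> g | Suc j \<Rightarrow> d j)"
  have "continuous_on S g"
    using g' DERIV_continuous_on by blast
  then have "\<forall>i\<le>Suc k. continuous_on S (e i)"
    using c by (auto simp: e_def split: nat.split)
  moreover have "\<forall>i<Suc k. \<forall>x\<in>S. (e i has_real_derivative e (Suc i) x) (at x within S)"
    using d g' d0 by (auto simp: e_def split: nat.split)
  ultimately show "C_diff_on (Suc k) g S"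
    unfolding C_diff_on_def by (intro exI[of _ e]) (auto simp: e_def)
qed

lemma C_diff_on_0_iff: "C_diff_on 0 g S \<longleftrightarrow> continuous_on S g"
proof
  assume "C_diff_on 0 g S"
  then obtain d where "\<forall>x\<in>S. d 0 x = g x" "continuous_on S (d (0::nat))"
    unfolding C_diff_on_def by blast
  then show "continuous_on S g"
    using continuous_on_cong by fastforce
next
  assume "continuous_on S g"
  then show "C_diff_on 0 g S"
    unfolding C_diff_on_def by (intro exI[of _ "\<lambda>_. g"]) auto
qed

lemma C_diff_on_SucI:
  assumes "\<And>x. x \<in> S \<Longrightarrow> (g has_real_derivative g' x) (at x within S)" "C_diff_on k g' S"
  shows "C_diff_on (Suc k) g S"
  using assms C_diff_on_Suc_iff by blast

lemma C_diff_on_cont: "C_diff_on k g S \<Longrightarrow> continuous_on S g"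
  by (cases k) (auto simp: C_diff_on_0_iff C_diff_on_Suc_iff intro: DERIV_continuous_on)

lemma C_diff_on_le: "C_diff_on k g S \<Longrightarrow> j \<le> k \<Longrightarrow> C_diff_on j g S"
  unfolding C_diff_on_def
proof (elim exE conjE, intro exI conjI)
  fix d :: "nat \<Rightarrow> real \<Rightarrow> real"
  assume "j \<le> k" "\<forall>i<k. \<forall>x\<in>S. (d i has_real_derivative d (Suc i) x) (at x within S)"
  then show "\<forall>i<j. \<forall>x\<in>S. (d i has_real_derivative d (Suc i) x) (at x within S)"
    using order_less_le_trans by blast
qed auto

lemma C_diff_on_Suc_imp: "C_diff_on (Suc k) g S \<Longrightarrow> C_diff_on k g S"
  by (rule C_diff_on_le) auto

lemma C_diff_on_subset: "C_diff_on k g S \<Longrightarrow> S' \<subseteq> S \<Longrightarrow> C_diff_on k g S'"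
  unfolding C_diff_on_def
proof (elim exE conjE, intro exI conjI)
  fix d :: "nat \<Rightarrow> real \<Rightarrow> real"
  assume "S' \<subseteq> S" "\<forall>i<k. \<forall>x\<in>S. (d i has_real_derivative d (Suc i) x) (at x within S)"
  then show "\<forall>i<k. \<forall>x\<in>S'. (d i has_real_derivative d (Suc i) x) (at x within S')"
    using DERIV_subset by blast
qed (auto intro: continuous_on_subset)

lemma C_diff_on_cong: "(\<And>x. x \<in> S \<Longrightarrow> g x = h x) \<Longrightarrow> C_diff_on k g S \<Longrightarrow> C_diff_on k h S"
  unfolding C_diff_on_def by metis

lemma C_diff_on_const: "C_diff_on k (\<lambda>_. c) S"
proof (induction k arbitrary: c)
  case (Suc k)
  show ?case by (rule C_diff_on_SucI[where g'="\<lambda>_. 0"]) (auto intro: Suc)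
qed (simp add: C_diff_on_0_iff)

lemma C_diff_on_add:
  "C_diff_on k g S \<Longrightarrow> C_diff_on k h S \<Longrightarrow> C_diff_on k (\<lambda>x. g x + h x) S"
proof (induction k arbitrary: g h)
  case (Suc k)
  obtain g' where g': "\<And>x. x \<in> S \<Longrightarrow> (g has_real_derivative g' x) (at x within S)" "C_diff_on k g' S"
    using Suc.prems(1) unfolding C_diff_on_Suc_iff by auto
  obtain h' where h': "\<And>x. x \<in> S \<Longrightarrow> (h has_real_derivative h' x) (at x within S)" "C_diff_on k h' S"
    using Suc.prems(2) unfolding C_diff_on_Suc_iff by auto
  show ?case
    by (rule C_diff_on_SucI[where g'="\<lambda>x. g' x + h' x"]) (auto intro: DERIV_add g' h' Suc.IH)
qed (simp add: C_diff_on_0_iff continuous_on_add)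

lemma C_diff_on_mult:
  "C_diff_on k g S \<Longrightarrow> C_diff_on k h S \<Longrightarrow> C_diff_on k (\<lambda>x. g x * h x) S"
proof (induction k arbitrary: g h)
  case (Suc k)
  obtain g' where g': "\<And>x. x \<in> S \<Longrightarrow> (g has_real_derivative g' x) (at x within S)" "C_diff_on k g' S"
    using Suc.prems(1) unfolding C_diff_on_Suc_iff by auto
  obtain h' where h': "\<And>x. x \<in> S \<Longrightarrow> (h has_real_derivative h' x) (at x within S)" "C_diff_on k h' S"
    using Suc.prems(2) unfolding C_diff_on_Suc_iff by auto
  have "C_diff_on k g S" "C_diff_on k h S" using Suc.prems C_diff_on_Suc_imp by auto
  then show ?case
    by (intro C_diff_on_SucI[where g'="\<lambda>x. g' x * h x + h' x * g x"] DERIV_mult g' h' C_diff_on_add Suc.IH)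
qed (simp add: C_diff_on_0_iff continuous_on_mult)

lemma C_diff_on_cmult: "C_diff_on k g S \<Longrightarrow> C_diff_on k (\<lambda>x. c * g x) S"
  by (intro C_diff_on_mult C_diff_on_const)

lemma C_diff_on_diff:
  "C_diff_on k g S \<Longrightarrow> C_diff_on k h S \<Longrightarrow> C_diff_on k (\<lambda>x. g x - h x) S"
  using C_diff_on_add[of k g S "\<lambda>x. (-1) * h x"] C_diff_on_cmult[of k h S "-1"] by simp

lemma C_diff_on_exp_linear: "C_diff_on k (\<lambda>x. exp (a * x)) S"
proof (induction k)
  case (Suc k)
  show ?case
    by (rule C_diff_on_SucI[where g'="\<lambda>x. a * exp (a * x)"])
      (auto intro!: derivative_eq_intros C_diff_on_cmult Suc)
qed (auto simp: C_diff_on_0_iff intro!: continuous_intros)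

lemma C_diff_on_powr: "S \<subseteq> {0<..} \<Longrightarrow> C_diff_on k (\<lambda>x. x powr a) S"
proof (induction k arbitrary: a)
  case (Suc k)
  show ?case
    by (rule C_diff_on_SucI[where g'="\<lambda>x. a * x powr (a - 1)"])
      (use Suc.prems in \<open>auto intro!: derivative_eq_intros C_diff_on_cmult Suc\<close>)
qed (auto simp: C_diff_on_0_iff intro!: continuous_intros)

lemma C_diff_on_shift:
  "C_diff_on k g S \<Longrightarrow> C_diff_on k (\<lambda>x. g (x + a)) ((\<lambda>x. x - a) ` S)"
proof (induction k arbitrary: g)
  case 0
  then show ?case
    by (auto simp: C_diff_on_0_iff intro!: continuous_on_compose2[where f="\<lambda>x. x + a" and g=g] continuous_intros)
next
  case (Suc k)
  obtain g' where g': "\<And>x. x \<in> S \<Longrightarrow> (g has_real_derivative g' x) (at x within S)" "C_diff_on k g' S"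
    using Suc.prems(1) unfolding C_diff_on_Suc_iff by auto
  show ?case
  proof (rule C_diff_on_SucI)
    fix x assume x: "x \<in> (\<lambda>x. x - a) ` S"
    have im: "(\<lambda>x. x + a) ` (\<lambda>x. x - a) ` S = S" by (auto simp: image_image)
    have "(g \<circ> (\<lambda>x. x + a) has_real_derivative g' (x + a) * 1) (at x within (\<lambda>x. x - a) ` S)"
    proof (rule DERIV_image_chain)
      show "(g has_real_derivative g' (x + a)) (at (x + a) within (\<lambda>x. x + a) ` (\<lambda>x. x - a) ` S)"
        unfolding im using x by (intro g') auto
    qed (auto intro!: derivative_eq_intros)
    then show "((\<lambda>x. g (x + a)) has_real_derivative g' (x + a)) (at x within (\<lambda>x. x - a) ` S)"
      by (simp add: o_def)
  qed (rule Suc.IH[OF g'(2)])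
qed

text \<open>The local derivatives can be glued because derivatives are unique; the second hypothesis
  excludes isolated points, where they are not.\<close>

lemma C_diff_on_local:
  assumes "\<And>x. x \<in> S \<Longrightarrow> \<exists>U. open U \<and> x \<in> U \<and> C_diff_on k g (S \<inter> U)"
    and lim: "\<And>x. x \<in> S \<Longrightarrow> at x within S \<noteq> bot"
  shows "C_diff_on k g S"
  using assms(1)
proof (induction k arbitrary: g)
  case 0
  show ?case unfolding C_diff_on_0_iff continuous_on_eq_continuous_within
  proof
    fix x assume x: "x \<in> S"
    then obtain U where U: "open U" "x \<in> U" "continuous_on (S \<inter> U) g"
      using 0 C_diff_on_0_iff by blast
    then have "continuous (at x within S \<inter> U) g"
      using x continuous_on_eq_continuous_within by blast
    moreover have "at x within S \<inter> U = at x within S"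
      using U by (metis at_within_nhd inf_assoc inf_idem)
    ultimately show "continuous (at x within S) g" by simp
  qed
next
  case (Suc k)
  have "\<exists>U d. open U \<and> x \<in> U \<and> (\<forall>y\<in>S \<inter> U. (g has_real_derivative d y) (at y within S \<inter> U)) \<and> C_diff_on k d (S \<inter> U)"
    if "x \<in> S" for x
    using Suc.prems[OF that] unfolding C_diff_on_Suc_iff by blast
  then obtain U d where U: "\<And>x. x \<in> S \<Longrightarrow> open (U x)" "\<And>x. x \<in> S \<Longrightarrow> x \<in> U x"
    and d: "\<And>x y. x \<in> S \<Longrightarrow> y \<in> S \<inter> U x \<Longrightarrow> (g has_real_derivative d x y) (at y within S \<inter> U x)"
    and C: "\<And>x. x \<in> S \<Longrightarrow> C_diff_on k (d x) (S \<inter> U x)"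
    by metis
  have dS: "(g has_real_derivative d x y) (at y within S)" if "x \<in> S" "y \<in> S \<inter> U x" for x y
  proof -
    have "at y within S \<inter> U x = at y within S"
      using U that by (metis Int_iff at_within_nhd inf_assoc inf_idem)
    then show ?thesis using d[OF that] by simp
  qed
  have eq: "d x y = d y y" if "x \<in> S" "y \<in> S \<inter> U x" for x y
  proof (rule has_field_derivative_unique)
    show "at y within S \<noteq> bot" using lim that by auto
    show "(g has_real_derivative d x y) (at y within S)" using dS that by auto
    show "(g has_real_derivative d y y) (at y within S)" using dS[of y y] that U by auto
  qed
  show ?case
  proof (rule C_diff_on_SucI)
    show "(g has_real_derivative d x x) (at x within S)" if "x \<in> S" for x
      using dS[of x x] U that by auto
    show "C_diff_on k (\<lambda>x. d x x) S"
    proof (rule Suc.IH)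
      fix x assume x: "x \<in> S"
      have "C_diff_on k (\<lambda>x. d x x) (S \<inter> U x)"
        by (rule C_diff_on_cong[OF _ C[OF x]]) (use eq x in auto)
      then show "\<exists>U. open U \<and> x \<in> U \<and> C_diff_on k (\<lambda>x. d x x) (S \<inter> U)"
        using U x by blast
    qed
  qed
qed

text \<open>Parabolic smoothing acts only after the initial time, so regularity is available on windows that are
  open on the left.  A window may end at \<open>T\<close>, which preserves the one-sided derivatives there; all other points are covered
  by the interior of a window.\<close>

lemma C_diff_on_from_windows:
  assumes T: "0 < T"
    and win: "\<And>a. 0 < a \<Longrightarrow> \<exists>\<epsilon>>0. \<forall>t0 L. a \<le> t0 \<longrightarrow> 0 < L \<longrightarrow> L \<le> \<epsilon> \<longrightarrow> t0 + L \<le> T \<longrightarrow>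
      C_diff_on k (\<lambda>\<tau>. F (t0 + \<tau>)) {0<..L}"
  shows "C_diff_on k F {0<..T}"
proof (rule C_diff_on_local)
  fix t assume t: "t \<in> {0<..T}"
  obtain \<epsilon> where \<epsilon>: "\<epsilon> > 0" and w: "\<And>t0 L. t/2 \<le> t0 \<Longrightarrow> 0 < L \<Longrightarrow> L \<le> \<epsilon> \<Longrightarrow> t0 + L \<le> T \<Longrightarrow>
      C_diff_on k (\<lambda>\<tau>. F (t0 + \<tau>)) {0<..L}"
    using win[of "t/2"] t by auto
  define L where "L = min \<epsilon> (t/2)"
  \<comment> \<open>The window ends at \<open>e\<close>: strictly after \<open>t\<close>, except when that would leave the interval.\<close>
  define e where "e = min T (t + L/2)"
  define t0 where "t0 = e - L"
  have L: "0 < L" "L \<le> \<epsilon>" "L \<le> t/2" using \<epsilon> t by (auto simp: L_def)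
  have e: "t \<le> e" "e \<le> T" "e \<le> t + L/2" using t L by (auto simp: e_def)
  have "C_diff_on k (\<lambda>\<tau>. F (t0 + \<tau>)) {0<..L}" using w L e by (auto simp: t0_def)
  from C_diff_on_shift[OF this, of "- t0"]
  have "C_diff_on k F ((\<lambda>x. x - - t0) ` {0<..L})" by simp
  then have C: "C_diff_on k F {t0<..e}"
    by (rule C_diff_on_subset) (auto simp: t0_def intro!: image_eqI[where x="_ - (e - L)"])
  define U where "U = (if e = T then {t0<..} else {t0<..<e})"
  have "open U" "t \<in> U" using e L t by (auto simp: U_def t0_def e_def min_def split: if_splits)
  moreover have "C_diff_on k F ({0<..T} \<inter> U)"
    by (rule C_diff_on_subset[OF C]) (auto simp: U_def split: if_splits)
  ultimately show "\<exists>U. open U \<and> t \<in> U \<and> C_diff_on k F ({0<..T} \<inter> U)" by blast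
next
  fix t assume "t \<in> {0<..T}"
  then show "at t within {0<..T} \<noteq> bot" by (auto simp: trivial_limit_within)
qed

section \<open>The Euler derivative\<close>

text \<open>\<open>a'\<close> is \<open>t * d/dt\<close> of \<open>a\<close>, for each value of a parameter \<open>p\<close>.  The value \<open>0\<close> required at
  \<open>t = 0\<close> makes the relation stable under the dilation by the factor \<open>0\<close>, whose result is constant in time.\<close>

definition euler_deriv ::
  "real \<Rightarrow> 'p set \<Rightarrow> (real \<Rightarrow> 'p \<Rightarrow> real) \<Rightarrow> (real \<Rightarrow> 'p \<Rightarrow> real) \<Rightarrow> bool" where
  "euler_deriv L R a a' \<longleftrightarrow>
     (\<forall>p\<in>R. a' 0 p = 0 \<and>
        (\<forall>t\<in>{0<..L}. ((\<lambda>t. a t p) has_real_derivative a' t p / t) (at t within {0<..L})))"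

text \<open>Joint continuity up to \<open>t = 0\<close> of the iterated Euler derivatives, the parameter included: this is what
  differentiation under an integral over the parameter needs.\<close>

primrec euler_C :: "nat \<Rightarrow> real \<Rightarrow> 'p::topological_space set \<Rightarrow> (real \<Rightarrow> 'p \<Rightarrow> real) \<Rightarrow> bool" where
  "euler_C 0 L R a \<longleftrightarrow> continuous_on ({0..L} \<times> R) (\<lambda>(t, p). a t p)"
| "euler_C (Suc k) L R a \<longleftrightarrow> continuous_on ({0..L} \<times> R) (\<lambda>(t, p). a t p) \<and>
     (\<exists>a'. euler_deriv L R a a' \<and> euler_C k L R a')"

lemma euler_C_SucI:
  "continuous_on ({0..L} \<times> R) (\<lambda>(t, p). a t p) \<Longrightarrow> euler_deriv L R a a' \<Longrightarrow> euler_C k L R a'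
    \<Longrightarrow> euler_C (Suc k) L R a"
  by auto

lemma euler_C_cont: "euler_C k L R a \<Longrightarrow> continuous_on ({0..L} \<times> R) (\<lambda>(t, p). a t p)"
  by (cases k) auto

lemma euler_C_Suc_imp: "euler_C (Suc k) L R a \<Longrightarrow> euler_C k L R a"
proof (induction k arbitrary: a)
  case (Suc k)
  then show ?case by (metis euler_C.simps(2))
qed simp

lemma euler_deriv_add:
  "euler_deriv L R a a' \<Longrightarrow> euler_deriv L R b b' \<Longrightarrow> euler_deriv L R (\<lambda>t p. a t p + b t p) (\<lambda>t p. a' t p + b' t p)"
  unfolding euler_deriv_def by (auto simp: add_divide_distrib intro!: DERIV_add)

lemma euler_C_add:
  "euler_C k L R a \<Longrightarrow> euler_C k L R b \<Longrightarrow> euler_C k L R (\<lambda>t p. a t p + b t p)"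
proof (induction k arbitrary: a b)
  case 0
  then show ?case by (auto simp: case_prod_unfold intro!: continuous_intros)
next
  case (Suc k)
  obtain a' b' where a': "euler_deriv L R a a'" "euler_C k L R a'"
    and b': "euler_deriv L R b b'" "euler_C k L R b'"
    using Suc.prems by auto
  have "euler_deriv L R (\<lambda>t p. a t p + b t p) (\<lambda>t p. a' t p + b' t p)"
    using a'(1) b'(1) by (rule euler_deriv_add)
  moreover have "continuous_on ({0..L} \<times> R) (\<lambda>(t, p). a t p + b t p)"
    using Suc.prems by (auto simp: case_prod_unfold intro!: continuous_intros)
  ultimately show ?case using Suc.IH[OF a'(2) b'(2)] by (intro euler_C_SucI)
qed

lemma euler_deriv_mult:
  assumes "euler_deriv L R a a'" "euler_deriv L R b b'"
  shows "euler_deriv L R (\<lambda>t p. a t p * b t p) (\<lambda>t p. a' t p * b t p + b' t p * a t p)"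
  unfolding euler_deriv_def
proof (intro ballI conjI)
  fix p t assume "p \<in> R" "t \<in> {0<..L}"
  then have "((\<lambda>t. a t p * b t p) has_real_derivative a' t p / t * b t p + b' t p / t * a t p) (at t within {0<..L})"
    using assms unfolding euler_deriv_def by (intro DERIV_mult) auto
  then show "((\<lambda>t. a t p * b t p) has_real_derivative (a' t p * b t p + b' t p * a t p) / t) (at t within {0<..L})"
    by (simp add: add_divide_distrib)
qed (use assms in \<open>auto simp: euler_deriv_def\<close>)

lemma euler_C_mult:
  "euler_C k L R a \<Longrightarrow> euler_C k L R b \<Longrightarrow> euler_C k L R (\<lambda>t p. a t p * b t p)"
proof (induction k arbitrary: a b)
  case 0
  then show ?case by (auto simp: case_prod_unfold intro!: continuous_intros)
next
  case (Suc k)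
  obtain a' b' where a': "euler_deriv L R a a'" "euler_C k L R a'"
    and b': "euler_deriv L R b b'" "euler_C k L R b'"
    using Suc.prems by auto
  have "continuous_on ({0..L} \<times> R) (\<lambda>(t, p). a t p * b t p)"
    using Suc.prems by (auto simp: case_prod_unfold intro!: continuous_intros)
  moreover have "euler_C k L R (\<lambda>t p. a' t p * b t p + b' t p * a t p)"
    by (intro euler_C_add Suc.IH a' b' euler_C_Suc_imp[OF Suc.prems(1)] euler_C_Suc_imp[OF Suc.prems(2)])
  ultimately show ?case using euler_deriv_mult[OF a'(1) b'(1)] by (intro euler_C_SucI)
qed

lemma euler_C_const_in_time: "continuous_on R b \<Longrightarrow> euler_C k L R (\<lambda>t. b)"
proof (induction k arbitrary: b)
  case 0
  then show ?case
    by (auto simp: case_prod_unfold intro!: continuous_on_compose2[OF _ continuous_on_snd[OF continuous_on_id]])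
next
  case (Suc k)
  have "continuous_on ({0..L} \<times> R) (\<lambda>(t, p). b p)"
    using Suc.prems
    by (auto simp: case_prod_unfold intro!: continuous_on_compose2[OF _ continuous_on_snd[OF continuous_on_id]])
  moreover have "euler_deriv L R (\<lambda>t. b) (\<lambda>t p. 0)"
    unfolding euler_deriv_def by auto
  moreover have "euler_C k L R (\<lambda>t. (\<lambda>p. 0))" by (rule Suc.IH) auto
  ultimately show ?case by (rule euler_C_SucI)
qed

lemma euler_C_const: "euler_C k L R (\<lambda>_ _. c)"
  by (rule euler_C_const_in_time) (rule continuous_on_const)

lemma euler_C_cmult: "euler_C k L R a \<Longrightarrow> euler_C k L R (\<lambda>t p. c * a t p)"
  using euler_C_mult[OF euler_C_const_in_time[of R "\<lambda>_. c"]] by simp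

lemma euler_C_diff:
  "euler_C k L R a \<Longrightarrow> euler_C k L R b \<Longrightarrow> euler_C k L R (\<lambda>t p. a t p - b t p)"
  using euler_C_add[of k L R a "\<lambda>t p. (-1) * b t p"] euler_C_cmult[of k L R b "-1"] by simp

lemma euler_C_time: "euler_C k L R (\<lambda>t p. t)"
proof (induction k)
  case (Suc k)
  show ?case
    by (rule euler_C_SucI[OF _ _ Suc])
      (auto simp: euler_deriv_def case_prod_unfold intro!: continuous_intros derivative_eq_intros)
qed (auto simp: case_prod_unfold intro!: continuous_intros)

lemma euler_deriv_sqrt: "euler_deriv L R (\<lambda>t p. sqrt t) (\<lambda>t p. (1/2) * sqrt t)"
  unfolding euler_deriv_def
proof (intro ballI conjI)
  fix p t assume "t \<in> {0<..L}"
  moreover have "sqrt t / (2 * t) = inverse (sqrt t) / 2" if "t > 0"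
    using that by (simp add: field_simps)
  ultimately show "(sqrt has_real_derivative 1 / 2 * sqrt t / t) (at t within {0<..L})"
    by (auto intro!: derivative_eq_intros)
qed auto

lemma euler_C_sqrt: "euler_C k L R (\<lambda>t p. sqrt t)"
proof (induction k)
  case (Suc k)
  have "continuous_on ({0..L} \<times> R) (\<lambda>(t, p). sqrt t)"
    by (auto simp: case_prod_unfold intro!: continuous_intros)
  then show ?case
    using euler_deriv_sqrt euler_C_cmult[OF Suc, of "1/2"] by (rule euler_C_SucI)
qed (auto simp: case_prod_unfold intro!: continuous_intros)

lemma euler_C_exp: "euler_C k L R a \<Longrightarrow> euler_C k L R (\<lambda>t p. exp (a t p))"
proof (induction k)
  case 0
  then show ?case by (auto simp: case_prod_unfold intro!: continuous_intros)
next
  case (Suc k)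
  obtain a' where a': "euler_deriv L R a a'" "euler_C k L R a'" using Suc.prems by auto
  have "euler_deriv L R (\<lambda>t p. exp (a t p)) (\<lambda>t p. exp (a t p) * a' t p)"
    using a'(1) unfolding euler_deriv_def by (auto intro!: derivative_eq_intros)
  moreover have "continuous_on ({0..L} \<times> R) (\<lambda>(t, p). exp (a t p))"
    using Suc.prems by (auto simp: case_prod_unfold intro!: continuous_intros)
  moreover have "euler_C k L R (\<lambda>t p. exp (a t p) * a' t p)"
    by (intro euler_C_mult a' Suc.IH euler_C_Suc_imp[OF Suc.prems])
  ultimately show ?case by (intro euler_C_SucI)
qed

lemma continuous_on_dilate:
  assumes "continuous_on R h" "\<And>p. p \<in> R \<Longrightarrow> h p \<in> {0..1}"
    and "continuous_on R j" "\<And>p. p \<in> R \<Longrightarrow> j p \<in> R'"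
    and "continuous_on ({0..L::real} \<times> R') (\<lambda>(t, p). a t p)"
  shows "continuous_on ({0..L} \<times> R) (\<lambda>(t, p). a (t * h p) (j p))"
proof -
  have "continuous_on ({0..L} \<times> R) (\<lambda>(t, p). (t * h p, j p))"
    unfolding case_prod_unfold
    by (intro continuous_intros continuous_on_compose2[OF assms(1)] continuous_on_compose2[OF assms(3)]) auto
  moreover have "(\<lambda>(t, p). (t * h p, j p)) ` ({0..L} \<times> R) \<subseteq> {0..L} \<times> R'"
  proof clarsimp
    fix t p assume "0 \<le> t" "t \<le> L" "p \<in> R"
    with assms(2)[of p] assms(4)[of p] show "0 \<le> t * h p \<and> t * h p \<le> L \<and> j p \<in> R'"
      using mult_left_le[of "h p" t] by auto
  qed
  ultimately have "continuous_on ({0..L} \<times> R) ((\<lambda>(t, p). a t p) \<circ> (\<lambda>(t, p). (t * h p, j p)))"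
    using assms(5) by (intro continuous_on_compose) (auto intro: continuous_on_subset)
  then show ?thesis by (simp add: o_def case_prod_unfold)
qed

text \<open>Scaling invariance of \<open>t * d/dt\<close>: it commutes with \<open>t \<mapsto> t * h\<close>, and no factor \<open>h\<close>
  appears.\<close>

lemma euler_deriv_dilate:
  assumes h: "\<And>p. p \<in> R \<Longrightarrow> h p \<in> {0..1}" and j: "\<And>p. p \<in> R \<Longrightarrow> j p \<in> R'"
    and a': "euler_deriv L R' a a'"
  shows "euler_deriv L R (\<lambda>t p. a (t * h p) (j p)) (\<lambda>t p. a' (t * h p) (j p))"
  unfolding euler_deriv_def
proof (intro ballI conjI)
  fix p assume p: "p \<in> R"
  show "a' (0 * h p) (j p) = 0" using a' j[OF p] by (auto simp: euler_deriv_def)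
  fix t assume t: "t \<in> {0<..L}"
  show "((\<lambda>t. a (t * h p) (j p)) has_real_derivative a' (t * h p) (j p) / t) (at t within {0<..L})"
  proof (cases "h p = 0")
    case True
    then show ?thesis using a' j[OF p] by (auto simp: euler_deriv_def)
  next
    case False
    then have hp: "h p > 0" "h p \<le> 1" using h[OF p] by auto
    have sub: "(\<lambda>t. t * h p) ` {0<..L} \<subseteq> {0<..L}"
    proof clarsimp
      fix x assume "0 < x" "x \<le> L"
      then show "0 < x * h p \<and> x * h p \<le> L"
        using hp mult_left_le[of "h p" x] by (metis linorder_not_less mult_pos_pos order.strict_implies_order order_trans)
    qed
    then have m: "t * h p \<in> {0<..L}" using t by blast
    have "((\<lambda>t. a t (j p)) \<circ> (\<lambda>t. t * h p) has_real_derivative a' (t * h p) (j p) / (t * h p) * h p) (at t within {0<..L})"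
    proof (rule DERIV_image_chain)
      have "((\<lambda>t. a t (j p)) has_real_derivative a' (t * h p) (j p) / (t * h p)) (at (t * h p) within {0<..L})"
        using a' j[OF p] m unfolding euler_deriv_def by blast
      then show "((\<lambda>t. a t (j p)) has_real_derivative a' (t * h p) (j p) / (t * h p))
         (at (t * h p) within (\<lambda>t. t * h p) ` {0<..L})"
        by (rule DERIV_subset[OF _ sub])
    qed (auto intro!: derivative_eq_intros)
    then show ?thesis using hp by (simp add: o_def)
  qed
qed

lemma euler_C_dilate:
  assumes "continuous_on R h" "\<And>p. p \<in> R \<Longrightarrow> h p \<in> {0..1}"
    and "continuous_on R j" "\<And>p. p \<in> R \<Longrightarrow> j p \<in> R'"
  shows "euler_C k L R' a \<Longrightarrow> euler_C k L R (\<lambda>t p. a (t * h p) (j p))"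
proof (induction k arbitrary: a)
  case 0
  then show ?case using continuous_on_dilate[OF assms] by simp
next
  case (Suc k)
  obtain a' where a': "euler_deriv L R' a a'" "euler_C k L R' a'" using Suc.prems by auto
  show ?case
    using Suc.prems by (intro euler_C_SucI[OF continuous_on_dilate[OF assms] euler_deriv_dilate[OF assms(2,4) a'(1)] Suc.IH[OF a'(2)]]) auto
qed

lemma continuous_on_integral_param:
  fixes R :: "'p::topological_space set" and x y :: real
  assumes "continuous_on ({0..L::real} \<times> (R \<times> {x..y})) (\<lambda>(t, p). a t p :: real)"
  shows "continuous_on ({0..L} \<times> R) (\<lambda>(t, p). integral {x..y} (\<lambda>v. a t (p, v)))"
proof -
  have "continuous_on (({0..L} \<times> R) \<times> cbox x y) (\<lambda>(tp, v). a (fst tp) (snd tp, v))"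
    unfolding case_prod_unfold
    by (rule continuous_on_compose2[OF assms[unfolded case_prod_unfold],
          where f="\<lambda>q. (fst (fst q), snd (fst q), snd q)", simplified])
      (auto intro!: continuous_intros)
  from integral_continuous_on_param[OF this] show ?thesis
    by (simp add: case_prod_unfold)
qed

lemma euler_deriv_integral:
  fixes R :: "'p::topological_space set" and x y :: real
  assumes a': "euler_deriv L (R \<times> {x..y}) a a'"
    and ca: "continuous_on ({0..L} \<times> (R \<times> {x..y})) (\<lambda>(t, p). a t p)"
    and ca': "continuous_on ({0..L} \<times> (R \<times> {x..y})) (\<lambda>(t, p). a' t p)"
  shows "euler_deriv L R (\<lambda>t p. integral {x..y} (\<lambda>v. a t (p, v))) (\<lambda>t p. integral {x..y} (\<lambda>v. a' t (p, v)))"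
  unfolding euler_deriv_def
proof (intro ballI conjI)
  fix p assume p: "p \<in> R"
  show "integral {x..y} (\<lambda>v. a' 0 (p, v)) = 0"
  proof -
    have "integral {x..y} (\<lambda>v. a' 0 (p, v)) = integral {x..y} (\<lambda>v. 0)"
      using a' p by (intro Henstock_Kurzweil_Integration.integral_cong) (auto simp: euler_deriv_def)
    then show ?thesis by simp
  qed
  fix t assume t: "t \<in> {0<..L}"
  have "((\<lambda>t. integral (cbox x y) (\<lambda>v. a t (p, v))) has_field_derivative
      integral (cbox x y) (\<lambda>v. a' t (p, v) / t)) (at t within {0<..L})"
  proof (rule leibniz_rule_field_derivative)
    show "(\<lambda>v. a s (p, v)) integrable_on cbox x y" if "s \<in> {0<..L}" for s
      using that p
      by (intro integrable_continuous continuous_on_compose2[OF ca[unfolded case_prod_unfold],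
          where f="\<lambda>v. (s, p, v)", simplified]) (auto intro!: continuous_intros)
    show "continuous_on ({0<..L} \<times> cbox x y) (\<lambda>(t, v). a' t (p, v) / t)"
      unfolding case_prod_unfold using p
      by (intro continuous_on_divide continuous_on_compose2[OF ca'[unfolded case_prod_unfold],
          where f="\<lambda>q. (fst q, p, snd q)", simplified]) (auto intro!: continuous_intros)
  qed (use a' p t in \<open>auto simp: euler_deriv_def\<close>)
  then show "((\<lambda>t. integral {x..y} (\<lambda>v. a t (p, v))) has_real_derivative
      integral {x..y} (\<lambda>v. a' t (p, v)) / t) (at t within {0<..L})"
    by simp
qed

lemma euler_C_integral:
  fixes R :: "'p::topological_space set" and x y :: real
  shows "euler_C k L (R \<times> {x..y}) a \<Longrightarrow>
    euler_C k L R (\<lambda>t p. integral {x..y} (\<lambda>v. a t (p, v)))"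
proof (induction k arbitrary: a)
  case 0
  then show ?case using continuous_on_integral_param by simp
next
  case (Suc k)
  obtain a' where a': "euler_deriv L (R \<times> {x..y}) a a'" "euler_C k L (R \<times> {x..y}) a'"
    using Suc.prems by auto
  have "euler_deriv L R (\<lambda>t p. integral {x..y} (\<lambda>v. a t (p, v))) (\<lambda>t p. integral {x..y} (\<lambda>v. a' t (p, v)))"
    using a' Suc.prems euler_C_cont by (intro euler_deriv_integral) blast+
  then show ?case using Suc.prems a' by (intro euler_C_SucI[OF continuous_on_integral_param _ Suc.IH]) auto
qed

lemma C_diff_on_imp_euler_C:
  "C_diff_on k c {0..L} \<Longrightarrow> euler_C k L R (\<lambda>t p. c t)"
proof (induction k arbitrary: c)
  have cont: "continuous_on ({0..L} \<times> R) (\<lambda>(t, p). c t)" if "continuous_on {0..L} c" for c :: "real \<Rightarrow> real"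
    unfolding case_prod_unfold
    by (rule continuous_on_compose2[OF that]) (auto intro!: continuous_intros)
  { case 0 then show ?case using cont by (simp add: C_diff_on_0_iff) }
  case (Suc k)
  obtain c' where c': "\<forall>x\<in>{0..L}. (c has_real_derivative c' x) (at x within {0..L})"
    "C_diff_on k c' {0..L}" using Suc.prems unfolding C_diff_on_Suc_iff by blast
  have "euler_deriv L R (\<lambda>t p. c t) (\<lambda>t p. t * c' t)"
    unfolding euler_deriv_def by (auto intro!: DERIV_subset[OF c'(1)[rule_format]])
  moreover have "euler_C k L R (\<lambda>t p. t * c' t)"
    by (intro euler_C_mult euler_C_time Suc.IH c')
  ultimately show ?case
    using cont[OF C_diff_on_cont[OF Suc.prems]] by (intro euler_C_SucI)
qed

lemma euler_C_imp_C_diff_on: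
  "euler_C k L R a \<Longrightarrow> p \<in> R \<Longrightarrow> C_diff_on k (\<lambda>t. a t p) {0<..L}"
proof (induction k arbitrary: a)
  case 0
  then have "continuous_on {0<..L} ((\<lambda>(t, p). a t p) \<circ> (\<lambda>t. (t, p)))"
    by (intro continuous_on_compose) (auto intro!: continuous_intros elim: continuous_on_subset)
  then show ?case by (simp add: C_diff_on_0_iff o_def)
next
  case (Suc k)
  obtain a' where a': "euler_deriv L R a a'" "euler_C k L R a'" using Suc.prems by auto
  show ?case
  proof (rule C_diff_on_SucI)
    show "((\<lambda>t. a t p) has_real_derivative t powr (-1) * a' t p) (at t within {0<..L})"
      if "t \<in> {0<..L}" for t
      using a'(1) Suc.prems(2) that by (auto simp: euler_deriv_def powr_minus divide_inverse mult.commute)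
    show "C_diff_on k (\<lambda>t. t powr (-1) * a' t p) {0<..L}"
      by (intro C_diff_on_mult C_diff_on_powr Suc.IH a' Suc.prems) auto
  qed
qed

section \<open>A dilation-invariant Volterra equation\<close>

text \<open>With \<open>\<tau> = t * (cos \<phi>)\<^sup>2\<close> one has \<open>d\<phi> = d\<tau> / (2 * sqrt (\<tau> * (t - \<tau>)))\<close> up to orientation.
  So this is the Abel type operator with kernel \<open>1 / sqrt (t - \<tau>)\<close>, conjugated by multiplication with \<open>sqrt t\<close>, without a
  singular integrand.\<close>

definition volterra_op :: "(real \<Rightarrow> real \<Rightarrow> real) \<Rightarrow> (real \<Rightarrow> real) \<Rightarrow> real \<Rightarrow> real" where
  "volterra_op \<kappa> x t = sqrt t * integral {0..pi/2} (\<lambda>\<phi>. \<kappa> t \<phi> * x (t * (cos \<phi>)\<^sup>2))"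

lemma cos_sq_le1: "(cos (\<phi>::real))\<^sup>2 \<le> 1"
  by (simp add: cos_squared_eq)

lemma dilate_mem: "t \<in> {0..L} \<Longrightarrow> t * (cos \<phi>)\<^sup>2 \<in> {0..L}" for t L \<phi> :: real
  using mult_left_le[of "(cos \<phi>)\<^sup>2" t] cos_sq_le1[of \<phi>] by auto

lemma euler_C_volterra:
  assumes "euler_C k L {0..pi/2} \<kappa>" "euler_C k L UNIV (\<lambda>t (_::real). x t)"
  shows "euler_C k L (R::real set) (\<lambda>t _. volterra_op \<kappa> x t)"
proof -
  have "euler_C k L (R \<times> {0..pi/2}) (\<lambda>t q. \<kappa> (t * 1) (snd q))"
    by (rule euler_C_dilate[OF _ _ _ _ assms(1)]) (auto intro!: continuous_intros)
  moreover have "euler_C k L (R \<times> {0..pi/2}) (\<lambda>t q. x (t * (cos (snd q))\<^sup>2))"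
    by (rule euler_C_dilate[OF _ _ _ _ assms(2), where j="\<lambda>q. 0"])
      (auto intro!: continuous_intros cos_sq_le1)
  ultimately have "euler_C k L (R \<times> {0..pi/2}) (\<lambda>t q. \<kappa> t (snd q) * x (t * (cos (snd q))\<^sup>2))"
    using euler_C_mult by fastforce
  from euler_C_mult[OF euler_C_sqrt euler_C_integral[OF this]] show ?thesis
    by (simp add: volterra_op_def)
qed

lemma continuous_time:
  "continuous_on {0..L} x \<longleftrightarrow> euler_C 0 L (UNIV::real set) (\<lambda>t _. x t)" for x :: "real \<Rightarrow> real"
proof
  assume x: "continuous_on {0..L} x"
  show "euler_C 0 L (UNIV::real set) (\<lambda>t _. x t)"
    by (auto simp: case_prod_unfold intro!: continuous_on_compose2[OF x] continuous_intros)
next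
  assume "euler_C 0 L (UNIV::real set) (\<lambda>t _. x t)"
  then have "continuous_on ({0..L} \<times> UNIV) (\<lambda>q::real\<times>real. x (fst q))" by (simp add: case_prod_unfold)
  moreover have "continuous_on {0..L} (\<lambda>t::real. (t, 0::real))" by (intro continuous_intros)
  ultimately have "continuous_on {0..L} (\<lambda>t. x (fst (t, 0::real)))"
    by (rule continuous_on_compose2) auto
  then show "continuous_on {0..L} x" by simp
qed

lemma continuous_on_volterra:
  assumes "continuous_on ({0..L} \<times> {0..pi/2}) (\<lambda>(t, \<phi>). \<kappa> t \<phi>)" "continuous_on {0..L} x"
  shows "continuous_on {0..L} (volterra_op \<kappa> x)"
proof -
  have "euler_C 0 L (UNIV::real set) (\<lambda>t _. volterra_op \<kappa> x t)"
    using assms euler_C_volterra[of 0 L \<kappa> x UNIV] continuous_time[of L x] by simp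
  then show ?thesis using continuous_time[of L "volterra_op \<kappa> x"] by blast
qed

lemma volterra_integrable:
  fixes \<kappa> :: "real \<Rightarrow> real \<Rightarrow> real"
  assumes "continuous_on ({0..L} \<times> {0..pi/2}) (\<lambda>(t, \<phi>). \<kappa> t \<phi>)" "continuous_on {0..L} x" "t \<in> {0..L}"
  shows "(\<lambda>\<phi>. \<kappa> t \<phi> * x (t * (cos \<phi>)\<^sup>2)) integrable_on {0..pi/2}"
proof -
  have "continuous_on {0..pi/2} (\<lambda>\<phi>. (\<lambda>(t, \<phi>). \<kappa> t \<phi>) (t, \<phi>))"
    using assms(3) by (intro continuous_on_compose2[OF assms(1)]) (auto intro!: continuous_intros)
  then have "continuous_on {0..pi/2} (\<lambda>\<phi>. \<kappa> t \<phi>)" by simp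
  moreover have "continuous_on {0..pi/2} (\<lambda>\<phi>. x (t * (cos \<phi>)\<^sup>2))"
    using dilate_mem[OF assms(3)]
    by (intro continuous_on_compose2[OF assms(2)]) (auto intro!: continuous_intros)
  ultimately have "continuous_on {0..pi/2} (\<lambda>\<phi>. \<kappa> t \<phi> * x (t * (cos \<phi>)\<^sup>2))"
    by (rule continuous_on_mult)
  then show ?thesis by (rule integrable_continuous_real)
qed

lemma volterra_diff:
  assumes "continuous_on ({0..L} \<times> {0..pi/2}) (\<lambda>(t, \<phi>). \<kappa> t \<phi>)"
    "continuous_on {0..L} x" "continuous_on {0..L} y" "t \<in> {0..L}"
  shows "volterra_op \<kappa> (\<lambda>t. x t - y t) t = volterra_op \<kappa> x t - volterra_op \<kappa> y t"
  unfolding volterra_op_def right_diff_distrib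
    Henstock_Kurzweil_Integration.integral_diff
      [OF volterra_integrable[OF assms(1,2,4)] volterra_integrable[OF assms(1,3,4)]] ..

text \<open>The factor \<open>sqrt L\<close> makes the operator a contraction on short time intervals.\<close>

lemma volterra_bound:
  assumes \<kappa>: "continuous_on ({0..L} \<times> {0..pi/2}) (\<lambda>(t, \<phi>). \<kappa> t \<phi>)"
    and x: "continuous_on {0..L} x" and t: "t \<in> {0..L}"
    and B: "\<And>\<phi>. \<phi> \<in> {0..pi/2} \<Longrightarrow> \<bar>\<kappa> t \<phi>\<bar> \<le> B" and M: "\<And>s. s \<in> {0..L} \<Longrightarrow> \<bar>x s\<bar> \<le> M"
  shows "\<bar>volterra_op \<kappa> x t\<bar> \<le> sqrt L * (pi/2) * B * M"
proof -
  have B0: "0 \<le> B" using order_trans[OF abs_ge_zero B[of 0]] by simp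
  have M0: "0 \<le> M" using M[OF t] by linarith
  have "norm (integral {0..pi/2} (\<lambda>\<phi>. \<kappa> t \<phi> * x (t * (cos \<phi>)\<^sup>2))) \<le> integral {0..pi/2} (\<lambda>_. B * M)"
  proof (rule integral_norm_bound_integral[OF volterra_integrable[OF \<kappa> x t]])
    fix \<phi> :: real assume "\<phi> \<in> {0..pi/2}"
    then show "norm (\<kappa> t \<phi> * x (t * (cos \<phi>)\<^sup>2)) \<le> B * M"
      using B M[OF dilate_mem[OF t]] B0 by (auto simp: abs_mult intro!: mult_mono)
  qed auto
  then have "norm (integral {0..pi/2} (\<lambda>\<phi>. \<kappa> t \<phi> * x (t * (cos \<phi>)\<^sup>2))) \<le> (pi/2) * (B * M)"
    by (simp add: mult_ac)
  moreover have "sqrt t \<le> sqrt L" "0 \<le> sqrt t" using t by auto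
  ultimately have "sqrt t * norm (integral {0..pi/2} (\<lambda>\<phi>. \<kappa> t \<phi> * x (t * (cos \<phi>)\<^sup>2))) \<le> sqrt L * ((pi/2) * (B * M))"
    by (intro mult_mono) auto
  then show ?thesis using t by (simp add: volterra_op_def abs_mult mult.assoc)
qed

lemma euler_deriv_eq:
  "euler_deriv L R a a' \<Longrightarrow> (\<And>t p. t \<in> {0<..L} \<Longrightarrow> p \<in> R \<Longrightarrow> a' t p = b' t p) \<Longrightarrow> (\<And>p. p \<in> R \<Longrightarrow> b' 0 p = 0)
    \<Longrightarrow> euler_deriv L R a b'"
  unfolding euler_deriv_def by auto

text \<open>The product rule: the Euler derivative falls on the dilated function, on the kernel, and on \<open>sqrt t\<close>.\<close>

lemma euler_deriv_volterra:
  fixes x y :: "real \<Rightarrow> real"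
  assumes \<kappa>: "continuous_on ({0..L} \<times> {0..pi/2}) (\<lambda>(t, \<phi>). \<kappa> t \<phi>)"
      "continuous_on ({0..L} \<times> {0..pi/2}) (\<lambda>(t, \<phi>). \<kappa>' t \<phi>)" "euler_deriv L {0..pi/2} \<kappa> \<kappa>'"
    and x: "continuous_on {0..L} x" "continuous_on {0..L} y"
    and d: "euler_deriv L (UNIV::real set) (\<lambda>t _. x t) (\<lambda>t _. y t)"
  shows "euler_deriv L (UNIV::real set) (\<lambda>t _. volterra_op \<kappa> x t)
     (\<lambda>t _. volterra_op \<kappa> y t + (volterra_op \<kappa>' x t + volterra_op \<kappa> x t / 2))"
proof -
  let ?R = "(UNIV::real set) \<times> {0..pi/2}"
  have c: "continuous_on ({0..L} \<times> ?R) (\<lambda>(t, q). k t (snd q))"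
    if "continuous_on ({0..L} \<times> {0..pi/2}) (\<lambda>(t, \<phi>). k t \<phi>)" for k :: "real \<Rightarrow> real \<Rightarrow> real"
    using continuous_on_dilate[OF _ _ _ _ that, of ?R "\<lambda>_. 1" snd] by (auto simp: continuous_intros)
  have cx: "continuous_on ({0..L} \<times> ?R) (\<lambda>(t, q). z (t * (cos (snd q))\<^sup>2))"
    if "continuous_on {0..L} z" for z :: "real \<Rightarrow> real"
    using dilate_mem by (auto simp: case_prod_unfold intro!: continuous_on_compose2[OF that] continuous_intros)
  have e1: "euler_deriv L ?R (\<lambda>t q. \<kappa> (t * 1) (snd q)) (\<lambda>t q. \<kappa>' (t * 1) (snd q))"
    by (rule euler_deriv_dilate[OF _ _ \<kappa>(3)]) auto
  have e2: "euler_deriv L ?R (\<lambda>t q. x (t * (cos (snd q))\<^sup>2)) (\<lambda>t q. y (t * (cos (snd q))\<^sup>2))"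
    by (rule euler_deriv_dilate[OF _ _ d, where j="\<lambda>_. 0"]) (auto intro: cos_sq_le1)
  have "euler_deriv L ?R (\<lambda>t q. \<kappa> t (snd q) * x (t * (cos (snd q))\<^sup>2))
     (\<lambda>t q. \<kappa>' t (snd q) * x (t * (cos (snd q))\<^sup>2) + y (t * (cos (snd q))\<^sup>2) * \<kappa> t (snd q))"
    using euler_deriv_mult[OF e1 e2] by simp
  moreover have "continuous_on ({0..L} \<times> ?R) (\<lambda>(t, q). \<kappa> t (snd q) * x (t * (cos (snd q))\<^sup>2))"
    using continuous_on_mult[OF c[OF \<kappa>(1)] cx[OF x(1)]] by (simp add: case_prod_unfold)
  moreover have "continuous_on ({0..L} \<times> ?R)
      (\<lambda>(t, q). \<kappa>' t (snd q) * x (t * (cos (snd q))\<^sup>2) + y (t * (cos (snd q))\<^sup>2) * \<kappa> t (snd q))"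
    using continuous_on_add[OF continuous_on_mult[OF c[OF \<kappa>(2)] cx[OF x(1)]] continuous_on_mult[OF cx[OF x(2)] c[OF \<kappa>(1)]]]
    by (simp add: case_prod_unfold)
  ultimately have "euler_deriv L (UNIV::real set)
      (\<lambda>t p. integral {0..pi/2} (\<lambda>\<phi>. \<kappa> t \<phi> * x (t * (cos \<phi>)\<^sup>2)))
      (\<lambda>t p. integral {0..pi/2} (\<lambda>\<phi>. \<kappa>' t \<phi> * x (t * (cos \<phi>)\<^sup>2) + y (t * (cos \<phi>)\<^sup>2) * \<kappa> t \<phi>))"
    using euler_deriv_integral by fastforce
  from euler_deriv_mult[OF euler_deriv_sqrt this]
  have "euler_deriv L (UNIV::real set) (\<lambda>t _. volterra_op \<kappa> x t)
    (\<lambda>t _. 1 / 2 * sqrt t * integral {0..pi/2} (\<lambda>\<phi>. \<kappa> t \<phi> * x (t * (cos \<phi>)\<^sup>2)) +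
       integral {0..pi/2} (\<lambda>\<phi>. \<kappa>' t \<phi> * x (t * (cos \<phi>)\<^sup>2) + y (t * (cos \<phi>)\<^sup>2) * \<kappa> t \<phi>) * sqrt t)"
    by (simp add: volterra_op_def)
  then show ?thesis
  proof (rule euler_deriv_eq)
    fix t assume "t \<in> {0<..L}"
    then have t: "t \<in> {0..L}" by simp
    have "integral {0..pi/2} (\<lambda>\<phi>. \<kappa>' t \<phi> * x (t * (cos \<phi>)\<^sup>2) + y (t * (cos \<phi>)\<^sup>2) * \<kappa> t \<phi>)
      = integral {0..pi/2} (\<lambda>\<phi>. \<kappa>' t \<phi> * x (t * (cos \<phi>)\<^sup>2))
      + integral {0..pi/2} (\<lambda>\<phi>. \<kappa> t \<phi> * y (t * (cos \<phi>)\<^sup>2))"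
      using volterra_integrable[OF \<kappa>(2) x(1) t] volterra_integrable[OF \<kappa>(1) x(2) t]
      by (simp add: Henstock_Kurzweil_Integration.integral_add mult.commute)
    then show "1 / 2 * sqrt t * integral {0..pi/2} (\<lambda>\<phi>. \<kappa> t \<phi> * x (t * (cos \<phi>)\<^sup>2)) +
       integral {0..pi/2} (\<lambda>\<phi>. \<kappa>' t \<phi> * x (t * (cos \<phi>)\<^sup>2) + y (t * (cos \<phi>)\<^sup>2) * \<kappa> t \<phi>) * sqrt t
      = volterra_op \<kappa> y t + (volterra_op \<kappa>' x t + volterra_op \<kappa> x t / 2)"
      by (simp add: volterra_op_def algebra_simps)
  qed (simp add: volterra_op_def)
qed

lemma volterra_tendsto:
  assumes \<kappa>: "continuous_on ({0..L} \<times> {0..pi/2}) (\<lambda>(t, \<phi>). \<kappa> t \<phi>)"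
    and X: "\<And>n::nat. continuous_on {0..L} (X n)" and u: "uniform_limit {0..L} X x sequentially" and t: "t \<in> {0..L}"
  shows "(\<lambda>n. volterra_op \<kappa> (X n) t) \<longlonglongrightarrow> volterra_op \<kappa> x t"
proof -
  have x: "continuous_on {0..L} x"
    using uniform_limit_theorem[OF _ u] X by simp
  have "compact ((\<lambda>(t, \<phi>). \<kappa> t \<phi>) ` ({0..L} \<times> {0..pi/2}))"
    by (intro compact_continuous_image[OF \<kappa>] compact_Times) auto
  then obtain B where B: "\<And>t \<phi>. t \<in> {0..L} \<Longrightarrow> \<phi> \<in> {0..pi/2} \<Longrightarrow> \<bar>\<kappa> t \<phi>\<bar> \<le> B" and B0: "B > 0"
    using compact_imp_bounded[THEN bounded_pos[THEN iffD1]] by fastforce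
  define K where "K = sqrt L * (pi/2) * B"
  have K0: "K \<ge> 0" using B0 t by (auto simp: K_def)
  show ?thesis
  proof (rule LIMSEQ_I)
    fix e :: real assume e: "e > 0"
    define \<delta> where "\<delta> = e / (2 * (K + 1))"
    have \<delta>: "\<delta> > 0" using e K0 by (simp add: \<delta>_def)
    obtain N where N: "\<And>n s. n \<ge> N \<Longrightarrow> s \<in> {0..L} \<Longrightarrow> dist (X n s) (x s) < \<delta>"
      using uniform_limitD[OF u \<delta>] unfolding eventually_sequentially by blast
    show "\<exists>no. \<forall>n\<ge>no. norm (volterra_op \<kappa> (X n) t - volterra_op \<kappa> x t) < e"
    proof (intro exI allI impI)
      fix n assume n: "n \<ge> N"
      have "\<bar>volterra_op \<kappa> (\<lambda>t. X n t - x t) t\<bar> \<le> sqrt L * (pi/2) * B * \<delta>"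
        using N[OF n] B t by (intro volterra_bound[OF \<kappa>] continuous_on_diff X x) (auto simp: dist_real_def intro: less_imp_le)
      also have "\<dots> = K * \<delta>" by (simp add: K_def)
      also have "\<dots> < e" using K0 e by (simp add: \<delta>_def field_simps) (smt (verit) mult_nonneg_nonneg)
      finally show "norm (volterra_op \<kappa> (X n) t - volterra_op \<kappa> x t) < e"
        using volterra_diff[OF \<kappa> X x t] by simp
    qed
  qed
qed

lemma uniform_limit_geometric:
  assumes "\<And>t. t \<in> S \<Longrightarrow> Y 0 t = (0::real)" "0 \<le> r" "r < 1"
    and "\<And>n t. t \<in> S \<Longrightarrow> \<bar>Y (Suc n) t - Y n t\<bar> \<le> C * r ^ n"
  obtains y where "uniform_limit S Y y sequentially"
proof -
  have "uniform_limit S (\<lambda>n t. \<Sum>i<n. (Y (Suc i) t - Y i t)) (\<lambda>t. suminf (\<lambda>i. Y (Suc i) t - Y i t)) sequentially"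
    by (rule Weierstrass_m_test[where M="\<lambda>n. C * r ^ n"])
      (use assms in \<open>auto intro!: summable_mult summable_geometric\<close>)
  moreover have "(\<Sum>i<n. (Y (Suc i) t - Y i t)) = Y n t" if "t \<in> S" for n t
    using assms(1)[OF that] by (induction n) auto
  ultimately have "uniform_limit S Y (\<lambda>t. suminf (\<lambda>i. Y (Suc i) t - Y i t)) sequentially"
    by (subst (asm) uniform_limit_cong'[where g=Y]) auto
  then show ?thesis using that by blast
qed

lemma euler_deriv_uniform_limit:
  assumes u: "uniform_limit {0..L} X x sequentially" "uniform_limit {0..L} Y y sequentially"
    and d: "\<And>n. euler_deriv L (UNIV::real set) (\<lambda>t _. X n t) (\<lambda>t _. Y n t)" and L: "0 \<le> L"
  shows "euler_deriv L (UNIV::real set) (\<lambda>t _. x t) (\<lambda>t _. y t)"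
  unfolding euler_deriv_def
proof (intro ballI conjI)
  have Xx: "(\<lambda>n. X n t) \<longlonglongrightarrow> x t" and Yy: "(\<lambda>n. Y n t) \<longlonglongrightarrow> y t" if "t \<in> {0..L}" for t
    using that u by (auto intro: tendsto_uniform_limitI)
  have "Y n 0 = 0" for n using d[of n] by (auto simp: euler_deriv_def)
  then show "y 0 = 0" using Yy[of 0] L by (auto simp: LIMSEQ_const_iff)
  fix t assume t: "t \<in> {0<..L}"
  define S where "S = {t/2<..L}"
  have tS: "t \<in> S" and S0: "S \<subseteq> {0<..L}" using t by (auto simp: S_def)
  have "\<exists>g. \<forall>s\<in>S. (\<lambda>n. X n s) \<longlonglongrightarrow> g s \<and> (g has_derivative (\<lambda>h. y s / s * h)) (at s within S)"
  proof (rule has_derivative_sequence[OF _ _ _ tS])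
    show "(X n has_derivative (\<lambda>h. Y n s / s * h)) (at s within S)" if "s \<in> S" for n s
    proof -
      have "(X n has_real_derivative Y n s / s) (at s within {0<..L})"
        using d[of n] that S0 by (auto simp: euler_deriv_def)
      from DERIV_subset[OF this S0] show ?thesis by (simp only: has_field_derivative_def)
    qed
    show "\<forall>\<^sub>F n in sequentially. \<forall>s\<in>S. \<forall>h. norm (Y n s / s * h - y s / s * h) \<le> e * norm h" if "e > 0" for e
    proof -
      have "\<forall>\<^sub>F n in sequentially. \<forall>s\<in>{0..L}. dist (Y n s) (y s) < e * (t/2)"
        using t that by (intro uniform_limitD[OF u(2)]) auto
      then show ?thesis
      proof eventually_elim
        case (elim n)
        show ?case
        proof (intro ballI allI)
          fix s h assume s: "s \<in> S"
          then have s': "s > 0" "t/2 \<le> s" "s \<in> {0..L}" using t by (auto simp: S_def)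
          then have "\<bar>Y n s - y s\<bar> \<le> e * (t/2)" using elim by (auto simp: dist_real_def less_imp_le)
          also have "\<dots> \<le> e * s" using s' that by (intro mult_left_mono) auto
          finally have "\<bar>Y n s - y s\<bar> / s \<le> e" using s' by (simp add: field_simps)
          then have "\<bar>(Y n s - y s) / s\<bar> * \<bar>h\<bar> \<le> e * \<bar>h\<bar>" using s' by (intro mult_right_mono) auto
          moreover have "Y n s / s * h - y s / s * h = (Y n s - y s) / s * h" by (simp add: diff_divide_distrib left_diff_distrib)
          ultimately show "norm (Y n s / s * h - y s / s * h) \<le> e * norm h"
            by (simp only: abs_mult real_norm_def)
        qed
      qed
    qed
    show "(\<lambda>n. X n t) \<longlonglongrightarrow> x t" using t by (intro Xx) auto
  qed (auto simp: S_def)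
  then obtain g where g: "\<And>s. s \<in> S \<Longrightarrow> (\<lambda>n. X n s) \<longlonglongrightarrow> g s"
    "\<And>s. s \<in> S \<Longrightarrow> (g has_derivative (\<lambda>h. y s / s * h)) (at s within S)" by blast
  have "g s = x s" if "s \<in> S" for s using LIMSEQ_unique[OF g(1)[OF that] Xx] that S0 by auto
  then have "(x has_derivative (\<lambda>h. y t / t * h)) (at t within S)"
    by (intro has_derivative_transform[OF tS _ g(2)[OF tS]]) auto
  moreover have "at t within S = at t within {0<..L}"
    by (rule at_within_nhd[of t "{t/2<..}"]) (use t in \<open>auto simp: S_def\<close>)
  ultimately show "(x has_real_derivative y t / t) (at t within {0<..L})"
    by (simp only: has_field_derivative_def)
qed

text \<open>Nothing is known about differentiability of \<open>x\<close> beforehand, so it is obtained as the limit of the Picard iterates \<open>X\<close>.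
  Their Euler derivatives \<open>Y\<close> satisfy a Picard recursion of their own, and both converge uniformly.\<close>

lemma volterra_regular_step:
  fixes x q q' :: "real \<Rightarrow> real"
  assumes L: "0 \<le> L"
    and \<kappa>: "continuous_on ({0..L} \<times> {0..pi/2}) (\<lambda>(t, \<phi>). \<kappa> t \<phi>)"
      "continuous_on ({0..L} \<times> {0..pi/2}) (\<lambda>(t, \<phi>). \<kappa>' t \<phi>)" "euler_deriv L {0..pi/2} \<kappa> \<kappa>'"
    and B: "\<And>t \<phi>. t \<in> {0..L} \<Longrightarrow> \<phi> \<in> {0..pi/2} \<Longrightarrow> \<bar>\<kappa> t \<phi>\<bar> \<le> B" "sqrt L * (pi/2) * B \<le> 1/2"
    and q: "continuous_on {0..L} q" "continuous_on {0..L} q'"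
      "euler_deriv L (UNIV::real set) (\<lambda>t _. q t) (\<lambda>t _. q' t)"
    and x: "continuous_on {0..L} x" "\<And>t. t \<in> {0..L} \<Longrightarrow> x t = volterra_op \<kappa> x t + q t"
  obtains y where "continuous_on {0..L} y" "euler_deriv L (UNIV::real set) (\<lambda>t _. x t) (\<lambda>t _. y t)"
    "\<And>t. t \<in> {0..L} \<Longrightarrow> y t = volterra_op \<kappa> y t + (volterra_op \<kappa>' x t + volterra_op \<kappa> x t / 2 + q' t)"
proof -
  define X where "X = rec_nat (\<lambda>_. 0) (\<lambda>n x t. volterra_op \<kappa> x t + q t)"
  have X0: "X 0 t = 0" and XS: "X (Suc n) t = volterra_op \<kappa> (X n) t + q t" for n t by (auto simp: X_def)
  define Y where "Y = rec_nat (\<lambda>_. 0)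
     (\<lambda>n y t. volterra_op \<kappa> y t + (volterra_op \<kappa>' (X n) t + volterra_op \<kappa> (X n) t / 2 + q' t))"
  have Y0: "Y 0 t = 0" and YS: "Y (Suc n) t = volterra_op \<kappa> (Y n) t
      + (volterra_op \<kappa>' (X n) t + volterra_op \<kappa> (X n) t / 2 + q' t)" for n t by (auto simp: Y_def)
  have cX: "continuous_on {0..L} (X n)" for n
  proof (induction n)
    case (Suc n)
    have "continuous_on {0..L} (\<lambda>t. volterra_op \<kappa> (X n) t + q t)"
      by (intro continuous_on_add continuous_on_volterra \<kappa> Suc q)
    moreover have "X (Suc n) = (\<lambda>t. volterra_op \<kappa> (X n) t + q t)" using XS by blast
    ultimately show ?case by simp
  qed (simp add: X_def)
  have cY: "continuous_on {0..L} (Y n)" for n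
  proof (induction n)
    case (Suc n)
    have "continuous_on {0..L} (\<lambda>t. volterra_op \<kappa> (Y n) t
      + (volterra_op \<kappa>' (X n) t + volterra_op \<kappa> (X n) t / 2 + q' t))"
      by (intro continuous_on_add continuous_on_divide continuous_on_const continuous_on_volterra \<kappa> Suc q cX) auto
    moreover have "Y (Suc n) = (\<lambda>t. volterra_op \<kappa> (Y n) t
      + (volterra_op \<kappa>' (X n) t + volterra_op \<kappa> (X n) t / 2 + q' t))" using YS by blast
    ultimately show ?case by simp
  qed (simp add: Y_def)
  have dXY: "euler_deriv L (UNIV::real set) (\<lambda>t _. X n t) (\<lambda>t _. Y n t)" for n
  proof (induction n)
    case 0
    show ?case by (simp add: euler_deriv_def X0 Y0)
  next
    case (Suc n)
    show ?case
      using euler_deriv_add[OF euler_deriv_volterra[OF \<kappa> cX cY Suc] q(3)] by (simp add: XS YS add.assoc)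
  qed
  have half: "\<bar>volterra_op \<kappa> z t\<bar> \<le> M / 2"
    if "continuous_on {0..L} z" "\<And>s. s \<in> {0..L} \<Longrightarrow> \<bar>z s\<bar> \<le> M" "t \<in> {0..L}" for z M t
  proof -
    have M: "0 \<le> M" using that(2,3) by (meson abs_ge_zero order_trans)
    have "\<bar>volterra_op \<kappa> z t\<bar> \<le> sqrt L * (pi/2) * B * M"
      using that B by (intro volterra_bound[OF \<kappa>(1)]) auto
    also have "\<dots> \<le> 1/2 * M" by (intro mult_right_mono B M)
    finally show ?thesis by simp
  qed
  have bdd: "\<exists>M\<ge>0. \<forall>t\<in>{0..L}. \<bar>z t\<bar> \<le> M" if "continuous_on {0..L} z" for z :: "real \<Rightarrow> real"
  proof -
    have "bounded (z ` {0..L})" by (intro compact_imp_bounded compact_continuous_image that) auto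
    then show ?thesis unfolding bounded_pos by (auto intro: less_imp_le)
  qed
  obtain M where M: "M \<ge> 0" "\<And>t. t \<in> {0..L} \<Longrightarrow> \<bar>x t\<bar> \<le> M" using bdd[OF x(1)] by blast
  have Xx: "\<bar>X n t - x t\<bar> \<le> M * (1/2) ^ n" if "t \<in> {0..L}" for n t
    using that
  proof (induction n arbitrary: t)
    case 0
    then show ?case using M by (simp add: X0)
  next
    case (Suc n)
    have "X (Suc n) t - x t = volterra_op \<kappa> (\<lambda>t. X n t - x t) t"
      using Suc.prems x volterra_diff[OF \<kappa>(1) cX x(1)] by (simp add: XS)
    also have "\<bar>\<dots>\<bar> \<le> (M * (1/2)^n) / 2"
      using Suc by (intro half continuous_on_diff cX x) auto
    finally show ?case by simp
  qed
  have uX: "uniform_limit {0..L} X x sequentially"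
  proof (rule uniform_limitI)
    fix e :: real assume "e > 0"
    moreover have "(\<lambda>n. M * (1/2) ^ n) \<longlonglongrightarrow> 0"
      by (intro tendsto_mult_right_zero LIMSEQ_power_zero) auto
    ultimately have "\<forall>\<^sub>F n in sequentially. M * (1/2) ^ n < e" using order_tendstoD(2) by blast
    then show "\<forall>\<^sub>F n in sequentially. \<forall>t\<in>{0..L}. dist (X n t) (x t) < e"
    proof eventually_elim
      case (elim n)
      then show ?case using Xx[of _ n] by (simp only: dist_real_def) (meson le_less_trans)
    qed
  qed
  have XX: "\<bar>X (Suc n) t - X n t\<bar> \<le> 2 * M * (1/2) ^ n" if "t \<in> {0..L}" for n t
  proof -
    have "M * (1/2) ^ Suc n \<le> M * (1/2) ^ n" using M by (intro mult_left_mono power_decreasing) auto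
    then show ?thesis using Xx[OF that, of n] Xx[OF that, of "Suc n"] by linarith
  qed
  have "compact ((\<lambda>(t, \<phi>). \<kappa>' t \<phi>) ` ({0..L} \<times> {0..pi/2}))"
    by (intro compact_continuous_image[OF \<kappa>(2)] compact_Times) auto
  then obtain B' where B': "\<And>t \<phi>. t \<in> {0..L} \<Longrightarrow> \<phi> \<in> {0..pi/2} \<Longrightarrow> \<bar>\<kappa>' t \<phi>\<bar> \<le> B'" and B'0: "B' > 0"
    using compact_imp_bounded[THEN bounded_pos[THEN iffD1]] by fastforce
  obtain Q where Q: "Q \<ge> 0" "\<And>t. t \<in> {0..L} \<Longrightarrow> \<bar>q' t\<bar> \<le> Q" using bdd[OF q(2)] by blast
  define K where "K = sqrt L * (pi/2) * B' * (2 * M) + M / 2"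
  have K0: "K \<ge> 0" using L B'0 M by (auto simp: K_def)
  define C where "C = 4 * K + Q"
  \<comment> \<open>The recursion for \<open>Y\<close> halves the differences and adds an error of order \<open>(1/2)^n\<close>; the ratio 3/4 absorbs the
  resulting factor \<open>n\<close>.\<close>
  have YY: "\<bar>Y (Suc n) t - Y n t\<bar> \<le> C * (3/4) ^ n" if "t \<in> {0..L}" for n t
    using that
  proof (induction n arbitrary: t)
    case 0
    have "volterra_op k (\<lambda>_. 0) t = 0" for k t by (simp add: volterra_op_def)
    moreover have "X 0 = (\<lambda>_. 0)" "Y 0 = (\<lambda>_. 0)" using X0 Y0 by auto
    ultimately have "Y (Suc 0) t - Y 0 t = q' t" by (simp add: YS)
    moreover have "\<bar>q' t\<bar> \<le> C" using Q(2)[OF 0] K0 by (simp add: C_def)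
    ultimately show ?case by simp
  next
    case (Suc n)
    let ?z = "\<lambda>t. X (Suc n) t - X n t"
    have z: "continuous_on {0..L} ?z" by (intro continuous_on_diff cX)
    have "Y (Suc (Suc n)) t - Y (Suc n) t = volterra_op \<kappa> (\<lambda>t. Y (Suc n) t - Y n t) t
      + (volterra_op \<kappa>' ?z t + volterra_op \<kappa> ?z t / 2)"
      using volterra_diff[OF \<kappa>(1) cY cY Suc.prems, of "Suc n" n]
        volterra_diff[OF \<kappa>(1) cX cX Suc.prems, of "Suc n" n]
        volterra_diff[OF \<kappa>(2) cX cX Suc.prems, of "Suc n" n]
      by (simp only: YS) (simp add: diff_divide_distrib)
    moreover have "\<bar>volterra_op \<kappa> (\<lambda>t. Y (Suc n) t - Y n t) t\<bar> \<le> C * (3/4)^n / 2"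
      using Suc by (intro half continuous_on_diff cY) auto
    moreover have "\<bar>volterra_op \<kappa> ?z t\<bar> \<le> 2 * M * (1/2)^n / 2"
      using Suc.prems XX by (intro half z) auto
    moreover have "\<bar>volterra_op \<kappa>' ?z t\<bar> \<le> sqrt L * (pi/2) * B' * (2 * M * (1/2)^n)"
      using Suc.prems XX B' by (intro volterra_bound[OF \<kappa>(2) z]) auto
    ultimately have "\<bar>Y (Suc (Suc n)) t - Y (Suc n) t\<bar> \<le> C * (3/4)^n / 2 + K * (1/2)^n"
      by (simp add: K_def algebra_simps)
    also have "K * (1/2)^n \<le> (C / 4) * (3/4)^n"
      using K0 Q by (intro mult_mono power_mono) (auto simp: C_def)
    finally show ?case by simp
  qed
  obtain y where uY: "uniform_limit {0..L} Y y sequentially"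
    by (rule uniform_limit_geometric[where S="{0..L}" and Y=Y and r="3/4" and C=C]) (use YY Y0 in auto)
  show thesis
  proof (rule that)
    show "continuous_on {0..L} y" using uniform_limit_theorem[OF _ uY] cY by simp
    show "euler_deriv L (UNIV::real set) (\<lambda>t _. x t) (\<lambda>t _. y t)"
      by (rule euler_deriv_uniform_limit[OF uX uY dXY L])
    fix t assume t: "t \<in> {0..L}"
    have "(\<lambda>n. volterra_op \<kappa> (Y n) t + (volterra_op \<kappa>' (X n) t + volterra_op \<kappa> (X n) t / 2 + q' t))
       \<longlonglongrightarrow> volterra_op \<kappa> y t + (volterra_op \<kappa>' x t + volterra_op \<kappa> x t / 2 + q' t)"
      by (intro tendsto_intros volterra_tendsto[OF \<kappa>(1) cY uY t] volterra_tendsto[OF \<kappa>(1) cX uX t]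
          volterra_tendsto[OF \<kappa>(2) cX uX t]) auto
    moreover have "(\<lambda>n. Y (Suc n) t) \<longlonglongrightarrow> y t"
      by (intro LIMSEQ_Suc tendsto_uniform_limitI[OF uY t])
    ultimately show "y t = volterra_op \<kappa> y t + (volterra_op \<kappa>' x t + volterra_op \<kappa> x t / 2 + q' t)"
      unfolding YS using LIMSEQ_unique by blast
  qed
qed

text \<open>The Euler derivative of a solution solves the same equation, with a right-hand side that involves only
  the solution itself and the derivatives of the data; hence the induction.\<close>

theorem volterra_regular:
  fixes x q :: "real \<Rightarrow> real"
  assumes L: "0 \<le> L"
    and B: "\<And>t \<phi>. t \<in> {0..L} \<Longrightarrow> \<phi> \<in> {0..pi/2} \<Longrightarrow> \<bar>\<kappa> t \<phi>\<bar> \<le> B" "sqrt L * (pi/2) * B \<le> 1/2"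
  shows "euler_C k L {0..pi/2} \<kappa> \<Longrightarrow> euler_C k L (UNIV::real set) (\<lambda>t _. q t) \<Longrightarrow> continuous_on {0..L} x \<Longrightarrow>
    (\<And>t. t \<in> {0..L} \<Longrightarrow> x t = volterra_op \<kappa> x t + q t) \<Longrightarrow> euler_C k L (UNIV::real set) (\<lambda>t _. x t)"
proof (induction k arbitrary: q x)
  case 0
  then show ?case using continuous_time by blast
next
  case (Suc k)
  have \<kappa>: "euler_C k L {0..pi/2} \<kappa>" and q: "euler_C k L (UNIV::real set) (\<lambda>t _. q t)"
    using Suc.prems euler_C_Suc_imp by blast+
  obtain \<kappa>' where \<kappa>': "euler_deriv L {0..pi/2} \<kappa> \<kappa>'" "euler_C k L {0..pi/2} \<kappa>'"
    using Suc.prems(1) by auto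
  obtain q'' where q'': "euler_deriv L (UNIV::real set) (\<lambda>t _. q t) q''" "euler_C k L (UNIV::real set) q''"
    using Suc.prems(2) by auto
  define q' where "q' = (\<lambda>t. q'' t 0)"
  have q'1: "euler_deriv L (UNIV::real set) (\<lambda>t _. q t) (\<lambda>t _. q' t)"
    using q''(1) by (auto simp: euler_deriv_def q'_def)
  have q'2: "euler_C k L (UNIV::real set) (\<lambda>t _. q' t)"
    using euler_C_dilate[OF _ _ _ _ q''(2), of UNIV "\<lambda>_. 1" "\<lambda>_. 0"] by (auto simp: q'_def)
  have cq: "continuous_on {0..L} q" "continuous_on {0..L} q'"
    using euler_C_cont[OF q] euler_C_cont[OF q'2] by (auto simp: continuous_time)
  obtain y where y: "continuous_on {0..L} y" "euler_deriv L (UNIV::real set) (\<lambda>t _. x t) (\<lambda>t _. y t)"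
    "\<And>t. t \<in> {0..L} \<Longrightarrow> y t = volterra_op \<kappa> y t + (volterra_op \<kappa>' x t + volterra_op \<kappa> x t / 2 + q' t)"
    using volterra_regular_step[OF L euler_C_cont[OF \<kappa>] euler_C_cont[OF \<kappa>'(2)] \<kappa>'(1) B cq q'1 Suc.prems(3,4)]
    by blast
  have x: "euler_C k L (UNIV::real set) (\<lambda>t _. x t)"
    using Suc.IH[OF \<kappa> q] Suc.prems(3,4) by blast
  have "euler_C k L (UNIV::real set) (\<lambda>t _. volterra_op \<kappa>' x t + (1/2) * volterra_op \<kappa> x t + q' t)"
    by (intro euler_C_add euler_C_cmult euler_C_volterra \<kappa> \<kappa>' x q'2)
  then have "euler_C k L (UNIV::real set) (\<lambda>t _. y t)"
    using Suc.IH[OF \<kappa> _ y(1), of "\<lambda>t. volterra_op \<kappa>' x t + volterra_op \<kappa> x t / 2 + q' t"] y(3) by simp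
  moreover have "continuous_on ({0..L} \<times> UNIV) (\<lambda>(t, p::real). x t)"
    using Suc.prems(3) continuous_time[of L x] by simp
  ultimately show ?case using y(2) by (intro euler_C_SucI)
qed

section \<open>Heat kernels\<close>

lemma power_times_exp_neg_le:
  fixes x :: real
  assumes "0 \<le> x"
  shows "x ^ n * exp (- x) \<le> fact n"
proof -
  have "(\<Sum>k\<in>{n}. inverse (fact k) *\<^sub>R x ^ k) \<le> (\<Sum>k. inverse (fact k) *\<^sub>R x ^ k)"
    using assms by (intro sum_le_suminf summable_exp_generic) auto
  then have "x ^ n / fact n \<le> exp x" by (simp add: exp_def field_simps)
  then show ?thesis by (simp add: exp_minus field_simps)
qed

text \<open>Apart from a factor \<open>sqrt (4 * pi)\<close>, \<open>heat_ker 0 1\<close> is the fundamental solution of the heat equation.  The powers of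
  \<open>z\<close> and of \<open>1 / sqrt r\<close> make the family closed under differentiation, and the value \<open>0\<close> for
  \<open>r \<le> 0\<close> allows integrals over a fixed time interval in place of \<open>{0..t}\<close>.\<close>

definition heat_ker :: "nat \<Rightarrow> nat \<Rightarrow> real \<Rightarrow> real \<Rightarrow> real" where
  "heat_ker i j z r = (if r \<le> 0 then 0 else z ^ i * exp (- (z\<^sup>2 / (4 * r))) / sqrt r ^ j)"

text \<open>Away from \<open>z = 0\<close> the exponential beats every power of \<open>1 / r\<close>.\<close>

lemma heat_ker_bound:
  assumes "0 < z"
  shows "\<bar>heat_ker i j z r\<bar> \<le> z ^ i * (fact (Suc j) * 4 ^ Suc j / z ^ (2 * Suc j)) * sqrt (max 0 r) ^ (j + 2)"
proof (cases "r > 0")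
  case True
  define x where "x = z\<^sup>2 / (4 * r)"
  have x: "x > 0" using assms True by (simp add: x_def)
  have r: "sqrt r > 0" "(sqrt r)\<^sup>2 = r" using True by auto
  have "exp (- x) \<le> fact (Suc j) / x ^ Suc j"
    using power_times_exp_neg_le[of x "Suc j"] x by (simp add: field_simps)
  also have "x ^ Suc j = z ^ (2 * Suc j) / (4 ^ Suc j * r ^ Suc j)"
    by (simp only: x_def power_divide power_mult_distrib power_mult)
  also have "r ^ Suc j = sqrt r ^ (j + 2) * sqrt r ^ j"
  proof -
    have "r ^ Suc j = sqrt r ^ (2 * Suc j)" by (simp only: power_mult r)
    also have "2 * Suc j = (j + 2) + j" by simp
    finally show ?thesis by (simp only: power_add)
  qed
  finally have e: "exp (- x) \<le> fact (Suc j) * 4 ^ Suc j / z ^ (2 * Suc j) * (sqrt r ^ (j + 2) * sqrt r ^ j)"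
    by (simp add: mult.assoc)
  have "\<bar>heat_ker i j z r\<bar> = z ^ i * exp (- x) / sqrt r ^ j"
    using True assms by (simp add: heat_ker_def x_def abs_mult)
  also have "\<dots> \<le> z ^ i * (fact (Suc j) * 4 ^ Suc j / z ^ (2 * Suc j) * (sqrt r ^ (j + 2) * sqrt r ^ j)) / sqrt r ^ j"
    using assms e True by (intro divide_right_mono mult_left_mono) auto
  also have "\<dots> = z ^ i * (fact (Suc j) * 4 ^ Suc j / z ^ (2 * Suc j)) * sqrt r ^ (j + 2)"
    using r by simp
  finally show ?thesis using True by simp
qed (use assms in \<open>simp add: heat_ker_def\<close>)

lemma continuous_on_heat_ker:
  assumes "0 < \<delta>"
  shows "continuous_on ({\<delta>..} \<times> UNIV) (\<lambda>(z, r). heat_ker i j z r)"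
proof -
  let ?b = "\<lambda>q::real\<times>real. fst q ^ i * (fact (Suc j) * 4 ^ Suc j / fst q ^ (2 * Suc j)) * sqrt (max 0 (snd q)) ^ (j + 2)"
  have "continuous (at q within {\<delta>..} \<times> UNIV) (\<lambda>q. heat_ker i j (fst q) (snd q))" if q: "q \<in> {\<delta>..} \<times> UNIV" for q
  proof -
    consider "snd q > 0" | "snd q < 0" | "snd q = 0" by linarith
    then show ?thesis
    proof cases
      case 1
      have "isCont (\<lambda>q. fst q ^ i * exp (- ((fst q)\<^sup>2 / (4 * snd q))) / sqrt (snd q) ^ j) q"
        using 1 by (intro continuous_intros) auto
      moreover have "\<forall>\<^sub>F p in nhds q. p \<in> UNIV \<times> {0<..}"
        using 1 by (intro eventually_nhds_in_open open_Times) (auto simp: mem_Times_iff)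
      then have "\<forall>\<^sub>F p in nhds q. fst p ^ i * exp (- ((fst p)\<^sup>2 / (4 * snd p))) / sqrt (snd p) ^ j = heat_ker i j (fst p) (snd p)"
        by eventually_elim (auto simp: heat_ker_def)
      ultimately have "isCont (\<lambda>q. heat_ker i j (fst q) (snd q)) q"
        using isCont_cong by force
      then show ?thesis by (rule continuous_at_imp_continuous_at_within)
    next
      case 2
      have "\<forall>\<^sub>F p in nhds q. p \<in> UNIV \<times> {..<0}"
        using 2 by (intro eventually_nhds_in_open open_Times) (auto simp: mem_Times_iff)
      then have "\<forall>\<^sub>F p in nhds q. 0 = heat_ker i j (fst p) (snd p)"
        by eventually_elim (auto simp: heat_ker_def)
      moreover have "isCont (\<lambda>q::real\<times>real. 0::real) q" by simp
      ultimately have "isCont (\<lambda>q. heat_ker i j (fst q) (snd q)) q"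
        using isCont_cong by force
      then show ?thesis by (rule continuous_at_imp_continuous_at_within)
    next
      case 3
      have "fst q > 0" using q assms by auto
      then have "isCont ?b q" by (intro continuous_intros) auto
      then have "(?b \<longlongrightarrow> ?b q) (at q within {\<delta>..} \<times> UNIV)"
        using continuous_at_imp_continuous_at_within continuous_within by blast
      then have lim: "(?b \<longlongrightarrow> 0) (at q within {\<delta>..} \<times> UNIV)" by (simp add: 3)
      have "\<forall>\<^sub>F p in at q within {\<delta>..} \<times> UNIV. norm (heat_ker i j (fst p) (snd p)) \<le> ?b p"
        unfolding eventually_at_filter using assms
        by (intro always_eventually allI impI, unfold real_norm_def, intro heat_ker_bound) auto
      from Lim_null_comparison[OF this lim] show ?thesis
        by (simp add: continuous_within 3 heat_ker_def)
    qed
  qed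
  then show ?thesis by (simp add: continuous_on_eq_continuous_within case_prod_unfold)
qed

lemma has_real_derivative_cong_nhds:
  assumes "(f has_real_derivative D) (at t within S)" "\<forall>\<^sub>F s in nhds t. f s = g s" "t \<in> S"
  shows "(g has_real_derivative D) (at t within S)"
  unfolding has_field_derivative_def
proof (rule has_derivative_transform_eventually)
  show "\<forall>\<^sub>F s in at t within S. f s = g s"
    using assms(2) unfolding eventually_at_filter by eventually_elim auto
  show "f t = g t" using eventually_nhds_x_imp_x[OF assms(2)] .
qed (use assms in \<open>auto simp: has_field_derivative_def\<close>)

lemma heat_ker_has_derivative_pos:
  assumes z: "(z has_real_derivative z') (at x within S)" and r: "(r has_real_derivative r') (at x within S)"
    and pos: "0 < r x" and x: "x \<in> S"
  shows "((\<lambda>x. heat_ker i j (z x) (r x)) has_real_derivative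
     z' * (i * heat_ker (i - 1) j (z x) (r x) - 1/2 * heat_ker (i + 1) (j + 2) (z x) (r x))
     + r' * (1/4 * heat_ker (i + 2) (j + 4) (z x) (r x) - j / 2 * heat_ker i (j + 2) (z x) (r x))) (at x within S)"
    (is "(_ has_real_derivative ?D) _")
proof -
  define E where "E = exp (- ((z x)\<^sup>2 / (4 * r x)))"
  define q where "q = 1 / sqrt (r x)"
  have q2: "q\<^sup>2 = 1 / r x" using pos by (simp add: q_def power_divide)
  have qj: "1 / sqrt (r x) ^ n = q ^ n" for n by (simp add: q_def power_divide)
  have hk: "heat_ker a b (z x) (r x) = z x ^ a * E * q ^ b" for a b
    using pos by (simp add: heat_ker_def E_def flip: qj)
  have dq: "((\<lambda>x. 1 / sqrt (r x)) has_real_derivative - (1/2) * r' * q ^ 3) (at x within S)"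
  proof -
    have "((\<lambda>x. sqrt (r x)) has_real_derivative inverse (sqrt (r x)) / 2 * r') (at x within S)"
      using DERIV_chain'[OF r DERIV_real_sqrt[OF pos]] by simp
    then have "((\<lambda>x. 1 / sqrt (r x)) has_real_derivative
        (0 * sqrt (r x) - 1 * (inverse (sqrt (r x)) / 2 * r')) / (sqrt (r x) * sqrt (r x))) (at x within S)"
      by (rule DERIV_divide[OF DERIV_const]) (use pos in simp)
    moreover have "(0 * sqrt (r x) - 1 * (inverse (sqrt (r x)) / 2 * r')) / (sqrt (r x) * sqrt (r x)) = - (1/2) * r' * q ^ 3"
      by (simp add: q_def power3_eq_cube field_simps)
    ultimately show ?thesis by (rule DERIV_cong)
  qed
  have E': "exp (- ((z x)\<^sup>2 * q\<^sup>2 / 4)) = E" by (simp add: E_def q2)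
  have dE: "((\<lambda>x. exp (- ((z x)\<^sup>2 * (1 / sqrt (r x))\<^sup>2 / 4))) has_real_derivative
      E * (- (1/2) * z x * z' * q\<^sup>2 + 1/4 * r' * (z x)\<^sup>2 * q ^ 4)) (at x within S)"
    by (rule DERIV_cong[OF DERIV_chain'[OF DERIV_minus[OF DERIV_cdivide[OF DERIV_mult
          [OF DERIV_power[OF z, of 2] DERIV_power[OF dq, of 2]]]] DERIV_exp]])
      (simp only: q_def[symmetric] E', simp add: power2_eq_square power3_eq_cube power4_eq_xxxx field_simps)
  have dz: "((\<lambda>x. z x ^ i) has_real_derivative i * z' * z x ^ (i - 1)) (at x within S)"
    by (rule DERIV_cong[OF DERIV_power[OF z]]) simp
  have dqj: "((\<lambda>x. (1 / sqrt (r x)) ^ j) has_real_derivative - (j/2) * r' * q ^ (j + 2)) (at x within S)"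
  proof (rule DERIV_cong[OF DERIV_power[OF dq]], unfold q_def[symmetric])
    show "real j * (- (1 / 2) * r' * q ^ 3 * q ^ (j - Suc 0)) = - (real j / 2) * r' * q ^ (j + 2)"
      by (cases j) (simp_all add: power_add power3_eq_cube power2_eq_square)
  qed
  have "((\<lambda>x. z x ^ i * exp (- ((z x)\<^sup>2 * (1 / sqrt (r x))\<^sup>2 / 4)) * (1 / sqrt (r x)) ^ j) has_real_derivative ?D) (at x within S)"
    by (rule DERIV_cong[OF DERIV_mult[OF DERIV_mult[OF dz dE] dqj]])
      (simp only: q_def[symmetric] E' hk, simp add: power_add algebra_simps power2_eq_square)
  moreover have "\<forall>\<^sub>F y in at x within S. z y ^ i * exp (- ((z y)\<^sup>2 * (1 / sqrt (r y))\<^sup>2 / 4)) * (1 / sqrt (r y)) ^ j = heat_ker i j (z y) (r y)"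
  proof -
    have "(r \<longlongrightarrow> r x) (at x within S)" using DERIV_continuous[OF r] by (simp add: continuous_within)
    then have "\<forall>\<^sub>F y in at x within S. 0 < r y" using pos by (rule order_tendstoD(1))
    then show ?thesis by eventually_elim (simp add: heat_ker_def power_divide)
  qed
  ultimately show ?thesis
    unfolding has_field_derivative_def
    by (rule has_derivative_transform_eventually) (use pos x in \<open>auto simp: heat_ker_def power_divide\<close>)
qed

text \<open>Differentiability across \<open>t = \<tau>\<close>, where the kernel starts to be nonzero: the difference quotient there is again a kernel of
  the family, and it tends to \<open>0\<close> because \<open>z\<close> stays away from \<open>0\<close>.\<close>

lemma heat_ker_has_derivative:
  assumes z: "(z has_real_derivative z') (at t within S)" and \<delta>: "0 < \<delta>" "\<And>s. s \<in> S \<Longrightarrow> \<delta> \<le> z s" and t: "t \<in> S"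
  shows "((\<lambda>t. heat_ker i j (z t) (t - \<tau>)) has_real_derivative
     z' * (i * heat_ker (i - 1) j (z t) (t - \<tau>) - 1/2 * heat_ker (i + 1) (j + 2) (z t) (t - \<tau>))
     + 1/4 * heat_ker (i + 2) (j + 4) (z t) (t - \<tau>) - j / 2 * heat_ker i (j + 2) (z t) (t - \<tau>)) (at t within S)"
    (is "(_ has_real_derivative ?D) _")
proof -
  consider "t > \<tau>" | "t < \<tau>" | "t = \<tau>" by linarith
  then show ?thesis
  proof cases
    case 1
    have "((\<lambda>t. t - \<tau>) has_real_derivative 1) (at t within S)" by (auto intro!: derivative_eq_intros)
    from heat_ker_has_derivative_pos[OF z this _ t] show ?thesis
      by (rule DERIV_cong) (use 1 in simp_all)
  next
    case 2
    then have "\<forall>\<^sub>F s in nhds t. s \<in> {..<\<tau>}" by (intro eventually_nhds_in_open) auto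
    then have ev: "\<forall>\<^sub>F s in nhds t. 0 = heat_ker i j (z s) (s - \<tau>)"
      by eventually_elim (simp add: heat_ker_def)
    have "((\<lambda>s. 0) has_real_derivative ?D) (at t within S)" using 2 by (simp add: heat_ker_def)
    then show ?thesis
      by (rule has_real_derivative_cong_nhds[OF _ ev t])
  next
    case 3
    have "((\<lambda>s. (\<lambda>(z, r). heat_ker i (j + 2) z r) (z s, s - \<tau>)) \<longlongrightarrow> (\<lambda>(z, r). heat_ker i (j + 2) z r) (z t, t - \<tau>)) (at t within S)"
    proof (rule continuous_on_tendsto_compose[OF continuous_on_heat_ker[OF \<delta>(1)]])
      show "((\<lambda>s. (z s, s - \<tau>)) \<longlongrightarrow> (z t, t - \<tau>)) (at t within S)"
        using DERIV_continuous[OF z] by (intro tendsto_intros) (auto simp: continuous_within)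
    qed (use t \<delta> in \<open>auto simp: eventually_at_filter\<close>)
    then have "((\<lambda>s. heat_ker i (j + 2) (z s) (s - \<tau>)) \<longlongrightarrow> 0) (at t within S)"
      using 3 by (simp add: heat_ker_def)
    moreover have "\<forall>\<^sub>F s in at t within S. heat_ker i (j + 2) (z s) (s - \<tau>)
        = (heat_ker i j (z s) (s - \<tau>) - heat_ker i j (z t) (t - \<tau>)) / (s - t)"
      unfolding eventually_at_filter
      by (intro always_eventually) (use 3 in \<open>auto simp: heat_ker_def power_add\<close>)
    ultimately have lim: "((\<lambda>s. (heat_ker i j (z s) (s - \<tau>) - heat_ker i j (z t) (t - \<tau>)) / (s - t)) \<longlongrightarrow> 0) (at t within S)"
      by (rule Lim_transform_eventually)
    have "?D = 0" using 3 by (simp add: heat_ker_def)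
    then show ?thesis using lim unfolding has_field_derivative_iff by (simp only:)
  qed
qed

text \<open>A potential evaluated at positive distance from its source is as smooth as the moving evaluation
  point, for any continuous density \<open>w\<close>: all derivatives fall on the kernel, and they stay in the family.\<close>

lemma C_diff_on_far_potential:
  assumes w: "continuous_on {0..L} w" and \<delta>: "0 < \<delta>"
  shows "C_diff_on k c {0..L} \<Longrightarrow> (\<And>t \<tau>. t \<in> {0..L} \<Longrightarrow> \<tau> \<in> {0..L} \<Longrightarrow> \<delta> \<le> c t - c \<tau> + d) \<Longrightarrow>
     C_diff_on k (\<lambda>t. integral {0..L} (\<lambda>\<tau>. heat_ker i j (c t - c \<tau> + d) (t - \<tau>) * w \<tau>)) {0..L}"
proof (induction k arbitrary: i j)
  have cont: "continuous_on ({0..L} \<times> {0..L}) (\<lambda>(t, \<tau>). heat_ker i j (c t - c \<tau> + d) (t - \<tau>) * w \<tau>)"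
    if c: "continuous_on {0..L} c" and z: "\<And>t \<tau>. t \<in> {0..L} \<Longrightarrow> \<tau> \<in> {0..L} \<Longrightarrow> \<delta> \<le> c t - c \<tau> + d" for i j
  proof -
    have "continuous_on ({0..L} \<times> {0..L}) (\<lambda>q. (\<lambda>(z, r). heat_ker i j z r) (c (fst q) - c (snd q) + d, fst q - snd q))"
      using z by (intro continuous_on_compose2[OF continuous_on_heat_ker[OF \<delta>]] continuous_intros
          continuous_on_compose2[OF c]) auto
    then show ?thesis
      by (auto simp: case_prod_unfold intro!: continuous_on_mult continuous_on_compose2[OF w] continuous_intros)
  qed
  { case 0
    then have c: "continuous_on {0..L} c" by (simp add: C_diff_on_0_iff)
    have "continuous_on ({0..L} \<times> cbox 0 L) (\<lambda>(t, \<tau>). heat_ker i j (c t - c \<tau> + d) (t - \<tau>) * w \<tau>)"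
      using cont[OF c 0(2)] by simp
    from integral_continuous_on_param[OF this] show ?case by (simp add: C_diff_on_0_iff) }
  case (Suc k)
  have c: "continuous_on {0..L} c" using Suc.prems C_diff_on_cont by blast
  have ck: "C_diff_on k c {0..L}" using Suc.prems C_diff_on_Suc_imp by blast
  obtain c' where c': "\<forall>x\<in>{0..L}. (c has_real_derivative c' x) (at x within {0..L})" "C_diff_on k c' {0..L}"
    using Suc.prems(1) unfolding C_diff_on_Suc_iff by blast
  define h where "h = (\<lambda>i j t \<tau>. heat_ker i j (c t - c \<tau> + d) (t - \<tau>) * w \<tau>)"
  let ?D = "\<lambda>t \<tau>. c' t * (i * h (i - 1) j t \<tau> - 1/2 * h (i + 1) (j + 2) t \<tau>)
     + 1/4 * h (i + 2) (j + 4) t \<tau> - j / 2 * h i (j + 2) t \<tau>"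
  have int: "h a b t integrable_on {0..L}" if "t \<in> {0..L}" for a b t
  proof (rule integrable_continuous_real)
    have "continuous_on {0..L} (\<lambda>\<tau>. (\<lambda>(t, \<tau>). h a b t \<tau>) (t, \<tau>))"
      using that unfolding h_def by (intro continuous_on_compose2[OF cont[OF c Suc.prems(2)]] continuous_intros) auto
    then show "continuous_on {0..L} (h a b t)" by simp
  qed
  have "((\<lambda>t. integral (cbox 0 L) (h i j t)) has_real_derivative integral (cbox 0 L) (?D t)) (at t within {0..L})"
    if t: "t \<in> {0..L}" for t
  proof (rule leibniz_rule_field_derivative[OF _ _ _ t])
    fix s \<tau> assume s: "s \<in> {0..L}" and \<tau>: "\<tau> \<in> cbox 0 L"
    have z: "((\<lambda>t. c t - c \<tau> + d) has_real_derivative c' s) (at s within {0..L})"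
      using c'(1) s by (auto intro!: derivative_eq_intros)
    show "((\<lambda>t. h i j t \<tau>) has_field_derivative ?D s \<tau>) (at s within {0..L})"
      unfolding h_def by (rule DERIV_cong[OF DERIV_cmult_right[OF heat_ker_has_derivative[OF z \<delta> _ s]]])
        (use Suc.prems(2) \<tau> in \<open>auto simp: h_def algebra_simps\<close>)
  next
    show "h i j s integrable_on cbox 0 L" if "s \<in> {0..L}" for s using int[OF that] by simp
    show "continuous_on ({0..L} \<times> cbox 0 L) (\<lambda>(t, \<tau>). ?D t \<tau>)"
    proof -
      have "continuous_on ({0..L} \<times> {0..L}) (\<lambda>q. h a b (fst q) (snd q))" for a b
        using cont[OF c Suc.prems(2)] by (simp add: h_def case_prod_unfold)
      moreover have "continuous_on ({0..L} \<times> {0..L}) (\<lambda>q. c' (fst q))"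
        by (rule continuous_on_compose2[OF C_diff_on_cont[OF c'(2)]]) (auto intro!: continuous_intros)
      ultimately show ?thesis
        unfolding case_prod_unfold box_real
        by (intro continuous_on_add continuous_on_diff continuous_on_mult continuous_on_const)
    qed
  qed auto
  moreover have "integral {0..L} (?D t) = c' t * (i * integral {0..L} (h (i - 1) j t) - 1/2 * integral {0..L} (h (i + 1) (j + 2) t))
     + 1/4 * integral {0..L} (h (i + 2) (j + 4) t) - j / 2 * integral {0..L} (h i (j + 2) t)" if t: "t \<in> {0..L}" for t
  proof (rule integral_unique)
    show "(?D t has_integral c' t * (i * integral {0..L} (h (i - 1) j t) - 1/2 * integral {0..L} (h (i + 1) (j + 2) t))
     + 1/4 * integral {0..L} (h (i + 2) (j + 4) t) - j / 2 * integral {0..L} (h i (j + 2) t)) {0..L}"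
      by (intro has_integral_add has_integral_diff has_integral_mult_right integrable_integral int t)
  qed
  ultimately have D: "((\<lambda>t. integral {0..L} (h i j t)) has_real_derivative
     c' t * (i * integral {0..L} (h (i - 1) j t) - 1/2 * integral {0..L} (h (i + 1) (j + 2) t))
     + 1/4 * integral {0..L} (h (i + 2) (j + 4) t) - j / 2 * integral {0..L} (h i (j + 2) t)) (at t within {0..L})"
    if "t \<in> {0..L}" for t using that by simp
  have "C_diff_on k (\<lambda>t. integral {0..L} (h a b t)) {0..L}" for a b
    unfolding h_def by (rule Suc.IH[OF ck Suc.prems(2)])
  then have "C_diff_on (Suc k) (\<lambda>t. integral {0..L} (h i j t)) {0..L}"
    by (intro C_diff_on_SucI[OF D] C_diff_on_add C_diff_on_diff C_diff_on_mult C_diff_on_const c'(2))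
  then show ?case by (simp add: h_def)
qed

text \<open>An integrable majorant with an elementary primitive.\<close>

lemma gaussian_moment_bound:
  obtains C where "0 \<le> C" "\<And>\<zeta>::real. \<bar>\<zeta> ^ i * exp (- (\<zeta>\<^sup>2 / 4))\<bar> \<le> C / (1 + \<zeta>\<^sup>2)"
proof
  let ?C = "\<lambda>n::nat. 4 ^ n * fact n :: real"
  let ?B = "?C 0 + ?C 1 + ?C i + ?C (Suc i)"
  show "0 \<le> ?B" by simp
  fix \<zeta> :: real
  let ?e = "exp (- (\<zeta>\<^sup>2 / 4))"
  have C: "(\<zeta>\<^sup>2) ^ n * ?e \<le> ?C n" for n
  proof -
    have "(\<zeta>\<^sup>2 / 4) ^ n * ?e \<le> fact n" by (rule power_times_exp_neg_le) simp
    then show ?thesis by (simp add: power_divide field_simps)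
  qed
  have "\<bar>\<zeta> ^ i\<bar> \<le> 1 + (\<zeta>\<^sup>2) ^ i"
  proof -
    have "0 \<le> (\<bar>\<zeta> ^ i\<bar> - 1/2)\<^sup>2" by simp
    then have "\<bar>\<zeta> ^ i\<bar> \<le> \<bar>\<zeta> ^ i\<bar>\<^sup>2 + 1/4" by (simp add: power2_diff power_divide)
    moreover have "\<bar>\<zeta> ^ i\<bar>\<^sup>2 = (\<zeta>\<^sup>2) ^ i" by (simp add: power_mult[symmetric] mult.commute)
    ultimately show ?thesis by linarith
  qed
  then have "\<bar>\<zeta> ^ i\<bar> * (?e * (1 + \<zeta>\<^sup>2)) \<le> (1 + (\<zeta>\<^sup>2) ^ i) * (?e * (1 + \<zeta>\<^sup>2))"
    by (intro mult_right_mono) auto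
  also have "\<dots> = (\<zeta>\<^sup>2) ^ 0 * ?e + (\<zeta>\<^sup>2) ^ 1 * ?e + (\<zeta>\<^sup>2) ^ i * ?e + (\<zeta>\<^sup>2) ^ Suc i * ?e"
    by (simp add: algebra_simps)
  also have "\<dots> \<le> ?B" by (intro add_mono C)
  finally have "\<bar>\<zeta> ^ i * ?e\<bar> * (1 + \<zeta>\<^sup>2) \<le> ?B" by (simp add: abs_mult mult.assoc)
  then show "\<bar>\<zeta> ^ i * ?e\<bar> \<le> ?B / (1 + \<zeta>\<^sup>2)"
    by (subst pos_le_divide_eq) (auto intro: add_pos_nonneg)
qed

text \<open>For \<open>i = 0\<close> this is \<open>sqrt t\<close> times the potential of the initial values \<open>w\<close>, evaluated at the moving boundary.
  In the self-similar variable \<open>\<zeta> = (c t - c 0 - y) / sqrt t\<close> the Euler derivative costs no power of \<open>1 / t\<close>, so the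
  family over \<open>i\<close> is closed under it.\<close>

definition initial_layer :: "(real \<Rightarrow> real) \<Rightarrow> (real \<Rightarrow> real) \<Rightarrow> real \<Rightarrow> nat \<Rightarrow> real \<Rightarrow> real" where
  "initial_layer c w d i t = (if t \<le> 0 then 0 else
     integral {-d..0} (\<lambda>y. ((c t - c 0 - y) / sqrt t) ^ i * exp (- (((c t - c 0 - y) / sqrt t)\<^sup>2 / 4)) * w y))"

lemma continuous_on_initial_integrand:
  assumes "continuous_on {0..L} c" "continuous_on {-d..0} w"
  shows "continuous_on ({0<..L} \<times> {-d..0})
    (\<lambda>(t, y). ((c t - c 0 - y) / sqrt t) ^ i * exp (- (((c t - c 0 - y) / sqrt t)\<^sup>2 / 4)) * w y)"
proof -
  have "continuous_on ({0<..L} \<times> {-d..0}) (\<lambda>q. c (fst q))" "continuous_on ({0<..L} \<times> {-d..0}) (\<lambda>q. w (snd q))"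
    by (auto intro!: continuous_on_compose2[OF assms(1)] continuous_on_compose2[OF assms(2)] continuous_intros)
  then show ?thesis unfolding case_prod_unfold
    by (intro continuous_intros) auto
qed

lemma initial_integrable:
  assumes "continuous_on {0..L} c" "continuous_on {-d..0} w" "t \<in> {0<..L}"
  shows "(\<lambda>y. ((c t - c 0 - y) / sqrt t) ^ i * exp (- (((c t - c 0 - y) / sqrt t)\<^sup>2 / 4)) * w y) integrable_on {-d..0}"
  using assms by (intro integrable_continuous_real continuous_intros) auto

text \<open>The integrand is concentrated on a set of width comparable to \<open>sqrt t\<close>.\<close>

lemma initial_layer_bound:
  assumes c: "continuous_on {0..L} c" and w: "continuous_on {-d..0} w"
  obtains K where "\<And>t. t \<in> {0..L} \<Longrightarrow> \<bar>initial_layer c w d i t\<bar> \<le> K * sqrt t"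
proof -
  obtain C where C: "0 \<le> C" "\<And>\<zeta>::real. \<bar>\<zeta> ^ i * exp (- (\<zeta>\<^sup>2 / 4))\<bar> \<le> C / (1 + \<zeta>\<^sup>2)"
    using gaussian_moment_bound[of i] by blast
  have "bounded (w ` {-d..0})" by (intro compact_imp_bounded compact_continuous_image w) auto
  then obtain M where M: "M > 0" "\<And>y. y \<in> {-d..0} \<Longrightarrow> \<bar>w y\<bar> \<le> M" unfolding bounded_pos by auto
  have "\<bar>initial_layer c w d i t\<bar> \<le> (C * M * pi) * sqrt t" if t: "t \<in> {0<..L}" and d: "0 \<le> d" for t
  proof -
    define \<zeta> where "\<zeta> = (\<lambda>y. (c t - c 0 - y) / sqrt t)"
    have st: "sqrt t > 0" using t by simp
    have "((\<lambda>y. C * M / (1 + (\<zeta> y)\<^sup>2)) has_integral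
        - (C * M * sqrt t * arctan (\<zeta> 0)) - - (C * M * sqrt t * arctan (\<zeta> (-d)))) {-d..0}"
    proof (rule fundamental_theorem_of_calculus)
      fix y assume "y \<in> {-d..0}"
      have "(\<zeta> has_real_derivative - (1 / sqrt t)) (at y within {-d..0})"
        unfolding \<zeta>_def using st t by (auto intro!: derivative_eq_intros simp: field_simps)
      from DERIV_minus[OF DERIV_cmult[OF DERIV_chain'[OF this DERIV_arctan], of "C * M * sqrt t"]]
      have "((\<lambda>y. - (C * M * sqrt t * arctan (\<zeta> y))) has_real_derivative C * M / (1 + (\<zeta> y)\<^sup>2)) (at y within {-d..0})"
        by (rule DERIV_cong) (use st in \<open>simp add: divide_inverse\<close>)
      then show "((\<lambda>y. - (C * M * sqrt t * arctan (\<zeta> y))) has_vector_derivative C * M / (1 + (\<zeta> y)\<^sup>2)) (at y within {-d..0})"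
        by (simp only: has_real_derivative_iff_has_vector_derivative)
    qed (use d in auto)
    note I = this
    have "norm (integral {-d..0} (\<lambda>y. \<zeta> y ^ i * exp (- ((\<zeta> y)\<^sup>2 / 4)) * w y)) \<le> integral {-d..0} (\<lambda>y. C * M / (1 + (\<zeta> y)\<^sup>2))"
    proof (rule integral_norm_bound_integral)
      show "(\<lambda>y. \<zeta> y ^ i * exp (- ((\<zeta> y)\<^sup>2 / 4)) * w y) integrable_on {-d..0}"
        unfolding \<zeta>_def by (rule initial_integrable[OF c w t])
      fix y assume "y \<in> {-d..0}"
      then have "\<bar>\<zeta> y ^ i * exp (- ((\<zeta> y)\<^sup>2 / 4))\<bar> * \<bar>w y\<bar> \<le> C / (1 + (\<zeta> y)\<^sup>2) * M"
        using C M by (intro mult_mono) auto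
      then show "norm (\<zeta> y ^ i * exp (- ((\<zeta> y)\<^sup>2 / 4)) * w y) \<le> C * M / (1 + (\<zeta> y)\<^sup>2)"
        by (simp add: abs_mult)
    qed (use I in auto)
    also have "\<dots> = (C * M * sqrt t) * (arctan (\<zeta> (-d)) - arctan (\<zeta> 0))"
      using integral_unique[OF I] by (simp add: algebra_simps)
    also have "\<dots> \<le> (C * M * sqrt t) * pi"
      using C M st arctan_bounded[of "\<zeta> (-d)"] arctan_bounded[of "\<zeta> 0"] by (intro mult_left_mono) auto
    finally show ?thesis using t by (simp add: initial_layer_def \<zeta>_def mult_ac)
  qed
  moreover have "initial_layer c w d i t = 0" if "\<not> 0 \<le> d" for t
    using that by (simp add: initial_layer_def)
  ultimately have "\<bar>initial_layer c w d i t\<bar> \<le> (C * M * pi) * sqrt t" if "t \<in> {0..L}" for t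
    using that C(1) M(1) by (cases "t = 0"; cases "0 \<le> d") (auto simp: initial_layer_def)
  then show ?thesis by (rule that)
qed

lemma continuous_on_initial_layer:
  assumes c: "continuous_on {0..L} c" and w: "continuous_on {-d..0} w"
  shows "continuous_on {0..L} (initial_layer c w d i)"
  unfolding continuous_on_eq_continuous_within
proof
  fix t assume t: "t \<in> {0..L}"
  show "continuous (at t within {0..L}) (initial_layer c w d i)"
  proof (cases "t = 0")
    case True
    obtain K where K: "\<And>t. t \<in> {0..L} \<Longrightarrow> \<bar>initial_layer c w d i t\<bar> \<le> K * sqrt t"
      using initial_layer_bound[OF c w] by blast
    have "((\<lambda>t. K * sqrt t) \<longlongrightarrow> K * sqrt 0) (at 0 within {0..L})" by (intro tendsto_intros)
    then have "((\<lambda>t. K * sqrt t) \<longlongrightarrow> 0) (at 0 within {0..L})" by simp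
    then have "(initial_layer c w d i \<longlongrightarrow> 0) (at 0 within {0..L})"
      by (rule Lim_null_comparison[rotated]) (auto simp: eventually_at_filter K)
    then show ?thesis using True by (simp add: continuous_within initial_layer_def)
  next
    case False
    have "continuous_on ({0<..L} \<times> cbox (-d) 0)
      (\<lambda>(t, y). ((c t - c 0 - y) / sqrt t) ^ i * exp (- (((c t - c 0 - y) / sqrt t)\<^sup>2 / 4)) * w y)"
      using continuous_on_initial_integrand[OF c w] by simp
    from integral_continuous_on_param[OF this]
    have "continuous_on {0<..L} (\<lambda>t. integral {-d..0} (\<lambda>y. ((c t - c 0 - y) / sqrt t) ^ i * exp (- (((c t - c 0 - y) / sqrt t)\<^sup>2 / 4)) * w y))"
      by simp
    then have "continuous_on {0<..L} (initial_layer c w d i)"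
      by (rule continuous_on_eq) (auto simp: initial_layer_def)
    then have "continuous (at t within {0<..L}) (initial_layer c w d i)"
      using t False by (auto simp: continuous_on_eq_continuous_within)
    moreover have "at t within {0<..L} = at t within {0..L}"
      by (rule at_within_nhd[of t "{0<..}"]) (use t False in auto)
    ultimately show ?thesis by simp
  qed
qed

text \<open>Based on \<open>t * d/dt \<zeta> = sqrt t * c' t - \<zeta> / 2\<close>.\<close>

lemma euler_deriv_initial_layer:
  assumes c': "\<And>t. t \<in> {0..L} \<Longrightarrow> (c has_real_derivative c' t) (at t within {0..L})" "continuous_on {0..L} c'"
    and w: "continuous_on {-d..0} w"
  shows "euler_deriv L R (\<lambda>t _. initial_layer c w d i t)
    (\<lambda>t _. sqrt t * c' t * (i * initial_layer c w d (i - 1) t - 1/2 * initial_layer c w d (i + 1) t)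
       - 1/2 * (i * initial_layer c w d i t - 1/2 * initial_layer c w d (i + 2) t))"
    (is "euler_deriv L R _ (\<lambda>t _. ?D t)")
  unfolding euler_deriv_def
proof (intro ballI conjI)
  show "?D 0 = 0" by (simp add: initial_layer_def)
  fix t assume t: "t \<in> {0<..L}"
  have c: "continuous_on {0..L} c" using c'(1) DERIV_continuous_on by blast
  define h where "h = (\<lambda>i t y. ((c t - c 0 - y) / sqrt t) ^ i * exp (- (((c t - c 0 - y) / sqrt t)\<^sup>2 / 4)) * w y)"
  let ?d = "\<lambda>t y. (sqrt t * c' t * (i * h (i - 1) t y - 1/2 * h (i + 1) t y)
       - 1/2 * (i * h i t y - 1/2 * h (i + 2) t y)) / t"
  have "((\<lambda>t. integral (cbox (-d) 0) (h i t)) has_real_derivative integral (cbox (-d) 0) (?d t)) (at t within {0<..L})"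
  proof (rule leibniz_rule_field_derivative[OF _ _ _ t])
    fix s y assume s: "s \<in> {0<..L}" and y: "y \<in> cbox (-d) 0"
    define \<zeta> where "\<zeta> = (\<lambda>t. (c t - c 0 - y) / sqrt t)"
    define E where "E = exp (- ((\<zeta> s)\<^sup>2 / 4))"
    have cs: "(c has_real_derivative c' s) (at s within {0<..L})"
      by (rule DERIV_subset[OF c'(1)]) (use s in auto)
    have d\<zeta>: "(\<zeta> has_real_derivative (sqrt s * c' s - \<zeta> s / 2) / s) (at s within {0<..L})"
    proof -
      have n: "((\<lambda>t. c t - c 0 - y) has_real_derivative c' s) (at s within {0<..L})"
        using DERIV_diff[OF DERIV_diff[OF cs DERIV_const[of "c 0"]] DERIV_const[of y]] by simp
      have q: "(sqrt has_real_derivative inverse (sqrt s) / 2) (at s within {0<..L})"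
        using s by (auto intro!: derivative_eq_intros)
      have s0: "sqrt s \<noteq> 0" and ss: "sqrt s * sqrt s = s" using s by auto
      have "(c s - c 0 - y) * (inverse (sqrt s) / 2) = \<zeta> s / 2" by (simp add: \<zeta>_def field_simps)
      then have "(c' s * sqrt s - (c s - c 0 - y) * (inverse (sqrt s) / 2)) / (sqrt s * sqrt s)
          = (sqrt s * c' s - \<zeta> s / 2) / s"
        by (simp only: ss mult.commute[of "c' s"])
      from DERIV_cong[OF DERIV_divide[OF n q s0] this] show ?thesis by (simp only: \<zeta>_def)
    qed
    have dE: "((\<lambda>s. exp (- ((\<zeta> s)\<^sup>2 / 4))) has_real_derivative
       E * (- (1/2) * \<zeta> s * ((sqrt s * c' s - \<zeta> s / 2) / s))) (at s within {0<..L})"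
      by (rule DERIV_cong[OF DERIV_chain'[OF DERIV_minus[OF DERIV_cdivide[OF DERIV_power[OF d\<zeta>, of 2]]] DERIV_exp]])
        (simp add: E_def)
    have "((\<lambda>s. \<zeta> s ^ i * exp (- ((\<zeta> s)\<^sup>2 / 4)) * w y) has_real_derivative
       (sqrt s * c' s * (i * (\<zeta> s ^ (i - 1) * E * w y) - 1/2 * (\<zeta> s ^ (i + 1) * E * w y))
       - 1/2 * (i * (\<zeta> s ^ i * E * w y) - 1/2 * (\<zeta> s ^ (i + 2) * E * w y))) / s) (at s within {0<..L})"
    proof (rule DERIV_cong[OF DERIV_cmult_right[OF DERIV_mult[OF DERIV_power[OF d\<zeta>, of i] dE]]])
      define A z Z m where "A = sqrt s * c' s" and "z = \<zeta> s" and "Z = \<zeta> s ^ i" and "m = i * \<zeta> s ^ (i - 1)"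
      have i: "i * Z = m * z" by (cases i) (auto simp: m_def z_def Z_def)
      have p: "\<zeta> s ^ (i + 1) = Z * z" "\<zeta> s ^ (i + 2) = Z * z * z"
        by (simp_all add: Z_def z_def power_add power2_eq_square)
      have "(A * (i * (\<zeta> s ^ (i - 1) * E * w y) - 1/2 * (Z * z * E * w y))
          - 1/2 * (i * (Z * E * w y) - 1/2 * (Z * z * z * E * w y))) / s
        = (A * (m * E * w y - 1/2 * (Z * z * E * w y)) - 1/2 * ((i * Z) * E * w y - 1/2 * (Z * z * z * E * w y))) / s"
        by (simp only: m_def mult.assoc)
      also have "\<dots> = (m * ((A - z / 2) / s) * E + E * (- (1/2) * z * ((A - z / 2) / s)) * Z) * w y"
        using s unfolding i by (simp add: field_simps)
      finally show "(real i * ((sqrt s * c' s - \<zeta> s / 2) / s * \<zeta> s ^ (i - Suc 0)) * exp (- ((\<zeta> s)\<^sup>2 / 4)) +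
         E * (- (1/2) * \<zeta> s * ((sqrt s * c' s - \<zeta> s / 2) / s)) * \<zeta> s ^ i) * w y =
        (sqrt s * c' s * (i * (\<zeta> s ^ (i - 1) * E * w y) - 1/2 * (\<zeta> s ^ (i + 1) * E * w y))
       - 1/2 * (i * (\<zeta> s ^ i * E * w y) - 1/2 * (\<zeta> s ^ (i + 2) * E * w y))) / s"
        unfolding p by (simp add: A_def z_def Z_def m_def E_def mult_ac)
    qed
    then show "((\<lambda>t. h i t y) has_field_derivative ?d s y) (at s within {0<..L})"
      by (simp only: \<zeta>_def E_def h_def)
  next
    show "h i s integrable_on cbox (-d) 0" if "s \<in> {0<..L}" for s
      using initial_integrable[OF c w that] by (simp add: h_def)
    have "continuous_on ({0<..L} \<times> {-d..0}) (\<lambda>q. c' (fst q))"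
      by (auto intro!: continuous_on_compose2[OF c'(2)] continuous_intros)
    moreover have "continuous_on ({0<..L} \<times> {-d..0}) (\<lambda>q. h n (fst q) (snd q))" for n
      using continuous_on_initial_integrand[OF c w] by (simp add: h_def case_prod_unfold)
    moreover have "continuous_on ({0<..L} \<times> {-d..0}) (\<lambda>q. sqrt (fst q))" by (intro continuous_intros)
    ultimately show "continuous_on ({0<..L} \<times> cbox (-d) 0) (\<lambda>(t, y). ?d t y)"
      unfolding case_prod_unfold box_real
      by (intro continuous_on_divide continuous_on_diff continuous_on_mult continuous_on_const
          continuous_on_fst continuous_on_id) auto
  qed auto
  moreover have "(?d t has_integral ?D t / t) {-d..0}"
  proof -
    have i: "(h n t has_integral initial_layer c w d n t) {-d..0}" for n
      using integrable_integral[OF initial_integrable[OF c w t]] t by (simp add: initial_layer_def h_def)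
    show ?thesis
      by (intro has_integral_divide has_integral_diff has_integral_mult_right i)
  qed
  then have "integral {-d..0} (?d t) = ?D t / t" by (rule integral_unique)
  ultimately have "((\<lambda>t. integral {-d..0} (h i t)) has_real_derivative ?D t / t) (at t within {0<..L})"
    unfolding box_real by (rule DERIV_cong)
  then show "(initial_layer c w d i has_real_derivative ?D t / t) (at t within {0<..L})"
    by (rule has_field_derivative_transform_within[where d=1]) (use t in \<open>auto simp: initial_layer_def h_def\<close>)
qed

lemma euler_C_initial_layer:
  assumes w: "continuous_on {-d..0} w"
  shows "C_diff_on k c {0..L} \<Longrightarrow> euler_C k L R (\<lambda>t _. initial_layer c w d i t)"
proof (induction k arbitrary: i)
  have cont: "continuous_on ({0..L} \<times> R) (\<lambda>(t, p). initial_layer c w d i t)" if "continuous_on {0..L} c" for i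
    unfolding case_prod_unfold
    by (rule continuous_on_compose2[OF continuous_on_initial_layer[OF that w]]) (auto intro!: continuous_intros)
  { case 0 then show ?case using cont by (simp add: C_diff_on_0_iff) }
  case (Suc k)
  have c: "continuous_on {0..L} c" and ck: "C_diff_on k c {0..L}"
    using Suc.prems C_diff_on_cont C_diff_on_Suc_imp by blast+
  obtain c' where c': "\<forall>x\<in>{0..L}. (c has_real_derivative c' x) (at x within {0..L})" "C_diff_on k c' {0..L}"
    using Suc.prems(1) unfolding C_diff_on_Suc_iff by blast
  show ?case
  proof (rule euler_C_SucI[OF cont[OF c] euler_deriv_initial_layer[OF _ C_diff_on_cont[OF c'(2)] w]])
    show "euler_C k L R (\<lambda>t _. sqrt t * c' t * (i * initial_layer c w d (i - 1) t - 1/2 * initial_layer c w d (i + 1) t)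
       - 1/2 * (i * initial_layer c w d i t - 1/2 * initial_layer c w d (i + 2) t))"
      by (intro euler_C_diff euler_C_mult euler_C_sqrt C_diff_on_imp_euler_C[OF c'(2)] Suc.IH[OF ck] euler_C_const)
  qed (use c'(1) in blast)
qed

section \<open>Concentration of the heat kernel at the boundary\<close>

text \<open>A primitive of the Gaussian.  The lower limit \<open>-1\<close> leaves room on both sides of \<open>0\<close>, because
  it is also evaluated at slightly negative points.\<close>

definition gauss_prim :: "real \<Rightarrow> real" where
  "gauss_prim x = integral {-1..x} (\<lambda>v. exp (- v\<^sup>2))"

lemma gauss_prim_has_derivative:
  assumes "-1 < x"
  shows "(gauss_prim has_real_derivative exp (- x\<^sup>2)) (at x)"
proof -
  have "(gauss_prim has_real_derivative exp (- x\<^sup>2)) (at x within {-1..x+1})"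
    unfolding gauss_prim_def[abs_def] using assms
    by (intro integral_has_real_derivative continuous_intros) auto
  moreover have "at x within {-1..x+1} = at x"
    by (rule at_within_interior) (use assms in auto)
  ultimately show ?thesis by simp
qed

lemma gauss_integrable: "(\<lambda>v::real. exp (- v\<^sup>2)) integrable_on {a..b}"
  by (intro integrable_continuous_real continuous_intros)

lemma gauss_prim_mono: "mono gauss_prim"
  unfolding gauss_prim_def by (intro monoI integral_subset_le gauss_integrable) auto

lemma gauss_prim_le: "gauss_prim x \<le> pi"
proof (cases "-1 \<le> x")
  case True
  have I: "((\<lambda>v. inverse (1 + v\<^sup>2)) has_integral arctan x - arctan (-1)) {-1..x}"
    using True by (intro fundamental_theorem_of_calculus)
      (auto intro!: DERIV_subset[OF DERIV_arctan] simp flip: has_real_derivative_iff_has_vector_derivative)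
  have "exp (- v\<^sup>2) \<le> inverse (1 + v\<^sup>2)" for v :: real
    unfolding exp_minus using exp_ge_add_one_self[of "v\<^sup>2"] by (intro le_imp_inverse_le) (auto intro: add_pos_nonneg)
  then have "gauss_prim x \<le> arctan x - arctan (-1)"
    unfolding gauss_prim_def integral_unique[OF I, symmetric]
    using I by (intro integral_le gauss_integrable) auto
  also have "\<dots> \<le> pi" using arctan_bounded[of x] arctan_bounded[of "-1"] by linarith
  finally show ?thesis .
qed (simp add: gauss_prim_def)

text \<open>The integral of the Gaussian over the positive half line, that is \<open>sqrt pi / 2\<close>.\<close>

definition half_gauss :: real where
  "half_gauss = Lim at_top gauss_prim - gauss_prim 0"

lemma gauss_prim_tendsto: "(gauss_prim \<longlongrightarrow> gauss_prim 0 + half_gauss) at_top"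
proof -
  have "bdd_above (range (\<lambda>n. gauss_prim (real n)))"
    by (rule bdd_aboveI[where M=pi]) (auto intro: gauss_prim_le)
  moreover have "incseq (\<lambda>n. gauss_prim (real n))"
    by (intro monoI monoD[OF gauss_prim_mono]) auto
  ultimately have "(\<lambda>n. gauss_prim (real n)) \<longlonglongrightarrow> (SUP n. gauss_prim (real n))"
    by (rule LIMSEQ_incseq_SUP)
  then have "(gauss_prim \<longlongrightarrow> (SUP n. gauss_prim (real n))) at_top"
    by (rule tendsto_at_topI_sequentially_real[OF gauss_prim_mono])
  moreover from this have "Lim at_top gauss_prim = (SUP n. gauss_prim (real n))"
    by (intro tendsto_Lim) auto
  ultimately show ?thesis by (simp add: half_gauss_def)
qed

lemma half_gauss_pos: "0 < half_gauss"
proof -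
  obtain z where z: "0 < z" "gauss_prim 1 - gauss_prim 0 = (1 - 0) * exp (- z\<^sup>2)"
    using MVT2[of 0 1 gauss_prim "\<lambda>x. exp (- x\<^sup>2)"] gauss_prim_has_derivative by force
  have "gauss_prim 1 \<le> gauss_prim 0 + half_gauss"
    by (rule tendsto_lowerbound[OF gauss_prim_tendsto])
      (auto intro!: eventually_at_top_linorderI[of 1] monoD[OF gauss_prim_mono])
  moreover have "0 < exp (- z\<^sup>2)" by simp
  moreover have "gauss_prim 1 - gauss_prim 0 = exp (- z\<^sup>2)" using z(2) by (simp only: diff_zero mult_1)
  ultimately show ?thesis by linarith
qed

lemma gauss_mass:
  assumes "0 < \<rho>" "a \<le> b" "-1 < (e - b) / (2 * \<rho>)"
  shows "((\<lambda>y. exp (- ((e - y) / (2 * \<rho>))\<^sup>2) / \<rho>) has_integral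
     2 * (gauss_prim ((e - a) / (2 * \<rho>)) - gauss_prim ((e - b) / (2 * \<rho>)))) {a..b}"
proof -
  let ?g = "\<lambda>y. - 2 * gauss_prim ((e - y) / (2 * \<rho>))"
  have "((\<lambda>y. exp (- ((e - y) / (2 * \<rho>))\<^sup>2) / \<rho>) has_integral ?g b - ?g a) {a..b}"
  proof (rule fundamental_theorem_of_calculus[OF assms(2)])
    fix y assume y: "y \<in> {a..b}"
    have "(e - b) / (2 * \<rho>) \<le> (e - y) / (2 * \<rho>)" using y assms by (intro divide_right_mono) auto
    then have m: "-1 < (e - y) / (2 * \<rho>)" using assms by linarith
    have l: "((\<lambda>y. (e - y) / (2 * \<rho>)) has_real_derivative - (1 / (2 * \<rho>))) (at y within {a..b})"
      using assms(1) by (auto intro!: derivative_eq_intros)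
    have "(?g has_real_derivative exp (- ((e - y) / (2 * \<rho>))\<^sup>2) / \<rho>) (at y within {a..b})"
      by (rule DERIV_cong[OF DERIV_cmult[OF DERIV_chain'[OF l gauss_prim_has_derivative[OF m]]]]) simp
    then show "(?g has_vector_derivative exp (- ((e - y) / (2 * \<rho>))\<^sup>2) / \<rho>) (at y within {a..b})"
      by (simp only: has_real_derivative_iff_has_vector_derivative)
  qed
  then show ?thesis by (simp add: algebra_simps)
qed

text \<open>Convergence to a point mass at the end of an interval.  Only the half of the kernel that lies over the
  interval counts, provided the centre \<open>e\<close> approaches the end point faster than the width \<open>\<rho>\<close>
  shrinks.\<close>

lemma half_gaussian_concentrates:
  fixes \<rho> e :: "'a \<Rightarrow> real" and V :: "'a \<Rightarrow> real \<Rightarrow> real"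
  assumes d: "0 < d" and \<rho>: "(\<rho> \<longlongrightarrow> 0) F" "\<forall>\<^sub>F x in F. 0 < \<rho> x"
    and e: "((\<lambda>x. e x / \<rho> x) \<longlongrightarrow> 0) F"
    and V: "\<forall>\<^sub>F x in F. continuous_on {-d..0} (V x)" "\<forall>\<^sub>F x in F. \<forall>y\<in>{-d..0}. \<bar>V x y\<bar> \<le> M"
    and lim: "\<And>\<epsilon>. 0 < \<epsilon> \<Longrightarrow> \<exists>\<eta>>0. \<forall>\<^sub>F x in F. \<forall>y\<in>{-\<eta>..0}. \<bar>V x y - A\<bar> \<le> \<epsilon>"
  shows "((\<lambda>x. integral {-d..0} (\<lambda>y. exp (- ((e x - y) / (2 * \<rho> x))\<^sup>2) / \<rho> x * V x y)) \<longlongrightarrow> 2 * half_gauss * A) F"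
proof -
  let ?G = gauss_prim
  let ?k = "\<lambda>x y. exp (- ((e x - y) / (2 * \<rho> x))\<^sup>2) / \<rho> x"
  have e0: "((\<lambda>x. e x / (2 * \<rho> x)) \<longlongrightarrow> 0) F"
    using tendsto_divide[OF e tendsto_const[of 2]] by (simp add: mult.commute)
  have top: "((\<lambda>x. ?G ((e x + a) / (2 * \<rho> x))) \<longlongrightarrow> ?G 0 + half_gauss) F" if a: "a > 0" for a
  proof (rule filterlim_compose[OF gauss_prim_tendsto])
    have "filterlim (\<lambda>x. a / 2 / \<rho> x) at_top F"
      by (rule LIM_at_top_divide[OF tendsto_const _ \<rho>]) (use a in simp)
    from filterlim_tendsto_add_at_top[OF e0 this]
    show "filterlim (\<lambda>x. (e x + a) / (2 * \<rho> x)) at_top F" by (simp add: add_divide_distrib)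
  qed
  have zero: "((\<lambda>x. ?G (e x / (2 * \<rho> x))) \<longlongrightarrow> ?G 0) F"
    by (rule isCont_tendsto_compose[OF DERIV_isCont[OF gauss_prim_has_derivative] e0]) simp
  have mass: "((\<lambda>x. 2 * (?G ((e x + a) / (2 * \<rho> x)) - ?G (e x / (2 * \<rho> x)))) \<longlongrightarrow> 2 * half_gauss) F" if "a > 0" for a
    using tendsto_mult[OF tendsto_const[of 2] tendsto_diff[OF top[OF that] zero]] by simp
  have tail: "((\<lambda>x. 2 * (?G ((e x + d) / (2 * \<rho> x)) - ?G ((e x + a) / (2 * \<rho> x)))) \<longlongrightarrow> 0) F" if "a > 0" for a
    using tendsto_mult[OF tendsto_const[of 2] tendsto_diff[OF top[OF d] top[OF that]]] by simp
  have K: "0 \<le> half_gauss" using half_gauss_pos by simp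
  show ?thesis
  proof (rule tendstoI)
    fix r :: real assume r: "r > 0"
    define \<epsilon> where "\<epsilon> = r / (4 * (2 * half_gauss + 1))"
    have \<epsilon>: "\<epsilon> > 0" using r K by (simp add: \<epsilon>_def)
    obtain \<eta>0 where \<eta>0: "\<eta>0 > 0" "\<forall>\<^sub>F x in F. \<forall>y\<in>{-\<eta>0..0}. \<bar>V x y - A\<bar> \<le> \<epsilon>" using lim[OF \<epsilon>] by blast
    define \<eta> where "\<eta> = min \<eta>0 d"
    have \<eta>: "\<eta> > 0" "\<eta> \<le> d" "\<eta> \<le> \<eta>0" using \<eta>0 d by (auto simp: \<eta>_def)
    define N where "N = \<bar>M\<bar> + \<bar>A\<bar>"
    have "((\<lambda>x. N * (2 * (?G ((e x + d) / (2 * \<rho> x)) - ?G ((e x + \<eta>) / (2 * \<rho> x))))) \<longlongrightarrow> N * 0) F"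
      by (intro tendsto_mult tendsto_const tail \<eta>)
    then have E1: "\<forall>\<^sub>F x in F. N * (2 * (?G ((e x + d) / (2 * \<rho> x)) - ?G ((e x + \<eta>) / (2 * \<rho> x)))) < r / 4"
      by (rule order_tendstoD(2)) (use r in simp)
    have E2: "\<forall>\<^sub>F x in F. 2 * (?G ((e x + \<eta>) / (2 * \<rho> x)) - ?G (e x / (2 * \<rho> x))) < 2 * half_gauss + 1"
      by (rule order_tendstoD(2)[OF mass[OF \<eta>(1)]]) simp
    have "((\<lambda>x. A * (2 * (?G ((e x + d) / (2 * \<rho> x)) - ?G (e x / (2 * \<rho> x))))) \<longlongrightarrow> A * (2 * half_gauss)) F"
      by (intro tendsto_mult tendsto_const mass d)
    then have E3: "\<forall>\<^sub>F x in F. dist (A * (2 * (?G ((e x + d) / (2 * \<rho> x)) - ?G (e x / (2 * \<rho> x))))) (A * (2 * half_gauss)) < r / 4"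
      by (rule tendstoD) (use r in simp)
    have E4: "\<forall>\<^sub>F x in F. -1 < e x / (2 * \<rho> x)" by (rule order_tendstoD(1)[OF e0]) simp
    show "\<forall>\<^sub>F x in F. dist (integral {-d..0} (\<lambda>y. ?k x y * V x y)) (2 * half_gauss * A) < r"
      using E1 E2 E3 E4 \<rho>(2) V \<eta>0(2)
    proof eventually_elim
      case (elim x)
      have kc: "continuous_on S (?k x)" for S using elim(5) by (intro continuous_intros) auto
      have "e x / (2 * \<rho> x) \<le> (e x + \<eta>) / (2 * \<rho> x)" using \<eta> elim(5) by (intro divide_right_mono) auto
      then have E5: "-1 < (e x + \<eta>) / (2 * \<rho> x)" using elim(4) by linarith
      have m: "(?k x has_integral 2 * (?G ((e x + d) / (2 * \<rho> x)) - ?G (e x / (2 * \<rho> x)))) {-d..0}"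
        using gauss_mass[OF elim(5), of "-d" 0 "e x"] d elim(4) by simp
      have m1: "(?k x has_integral 2 * (?G ((e x + d) / (2 * \<rho> x)) - ?G ((e x + \<eta>) / (2 * \<rho> x)))) {-d..-\<eta>}"
        using gauss_mass[OF elim(5), of "-d" "-\<eta>" "e x"] \<eta> E5 by simp
      have m2: "(?k x has_integral 2 * (?G ((e x + \<eta>) / (2 * \<rho> x)) - ?G (e x / (2 * \<rho> x)))) {-\<eta>..0}"
        using gauss_mass[OF elim(5), of "-\<eta>" 0 "e x"] \<eta> elim(4) by simp
      let ?f = "\<lambda>y. ?k x y * (V x y - A)"
      have fc: "continuous_on {-d..0} ?f" by (intro continuous_on_mult kc continuous_on_diff elim continuous_on_const)
      have k0: "0 \<le> ?k x y" for y using elim(5) by simp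
      have f1: "norm (integral {-d..-\<eta>} ?f) \<le> integral {-d..-\<eta>} (\<lambda>y. N * ?k x y)"
      proof (rule integral_norm_bound_integral)
        show "?f integrable_on {-d..-\<eta>}"
          using \<eta> by (intro integrable_continuous_real continuous_on_subset[OF fc]) auto
        show "(\<lambda>y. N * ?k x y) integrable_on {-d..-\<eta>}" using m1 by (intro integrable_on_mult_right) blast
        fix y assume "y \<in> {-d..-\<eta>}"
        then have "\<bar>V x y\<bar> \<le> M" using elim(7) \<eta> by auto
        then have "\<bar>V x y - A\<bar> \<le> N" unfolding N_def by linarith
        then have "?k x y * \<bar>V x y - A\<bar> \<le> ?k x y * N" by (intro mult_left_mono k0)
        then show "norm (?f y) \<le> N * ?k x y" using k0[of y] elim(5) by (simp add: abs_mult mult.commute)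
      qed
      have f2: "norm (integral {-\<eta>..0} ?f) \<le> integral {-\<eta>..0} (\<lambda>y. \<epsilon> * ?k x y)"
      proof (rule integral_norm_bound_integral)
        show "?f integrable_on {-\<eta>..0}"
          using \<eta> by (intro integrable_continuous_real continuous_on_subset[OF fc]) auto
        show "(\<lambda>y. \<epsilon> * ?k x y) integrable_on {-\<eta>..0}" using m2 by (intro integrable_on_mult_right) blast
        fix y assume "y \<in> {-\<eta>..0}"
        then have "\<bar>V x y - A\<bar> \<le> \<epsilon>" using elim(8) \<eta> by auto
        then have "?k x y * \<bar>V x y - A\<bar> \<le> ?k x y * \<epsilon>" by (intro mult_left_mono k0)
        then show "norm (?f y) \<le> \<epsilon> * ?k x y" using k0[of y] elim(5) by (simp add: abs_mult mult.commute)
      qed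
      have "integral {-d..0} ?f = integral {-d..-\<eta>} ?f + integral {-\<eta>..0} ?f"
        using \<eta> by (intro Henstock_Kurzweil_Integration.integral_combine[symmetric] integrable_continuous_real fc) auto
      moreover have "\<epsilon> * (2 * (?G ((e x + \<eta>) / (2 * \<rho> x)) - ?G (e x / (2 * \<rho> x)))) \<le> \<epsilon> * (2 * half_gauss + 1)"
        using elim(2) \<epsilon> by (intro mult_left_mono) auto
      moreover have "\<epsilon> * (2 * half_gauss + 1) = r / 4"
        using K by (simp add: \<epsilon>_def divide_simps)
      moreover have "integral {-d..-\<eta>} (\<lambda>y. N * ?k x y) = N * (2 * (?G ((e x + d) / (2 * \<rho> x)) - ?G ((e x + \<eta>) / (2 * \<rho> x))))"
        by (intro integral_unique has_integral_mult_right m1)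
      moreover have "integral {-\<eta>..0} (\<lambda>y. \<epsilon> * ?k x y) = \<epsilon> * (2 * (?G ((e x + \<eta>) / (2 * \<rho> x)) - ?G (e x / (2 * \<rho> x))))"
        by (intro integral_unique has_integral_mult_right m2)
      ultimately have F: "\<bar>integral {-d..0} ?f\<bar> \<le> r / 4 + r / 4"
        using f1 f2 elim(1) unfolding real_norm_def by linarith
      have "integral {-d..0} (\<lambda>y. ?k x y * V x y) = integral {-d..0} (\<lambda>y. ?f y + A * ?k x y)"
      proof (rule Henstock_Kurzweil_Integration.integral_cong)
        have "k * v = k * (v - A) + A * k" for k v :: real by (simp add: algebra_simps)
        then show "?k x y * V x y = ?f y + A * ?k x y" for y .
      qed
      also have "\<dots> = integral {-d..0} ?f + A * (2 * (?G ((e x + d) / (2 * \<rho> x)) - ?G (e x / (2 * \<rho> x))))"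
        by (intro integral_unique has_integral_add has_integral_mult_right m integrable_integral integrable_continuous_real fc)
      finally show ?case
        using F elim(3) r unfolding dist_real_def mult.commute[of "2 * half_gauss" A] by linarith
    qed
  qed
qed

section \<open>Boundary representation of heat solutions\<close>

text \<open>The equation is given only for interior \<open>y\<close>; its integrated form extends to the end points by continuity.\<close>

lemma derivative_up_to_boundary:
  fixes F G :: "real \<Rightarrow> real \<Rightarrow> real"
  assumes F: "continuous_on ({a..b} \<times> {\<alpha>..\<beta>}) (\<lambda>(y, t). F y t)" and G: "continuous_on ({a..b} \<times> {\<alpha>..\<beta>}) (\<lambda>(y, t). G y t)"
    and ab: "a < b"
    and D: "\<And>y t. y \<in> {a<..<b} \<Longrightarrow> t \<in> {\<alpha>..\<beta>} \<Longrightarrow> (F y has_real_derivative G y t) (at t within {\<alpha>..\<beta>})"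
    and y: "y \<in> {a..b}" and t: "t \<in> {\<alpha>..\<beta>}"
  shows "(F y has_real_derivative G y t) (at t within {\<alpha>..\<beta>})"
proof -
  have Gt: "continuous_on {\<alpha>..\<beta>} (G y)" if "y \<in> {a..b}" for y
  proof -
    have "continuous_on {\<alpha>..\<beta>} (\<lambda>t. (\<lambda>(y, t). G y t) (y, t))"
      using that by (intro continuous_on_compose2[OF G] continuous_intros) auto
    then show ?thesis by simp
  qed
  have eq: "F y s = F y \<alpha> + integral {\<alpha>..s} (G y)" if s: "s \<in> {\<alpha>..\<beta>}" for s
  proof -
    have Fs: "continuous_on {a..b} (\<lambda>y. F y s')" if "s' \<in> {\<alpha>..\<beta>}" for s'
    proof -
      have "continuous_on {a..b} (\<lambda>y. (\<lambda>(y, t). F y t) (y, s'))"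
        using that by (intro continuous_on_compose2[OF F] continuous_intros) auto
      then show ?thesis by simp
    qed
    have "continuous_on ({a..b} \<times> cbox \<alpha> s) (\<lambda>(y, t). G y t)"
      by (rule continuous_on_subset[OF G]) (use s in auto)
    from integral_continuous_on_param[OF this]
    have Gi: "continuous_on {a..b} (\<lambda>y. integral {\<alpha>..s} (G y))" by simp
    have "F y s - F y \<alpha> - integral {\<alpha>..s} (G y) = 0"
    proof (rule continuous_constant_on_closure[where S="{a<..<b}" and f="\<lambda>y. F y s - F y \<alpha> - integral {\<alpha>..s} (G y)"])
      show "continuous_on (closure {a<..<b}) (\<lambda>y. F y s - F y \<alpha> - integral {\<alpha>..s} (G y))"
        using s by (auto simp: ab intro!: continuous_on_diff Fs Gi)
      show "y \<in> closure {a<..<b}" using y by (simp add: ab)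
      fix y assume y: "y \<in> {a<..<b}"
      have "(G y has_integral F y s - F y \<alpha>) {\<alpha>..s}"
      proof (rule fundamental_theorem_of_calculus)
        fix t assume "t \<in> {\<alpha>..s}"
        then have "(F y has_real_derivative G y t) (at t within {\<alpha>..s})"
          using s by (intro DERIV_subset[OF D[OF y]]) auto
        then show "(F y has_vector_derivative G y t) (at t within {\<alpha>..s})"
          by (simp only: has_real_derivative_iff_has_vector_derivative)
      qed (use s in auto)
      then show "F y s - F y \<alpha> - integral {\<alpha>..s} (G y) = 0" by (simp add: integral_unique)
    qed
    then show ?thesis by simp
  qed
  have "((\<lambda>s. F y \<alpha> + integral {\<alpha>..s} (G y)) has_real_derivative 0 + G y t) (at t within {\<alpha>..\<beta>})"
    by (intro DERIV_add DERIV_const integral_has_real_derivative Gt y t)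
  then have "((\<lambda>s. F y \<alpha> + integral {\<alpha>..s} (G y)) has_real_derivative G y t) (at t within {\<alpha>..\<beta>})" by simp
  then show ?thesis
    by (rule has_field_derivative_transform_within[where d=1]) (use t eq[symmetric] in simp_all)
qed

text \<open>A solution of the heat equation in the strip of width \<open>d\<close> behind the curve \<open>c\<close>, in the moving
  coordinate \<open>y = x - c t\<close>, which contributes the drift \<open>c' t * Wy\<close>.  The boundary curve is \<open>y = 0\<close>.
  The condition with \<open>\<delta>\<close> says that the boundary at time \<open>t\<close> stays away from the far edge \<open>y = -d\<close>
  at time \<open>\<tau>\<close>.\<close>

locale boundary_layer =
  fixes d L \<delta> :: real and c c' :: "real \<Rightarrow> real" and W Wy Wyy :: "real \<Rightarrow> real \<Rightarrow> real"
  assumes d: "0 < d" and L: "0 < L"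
    and c: "\<And>t. t \<in> {0..L} \<Longrightarrow> (c has_real_derivative c' t) (at t within {0..L})"
    and c'_cont: "continuous_on {0..L} c'"
    and \<delta>: "0 < \<delta>" "\<And>t \<tau>. t \<in> {0..L} \<Longrightarrow> \<tau> \<in> {0..L} \<Longrightarrow> \<delta> \<le> c t - c \<tau> + d"
    and W_cont: "continuous_on ({-d..0} \<times> {0..L}) (\<lambda>(y, t). W y t)"
    and Wy_cont: "continuous_on ({-d..0} \<times> {0..L}) (\<lambda>(y, t). Wy y t)"
    and Wyy_cont: "continuous_on ({-d..0} \<times> {0..L}) (\<lambda>(y, t). Wyy y t)"
    and W_y: "\<And>y t. y \<in> {-d..0} \<Longrightarrow> t \<in> {0..L} \<Longrightarrow> ((\<lambda>y. W y t) has_real_derivative Wy y t) (at y within {-d..0})"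
    and W_yy: "\<And>y t. y \<in> {-d..0} \<Longrightarrow> t \<in> {0..L} \<Longrightarrow> ((\<lambda>y. Wy y t) has_real_derivative Wyy y t) (at y within {-d..0})"
    and heat: "\<And>y t. y \<in> {-d<..<0} \<Longrightarrow> t \<in> {0..L} \<Longrightarrow>
       (W y has_real_derivative Wyy y t + c' t * Wy y t) (at t within {0..L})"
begin

lemma c_cont: "continuous_on {0..L} c"
  using c DERIV_continuous_on by blast

lemma c'_cont_snd: "continuous_on ({-d..0} \<times> {0..L}) (\<lambda>q. c' (snd q))"
  by (rule continuous_on_compose2[OF c'_cont]) (auto intro!: continuous_intros)

lemma heat_closed:
  assumes "y \<in> {-d..0}" "t \<in> {0..L}"
  shows "(W y has_real_derivative Wyy y t + c' t * Wy y t) (at t within {0..L})"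
proof (rule derivative_up_to_boundary[OF W_cont _ _ heat assms])
  show "continuous_on ({-d..0} \<times> {0..L}) (\<lambda>(y, t). Wyy y t + c' t * Wy y t)"
    using Wyy_cont Wy_cont c'_cont_snd unfolding case_prod_unfold by (intro continuous_on_add continuous_on_mult)
qed (use d in auto)

lemma slice_y:
  assumes "continuous_on ({-d..0} \<times> {0..L}) (\<lambda>(y, t). V y t :: real)" "t \<in> {0..L}"
  shows "continuous_on {-d..0} (\<lambda>y. V y t)"
proof -
  have "continuous_on {-d..0} (\<lambda>y. (\<lambda>(y, t). V y t) (y, t))"
    using assms(2) by (intro continuous_on_compose2[OF assms(1)] continuous_intros) auto
  then show ?thesis by simp
qed

lemma slice_t:
  assumes "continuous_on ({-d..0} \<times> {0..L}) (\<lambda>(y, t). V y t :: real)" "y \<in> {-d..0}"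
  shows "continuous_on {0..L} (V y)"
proof -
  have "continuous_on {0..L} (\<lambda>t. (\<lambda>(y, t). V y t) (y, t))"
    using assms(2) by (intro continuous_on_compose2[OF assms(1)] continuous_intros) auto
  then show ?thesis by simp
qed

text \<open>The flux of Green's identity through \<open>y\<close> at time \<open>\<tau>\<close>, for the kernel centred at the boundary point at time
  \<open>t\<close>.  The last kernel with its factor is the derivative of the first one in its space argument.\<close>

definition flux :: "real \<Rightarrow> real \<Rightarrow> real \<Rightarrow> real" where
  "flux t y \<tau> = heat_ker 0 1 (c t - c \<tau> - y) (t - \<tau>) * Wy y \<tau>
     + (c' \<tau> * heat_ker 0 1 (c t - c \<tau> - y) (t - \<tau>) - 1/2 * heat_ker 1 3 (c t - c \<tau> - y) (t - \<tau>)) * W y \<tau>"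

definition heat_mass :: "real \<Rightarrow> real \<Rightarrow> real" where
  "heat_mass t \<tau> = integral {-d..0} (\<lambda>y. heat_ker 0 1 (c t - c \<tau> - y) (t - \<tau>) * W y \<tau>)"

lemma heat_ker_cont_pos:
  assumes t: "t \<in> {0..L}"
  shows "continuous_on ({0..<t} \<times> {-d..0}) (\<lambda>q. heat_ker i j (c t - c (fst q) - snd q) (t - fst q))"
proof -
  have "continuous_on ({0..<t} \<times> {-d..0}) (\<lambda>q. c (fst q))"
    using t by (intro continuous_on_compose2[OF c_cont] continuous_intros) auto
  then have "continuous_on ({0..<t} \<times> {-d..0}) (\<lambda>q. (c t - c (fst q) - snd q) ^ i
     * exp (- ((c t - c (fst q) - snd q)\<^sup>2 / (4 * (t - fst q)))) / sqrt (t - fst q) ^ j)"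
    by (intro continuous_intros) auto
  then show ?thesis
    by (rule continuous_on_eq) (auto simp: heat_ker_def)
qed

lemma swap_cont:
  assumes "continuous_on ({-d..0} \<times> {0..L}) (\<lambda>(y, t). V y t :: real)" "t \<in> {0..L}"
  shows "continuous_on ({0..<t} \<times> {-d..0}) (\<lambda>q. V (snd q) (fst q))"
proof -
  have "continuous_on ({0..<t} \<times> {-d..0}) (\<lambda>q. (\<lambda>(y, t). V y t) (snd q, fst q))"
    using assms(2) by (intro continuous_on_compose2[OF assms(1)] continuous_intros) auto
  then show ?thesis by simp
qed

text \<open>Green's identity: the kernel solves the backward heat equation in \<open>\<tau>\<close>, so the time derivative of the integrand is an
  exact \<open>y\<close>-derivative.\<close>

lemma heat_mass_deriv:
  assumes t: "t \<in> {0..L}" and \<tau>: "\<tau> \<in> {0..<t}"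
  shows "(heat_mass t has_real_derivative flux t 0 \<tau> - flux t (-d) \<tau>) (at \<tau> within {0..<t})"
proof -
  define k where "k = (\<lambda>i j \<tau> y. heat_ker i j (c t - c \<tau> - y) (t - \<tau>))"
  define D where "D = (\<lambda>\<tau> y. (1/2 * c' \<tau> * k 1 3 \<tau> y - (1/4 * k 2 5 \<tau> y - 1/2 * k 0 3 \<tau> y)) * W y \<tau>
      + (Wyy y \<tau> + c' \<tau> * Wy y \<tau>) * k 0 1 \<tau> y)"
  have sub: "{0..<t} \<subseteq> {0..L}" using t by auto
  have kc: "continuous_on ({0..<t} \<times> {-d..0}) (\<lambda>q. k i j (fst q) (snd q))" for i j
    unfolding k_def by (rule heat_ker_cont_pos[OF t])
  have kc1: "continuous_on {-d..0} (k i j s)" if "s \<in> {0..<t}" for i j s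
  proof -
    have "continuous_on {-d..0} (\<lambda>y. k i j (fst (s, y)) (snd (s, y)))"
      using that by (intro continuous_on_compose2[OF kc] continuous_intros) auto
    then show ?thesis by simp
  qed
  have "((\<lambda>\<tau>. integral (cbox (-d) 0) (\<lambda>y. k 0 1 \<tau> y * W y \<tau>)) has_field_derivative integral (cbox (-d) 0) (D \<tau>)) (at \<tau> within {0..<t})"
  proof (rule leibniz_rule_field_derivative[OF _ _ _ \<tau>])
    fix s y assume s: "s \<in> {0..<t}" and y: "y \<in> cbox (-d) 0"
    have z: "((\<lambda>s. c t - c s - y) has_real_derivative - c' s) (at s within {0..<t})"
      using DERIV_subset[OF c sub, of s] s t by (auto intro!: derivative_eq_intros)
    have r: "((\<lambda>s. t - s) has_real_derivative - 1) (at s within {0..<t})"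
      by (auto intro!: derivative_eq_intros)
    have w: "(W y has_real_derivative Wyy y s + c' s * Wy y s) (at s within {0..<t})"
      by (rule DERIV_subset[OF heat_closed sub]) (use s y t in auto)
    show "((\<lambda>s. k 0 1 s y * W y s) has_field_derivative D s y) (at s within {0..<t})"
      unfolding k_def
      by (rule DERIV_cong[OF DERIV_mult[OF heat_ker_has_derivative_pos[OF z r _ s] w]])
        (use s in \<open>simp_all add: D_def k_def numeral_eq_Suc\<close>)
  next
    show "(\<lambda>y. k 0 1 s y * W y s) integrable_on cbox (-d) 0" if "s \<in> {0..<t}" for s
      unfolding box_real using that sub
      by (intro integrable_continuous_real continuous_on_mult kc1 slice_y[OF W_cont]) auto
    have "continuous_on ({0..<t} \<times> {-d..0}) (\<lambda>q. c' (fst q))"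
      using sub by (intro continuous_on_compose2[OF c'_cont] continuous_intros) auto
    then show "continuous_on ({0..<t} \<times> cbox (-d) 0) (\<lambda>(s, y). D s y)"
      unfolding D_def case_prod_unfold box_real
      by (intro continuous_on_add continuous_on_diff continuous_on_mult continuous_on_const kc
          swap_cont[OF W_cont t] swap_cont[OF Wy_cont t] swap_cont[OF Wyy_cont t])
  qed auto
  moreover have "(D \<tau> has_integral flux t 0 \<tau> - flux t (-d) \<tau>) {-d..0}"
  proof (rule fundamental_theorem_of_calculus)
    fix y assume y: "y \<in> {-d..0}"
    have \<tau>L: "\<tau> \<in> {0..L}" using sub \<tau> by auto
    have z: "((\<lambda>y. c t - c \<tau> - y) has_real_derivative - 1) (at y within {-d..0})"
      by (auto intro!: derivative_eq_intros)
    have r: "((\<lambda>y. t - \<tau>) has_real_derivative 0) (at y within {-d..0})" by simp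
    have pos: "0 < t - \<tau>" using \<tau> by simp
    note hk = heat_ker_has_derivative_pos[OF z r pos y]
    have k1: "(k 0 1 \<tau> has_real_derivative 1/2 * k 1 3 \<tau> y) (at y within {-d..0})"
      unfolding k_def by (rule DERIV_cong[OF hk]) (simp add: numeral_eq_Suc)
    have k2: "(k 1 3 \<tau> has_real_derivative 1/2 * k 2 5 \<tau> y - k 0 3 \<tau> y) (at y within {-d..0})"
      unfolding k_def by (rule DERIV_cong[OF hk]) (simp add: numeral_eq_Suc)
    have "((\<lambda>y. k 0 1 \<tau> y * Wy y \<tau> + (c' \<tau> * k 0 1 \<tau> y - 1/2 * k 1 3 \<tau> y) * W y \<tau>) has_real_derivative D \<tau> y) (at y within {-d..0})"
      by (rule DERIV_cong[OF DERIV_add[OF DERIV_mult[OF k1 W_yy[OF y \<tau>L]]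
            DERIV_mult[OF DERIV_diff[OF DERIV_cmult[OF k1] DERIV_cmult[OF k2]] W_y[OF y \<tau>L]]]])
        (simp add: D_def algebra_simps)
    then show "((\<lambda>y. flux t y \<tau>) has_vector_derivative D \<tau> y) (at y within {-d..0})"
      unfolding flux_def k_def by (simp only: has_real_derivative_iff_has_vector_derivative)
  qed (use d in auto)
  then have "integral {-d..0} (D \<tau>) = flux t 0 \<tau> - flux t (-d) \<tau>" by (rule integral_unique)
  ultimately show ?thesis
    unfolding heat_mass_def[abs_def] k_def box_real by (rule DERIV_cong)
qed

lemma flux_far_cont: 
  assumes t: "t \<in> {0..L}"
  shows "continuous_on {0..L} (flux t (-d))"
proof -
  have "continuous_on {0..L} (\<lambda>\<tau>. (\<lambda>(z, r). heat_ker i j z r) (c t - c \<tau> - -d, t - \<tau>))" for i j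
    using \<delta>(2) t by (intro continuous_on_compose2[OF continuous_on_heat_ker[OF \<delta>(1)]] continuous_intros c_cont) auto
  then show ?thesis
    unfolding flux_def[abs_def] using d
    by (intro continuous_on_add continuous_on_diff continuous_on_mult continuous_on_const c'_cont
        slice_t[OF W_cont] slice_t[OF Wy_cont]) auto
qed

text \<open>The difference quotient of \<open>c\<close> between \<open>t * (cos \<phi>)\<^sup>2\<close> and \<open>t\<close>, written as a mean of \<open>c'\<close>: this form is
  regular at \<open>\<phi> = 0\<close>, and it is an integral of dilates of \<open>c'\<close>.\<close>

definition secant :: "real \<Rightarrow> real \<Rightarrow> real" where
  "secant t \<phi> = integral {0..1} (\<lambda>v. c' (t * ((cos \<phi>)\<^sup>2 + v * (sin \<phi>)\<^sup>2)))"

text \<open>The exponential factor of the heat kernel between the boundary points at times \<open>t\<close> and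
  \<open>t * (cos \<phi>)\<^sup>2\<close>.\<close>

definition gauss_fac :: "real \<Rightarrow> real \<Rightarrow> real" where
  "gauss_fac t \<phi> = exp (- ((secant t \<phi>)\<^sup>2 * (t * (sin \<phi>)\<^sup>2) / 4))"

lemma interpolate_mem: "v \<in> {0..1} \<Longrightarrow> (cos \<phi>)\<^sup>2 + v * (sin \<phi>)\<^sup>2 \<in> {0..1}" for v \<phi> :: real
proof -
  assume v: "v \<in> {0..1}"
  then have "v * (sin \<phi>)\<^sup>2 \<le> (sin \<phi>)\<^sup>2" by (intro mult_left_le_one_le) auto
  then have "(cos \<phi>)\<^sup>2 + v * (sin \<phi>)\<^sup>2 \<le> 1" using sin_cos_squared_add[of \<phi>] by linarith
  then show ?thesis using v by auto
qed

lemma interpolate_mem': "t \<in> {0..L} \<Longrightarrow> v \<in> {0..1} \<Longrightarrow> t * ((cos \<phi>)\<^sup>2 + v * (sin \<phi>)\<^sup>2) \<in> {0..L}"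
  using interpolate_mem[of v \<phi>] mult_left_le[of "(cos \<phi>)\<^sup>2 + v * (sin \<phi>)\<^sup>2" t] by auto

lemma secant_integrable:
  assumes t: "t \<in> {0..L}"
  shows "(\<lambda>v. c' (t * ((cos \<phi>)\<^sup>2 + v * (sin \<phi>)\<^sup>2))) integrable_on {0..1}"
  using interpolate_mem'[OF t]
  by (intro integrable_continuous_real continuous_on_compose2[OF c'_cont] continuous_intros) auto

lemma secant_eq:
  assumes t: "t \<in> {0..L}"
  shows "secant t \<phi> * (t * (sin \<phi>)\<^sup>2) = c t - c (t * (cos \<phi>)\<^sup>2)"
proof -
  let ?x = "\<lambda>v. t * ((cos \<phi>)\<^sup>2 + v * (sin \<phi>)\<^sup>2)"
  have "((\<lambda>v. c' (?x v) * (t * (sin \<phi>)\<^sup>2)) has_integral c (?x 1) - c (?x 0)) {0..1}"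
  proof (rule fundamental_theorem_of_calculus)
    fix v :: real assume v: "v \<in> {0..1}"
    have sub: "?x ` {0..1} \<subseteq> {0..L}" using interpolate_mem'[OF t] by blast
    have "(c \<circ> ?x has_real_derivative c' (?x v) * (t * (sin \<phi>)\<^sup>2)) (at v within {0..1})"
      by (rule DERIV_image_chain[OF DERIV_subset[OF c sub]])
        (use interpolate_mem'[OF t v] in \<open>auto intro!: derivative_eq_intros\<close>)
    then show "((\<lambda>v. c (?x v)) has_vector_derivative c' (?x v) * (t * (sin \<phi>)\<^sup>2)) (at v within {0..1})"
      by (simp only: has_real_derivative_iff_has_vector_derivative o_def)
  qed auto
  moreover have "((\<lambda>v. c' (?x v) * (t * (sin \<phi>)\<^sup>2)) has_integral secant t \<phi> * (t * (sin \<phi>)\<^sup>2)) {0..1}"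
    unfolding secant_def by (intro has_integral_mult_left integrable_integral secant_integrable t)
  ultimately show ?thesis by (auto dest: has_integral_unique)
qed

lemma euler_C_secant:
  assumes "C_diff_on k c' {0..L}"
  shows "euler_C k L {0..pi/2} secant"
proof -
  have "euler_C k L ({0..pi/2} \<times> {0..1}) (\<lambda>t q. c' (t * ((cos (fst q))\<^sup>2 + snd q * (sin (fst q))\<^sup>2)))"
    by (rule euler_C_dilate[OF _ interpolate_mem _ _ C_diff_on_imp_euler_C[OF assms], where j="\<lambda>_. 0::real" and R'=UNIV])
      (auto intro!: continuous_intros)
  from euler_C_integral[OF this] show ?thesis by (simp add: secant_def[abs_def])
qed

lemma euler_C_gauss_fac:
  assumes "C_diff_on k c' {0..L}"
  shows "euler_C k L {0..pi/2} gauss_fac"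
proof -
  have "euler_C k L {0..pi/2} (\<lambda>t \<phi>. exp ((- (1/4)) * ((secant t \<phi> * secant t \<phi>) * (t * (sin \<phi>)\<^sup>2))))"
    by (intro euler_C_exp euler_C_mult euler_C_const euler_C_secant[OF assms] euler_C_time
        euler_C_const_in_time continuous_intros)
  moreover have "gauss_fac = (\<lambda>t \<phi>. exp ((- (1/4)) * ((secant t \<phi> * secant t \<phi>) * (t * (sin \<phi>)\<^sup>2))))"
    by (auto simp: gauss_fac_def fun_eq_iff power2_eq_square)
  ultimately show ?thesis by simp
qed

lemma secant_bound:
  assumes t: "t \<in> {0..L}" and B: "\<And>t. t \<in> {0..L} \<Longrightarrow> \<bar>c' t\<bar> \<le> B"
  shows "\<bar>secant t \<phi>\<bar> \<le> B"
proof -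
  have "norm (secant t \<phi>) \<le> integral {0..1} (\<lambda>v::real. B)"
    unfolding secant_def
    by (rule integral_norm_bound_integral[OF secant_integrable[OF t]])
      (use B interpolate_mem'[OF t] in auto)
  then show ?thesis by simp
qed

lemma lag_eq: "t - t * (cos \<phi>)\<^sup>2 = t * (sin \<phi>)\<^sup>2" for t \<phi> :: real
  by (simp add: sin_squared_eq algebra_simps)

text \<open>The boundary points at times \<open>t\<close> and \<open>\<tau>\<close> are at distance of order \<open>t - \<tau>\<close>, so the flux is singular only like
  \<open>1 / sqrt (t - \<tau>)\<close>; the Jacobian of the substitution cancels that.\<close>

lemma flux_at_boundary:
  assumes t: "t \<in> {0<..L}" and \<phi>: "\<phi> \<in> {0<..<pi/2}"
  shows "flux t 0 (t * (cos \<phi>)\<^sup>2) * (2 * t * cos \<phi> * sin \<phi>)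
    = 2 * sqrt t * cos \<phi> * gauss_fac t \<phi> * (Wy 0 (t * (cos \<phi>)\<^sup>2)
        + (c' (t * (cos \<phi>)\<^sup>2) - secant t \<phi> / 2) * W 0 (t * (cos \<phi>)\<^sup>2))"
proof -
  define r where "r = t * (sin \<phi>)\<^sup>2"
  have s: "0 < sin \<phi>" using \<phi> by (intro sin_gt_zero) auto
  have r: "0 < r" using t s by (simp add: r_def)
  have sr: "sqrt r = sqrt t * sin \<phi>" using s by (simp add: r_def real_sqrt_mult)
  have rr: "sqrt r * sqrt r = r" using r by simp
  have z: "c t - c (t * (cos \<phi>)\<^sup>2) = secant t \<phi> * r"
    using secant_eq[of t \<phi>] t by (simp add: r_def)
  have lag: "t - t * (cos \<phi>)\<^sup>2 = r" by (simp add: lag_eq r_def)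
  have "(secant t \<phi> * r)\<^sup>2 / (4 * r) = (secant t \<phi>)\<^sup>2 * r / 4"
    using r by (simp add: power2_eq_square)
  then have e: "exp (- ((secant t \<phi> * r)\<^sup>2 / (4 * r))) = gauss_fac t \<phi>"
    by (simp add: gauss_fac_def r_def)
  have k1: "heat_ker 0 1 (secant t \<phi> * r) r = gauss_fac t \<phi> / sqrt r"
    using r e by (simp add: heat_ker_def)
  have "sqrt r ^ 3 = r * sqrt r" using rr by (simp add: power3_eq_cube)
  then have k3: "heat_ker 1 3 (secant t \<phi> * r) r = secant t \<phi> * gauss_fac t \<phi> / sqrt r"
    using r e by (simp add: heat_ker_def)
  have "t / sqrt r * sin \<phi> = sqrt t" using s t by (simp add: sr real_div_sqrt)
  moreover have "2 * t * cos \<phi> * sin \<phi> / sqrt r = 2 * cos \<phi> * (t / sqrt r * sin \<phi>)" by simp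
  ultimately have w: "2 * t * cos \<phi> * sin \<phi> / sqrt r = 2 * sqrt t * cos \<phi>"
    by (simp only: mult_ac)
  have "flux t 0 (t * (cos \<phi>)\<^sup>2) * (2 * t * cos \<phi> * sin \<phi>) = (2 * t * cos \<phi> * sin \<phi> / sqrt r) * gauss_fac t \<phi>
     * (Wy 0 (t * (cos \<phi>)\<^sup>2) + (c' (t * (cos \<phi>)\<^sup>2) - secant t \<phi> / 2) * W 0 (t * (cos \<phi>)\<^sup>2))"
    unfolding flux_def diff_zero z lag k1 k3 by (simp add: algebra_simps add_divide_distrib diff_divide_distrib)
  then show ?thesis unfolding w by simp
qed

text \<open>The kernel has width \<open>sqrt t * sin \<phi>\<close>, while its centre is at distance of order \<open>(sin \<phi>)\<^sup>2\<close> from the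
  boundary.\<close>

lemma heat_mass_tendsto:
  assumes t: "t \<in> {0<..L}"
  shows "((\<lambda>\<phi>. heat_mass t (t * (cos \<phi>)\<^sup>2)) \<longlongrightarrow> 2 * half_gauss * W 0 t) (at 0 within {0..pi/2})"
    (is "(_ \<longlongrightarrow> _) ?F")
proof -
  have tL: "t \<in> {0..L}" using t by auto
  let ?\<rho> = "\<lambda>\<phi>. sqrt t * sin \<phi>" and ?e = "\<lambda>\<phi>. c t - c (t * (cos \<phi>)\<^sup>2)"
  have pos: "\<forall>\<^sub>F \<phi> in ?F. \<phi> \<in> {0<..pi/2}" by (auto simp: eventually_at_filter)
  have sin0: "((\<lambda>\<phi>::real. sin \<phi>) \<longlongrightarrow> sin 0) ?F" by (intro tendsto_intros)
  have cos0: "((\<lambda>\<phi>::real. t * (cos \<phi>)\<^sup>2) \<longlongrightarrow> t * (cos 0)\<^sup>2) ?F" by (intro tendsto_intros)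
  have \<rho>pos: "\<forall>\<^sub>F \<phi> in ?F. 0 < ?\<rho> \<phi>"
    using pos
  proof eventually_elim
    case (elim \<phi>)
    then have "0 < sin \<phi>" using pi_gt_zero by (intro sin_gt_zero) auto
    then show ?case using t by simp
  qed
  have \<rho>0: "(?\<rho> \<longlongrightarrow> 0) ?F" using tendsto_mult[OF tendsto_const[of "sqrt t"] sin0] by simp
  have e0: "((\<lambda>\<phi>. ?e \<phi> / ?\<rho> \<phi>) \<longlongrightarrow> 0) ?F"
  proof -
    have "continuous_on ({0..L} \<times> {0..pi/2}) (\<lambda>(t, \<phi>). secant t \<phi>)"
      using euler_C_secant[of 0] c'_cont by (simp add: C_diff_on_0_iff)
    then have "continuous_on {0..pi/2} (\<lambda>\<phi>. (\<lambda>(t, \<phi>). secant t \<phi>) (t, \<phi>))"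
      using tL by (elim continuous_on_compose2) (auto intro!: continuous_intros)
    then have "(secant t \<longlongrightarrow> secant t 0) ?F" by (simp add: continuous_on)
    from tendsto_mult[OF this \<rho>0] have "((\<lambda>\<phi>. secant t \<phi> * ?\<rho> \<phi>) \<longlongrightarrow> 0) ?F" by simp
    moreover have "\<forall>\<^sub>F \<phi> in ?F. secant t \<phi> * ?\<rho> \<phi> = ?e \<phi> / ?\<rho> \<phi>"
      using \<rho>pos
    proof eventually_elim
      case (elim \<phi>)
      have "?\<rho> \<phi> * ?\<rho> \<phi> = t * (sin \<phi>)\<^sup>2"
        using t by (simp add: power2_eq_square[symmetric] power_mult_distrib)
      then have "?e \<phi> = secant t \<phi> * ?\<rho> \<phi> * ?\<rho> \<phi>"
        using secant_eq[OF tL, of \<phi>] by (simp only: mult.assoc)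
      then show ?case using elim by simp
    qed
    ultimately show ?thesis by (rule Lim_transform_eventually)
  qed
  have mem: "t * (cos \<phi>)\<^sup>2 \<in> {0..L}" for \<phi> by (rule dilate_mem[OF tL])
  have "compact ((\<lambda>(y, t). W y t) ` ({-d..0} \<times> {0..L}))"
    by (intro compact_continuous_image[OF W_cont] compact_Times) auto
  then obtain M where M: "\<And>y s. y \<in> {-d..0} \<Longrightarrow> s \<in> {0..L} \<Longrightarrow> \<bar>W y s\<bar> \<le> M"
    using compact_imp_bounded[THEN bounded_pos[THEN iffD1]] by fastforce
  have "((\<lambda>\<phi>. integral {-d..0} (\<lambda>y. exp (- ((?e \<phi> - y) / (2 * ?\<rho> \<phi>))\<^sup>2) / ?\<rho> \<phi> * W y (t * (cos \<phi>)\<^sup>2)))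
      \<longlongrightarrow> 2 * half_gauss * W 0 t) ?F"
  proof (rule half_gaussian_concentrates[OF d \<rho>0 \<rho>pos e0, where M=M])
    show "\<forall>\<^sub>F \<phi> in ?F. continuous_on {-d..0} (\<lambda>y. W y (t * (cos \<phi>)\<^sup>2))"
      by (intro always_eventually allI slice_y[OF W_cont] mem)
    show "\<forall>\<^sub>F \<phi> in ?F. \<forall>y\<in>{-d..0}. \<bar>W y (t * (cos \<phi>)\<^sup>2)\<bar> \<le> M"
      using M mem by (intro always_eventually) blast
    fix \<epsilon> :: real assume \<epsilon>: "0 < \<epsilon>"
    have "(0, t) \<in> {-d..0} \<times> {0..L}" using d tL by auto
    then obtain \<eta> where \<eta>: "\<eta> > 0" and near: "\<And>q. q \<in> {-d..0} \<times> {0..L} \<Longrightarrow> dist q (0, t) < \<eta> \<Longrightarrow>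
        dist (W (fst q) (snd q)) (W 0 t) < \<epsilon>"
      using W_cont[unfolded continuous_on_iff] \<epsilon> by (fastforce simp: case_prod_unfold)
    have "\<forall>\<^sub>F \<phi> in ?F. dist (t * (cos \<phi>)\<^sup>2) t < \<eta> / 2"
      using tendstoD[OF cos0, of "\<eta>/2"] \<eta> by simp
    then have "\<forall>\<^sub>F \<phi> in ?F. \<forall>y\<in>{-(min d (\<eta>/3))..0}. \<bar>W y (t * (cos \<phi>)\<^sup>2) - W 0 t\<bar> \<le> \<epsilon>"
    proof eventually_elim
      case (elim \<phi>)
      show ?case
      proof
        fix y assume y: "y \<in> {-(min d (\<eta>/3))..0}"
        then have "dist y 0 < \<eta> / 2" using \<eta> by (auto simp: dist_real_def)
        have "dist (y, t * (cos \<phi>)\<^sup>2) (0, t) \<le> dist y 0 + dist (t * (cos \<phi>)\<^sup>2) t"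
          unfolding dist_Pair_Pair by (rule sqrt_sum_squares_le_sum) auto
        then have "dist (y, t * (cos \<phi>)\<^sup>2) (0, t) < \<eta>" using elim \<open>dist y 0 < \<eta> / 2\<close> by linarith
        then show "\<bar>W y (t * (cos \<phi>)\<^sup>2) - W 0 t\<bar> \<le> \<epsilon>"
          using near[of "(y, t * (cos \<phi>)\<^sup>2)"] y mem[of \<phi>] by (auto simp: dist_real_def less_imp_le)
      qed
    qed
    then show "\<exists>\<eta>>0. \<forall>\<^sub>F \<phi> in ?F. \<forall>y\<in>{-\<eta>..0}. \<bar>W y (t * (cos \<phi>)\<^sup>2) - W 0 t\<bar> \<le> \<epsilon>"
      using \<eta> d by (intro exI[of _ "min d (\<eta>/3)"]) auto
  qed
  moreover have "\<forall>\<^sub>F \<phi> in ?F. integral {-d..0} (\<lambda>y. exp (- ((?e \<phi> - y) / (2 * ?\<rho> \<phi>))\<^sup>2) / ?\<rho> \<phi> * W y (t * (cos \<phi>)\<^sup>2))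
      = heat_mass t (t * (cos \<phi>)\<^sup>2)"
    using \<rho>pos
  proof eventually_elim
    case (elim \<phi>)
    have s: "0 < sin \<phi>" using elim t by (simp add: zero_less_mult_iff)
    have "sqrt (t - t * (cos \<phi>)\<^sup>2) = ?\<rho> \<phi>" using s by (simp add: lag_eq real_sqrt_mult)
    moreover have "t - t * (cos \<phi>)\<^sup>2 = (?\<rho> \<phi>)\<^sup>2" using t by (simp add: lag_eq power_mult_distrib)
    moreover have "\<not> (?\<rho> \<phi>)\<^sup>2 \<le> 0" using zero_less_power[OF elim, of 2] by (simp only: not_le)
    moreover have "(?e \<phi> - y)\<^sup>2 / (4 * (?\<rho> \<phi>)\<^sup>2) = ((?e \<phi> - y) / (2 * ?\<rho> \<phi>))\<^sup>2" for y
      by (simp add: power_divide power_mult_distrib)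
    ultimately have "heat_ker 0 1 (?e \<phi> - y) (t - t * (cos \<phi>)\<^sup>2) = exp (- ((?e \<phi> - y) / (2 * ?\<rho> \<phi>))\<^sup>2) / ?\<rho> \<phi>" for y
      unfolding heat_ker_def by (simp only: if_False power_one_right power_0 mult_1)
    then show ?case by (simp add: heat_mass_def)
  qed
  ultimately show ?thesis by (rule Lim_transform_eventually)
qed

text \<open>Green's identity integrated over the whole past, with \<open>\<phi>\<close> as the variable of integration.  The kernel leaves half of its
  mass, which is \<open>2 * half_gauss\<close>, on the side of the solution as \<open>\<tau>\<close> tends to \<open>t\<close>.\<close>

lemma boundary_identity:
  assumes t: "t \<in> {0<..L}"
  shows "2 * half_gauss * W 0 t + integral {0..t} (flux t (-d)) = heat_mass t 0
    + integral {0..pi/2} (\<lambda>\<phi>. 2 * sqrt t * cos \<phi> * gauss_fac t \<phi> * (Wy 0 (t * (cos \<phi>)\<^sup>2)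
        + (c' (t * (cos \<phi>)\<^sup>2) - secant t \<phi> / 2) * W 0 (t * (cos \<phi>)\<^sup>2)))"
proof -
  have tL: "t \<in> {0..L}" using t by auto
  define J where "J = (\<lambda>\<tau>. integral {0..\<tau>} (flux t (-d)))"
  define \<theta> where "\<theta> = (\<lambda>\<phi>. t * (cos \<phi>)\<^sup>2)"
  \<comment> \<open>Adding the far flux leaves only the flux through the boundary in the derivative of \<open>f\<close>; its value at \<open>\<phi> = 0\<close>
  is the limit found above.\<close>
  define f where "f = (\<lambda>\<phi>. (if \<phi> = 0 then 2 * half_gauss * W 0 t else heat_mass t (\<theta> \<phi>)) + J (\<theta> \<phi>))"
  let ?h = "\<lambda>\<phi>. 2 * sqrt t * cos \<phi> * gauss_fac t \<phi> * (Wy 0 (\<theta> \<phi>) + (c' (\<theta> \<phi>) - secant t \<phi> / 2) * W 0 (\<theta> \<phi>))"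
  have J: "(J has_real_derivative flux t (-d) \<tau>) (at \<tau> within {0..L})" if "\<tau> \<in> {0..L}" for \<tau>
    unfolding J_def using that by (intro integral_has_real_derivative flux_far_cont[OF tL])
  then have Jc: "continuous_on {0..L} J" by (rule DERIV_continuous_on)
  have \<theta>c: "continuous_on S \<theta>" for S unfolding \<theta>_def by (intro continuous_intros)
  have \<theta>L: "\<theta> \<phi> \<in> {0..L}" for \<phi> unfolding \<theta>_def by (rule dilate_mem[OF tL])
  have \<theta>lt: "\<theta> \<phi> \<in> {0..<t}" if "\<phi> \<in> {0<..pi/2}" for \<phi>
  proof -
    have "0 < sin \<phi>" using that pi_gt_zero by (intro sin_gt_zero) auto
    then have "(cos \<phi>)\<^sup>2 < 1" by (simp add: cos_squared_eq)
    then show ?thesis using t by (simp add: \<theta>_def mult_less_cancel_left2)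
  qed
  have "((\<lambda>\<phi>. - ?h \<phi>) has_integral f (pi/2) - f 0) {0..pi/2}"
  proof (rule fundamental_theorem_of_calculus_interior)
    show "continuous_on {0..pi/2} f"
      unfolding continuous_on_eq_continuous_within
    proof
      fix \<phi> :: real assume \<phi>: "\<phi> \<in> {0..pi/2}"
      have "continuous_on {0..pi/2} (\<lambda>\<phi>. J (\<theta> \<phi>))"
        by (rule continuous_on_compose2[OF Jc \<theta>c]) (use \<theta>L in blast)
      then have cJ: "continuous (at \<phi> within {0..pi/2}) (\<lambda>\<phi>. J (\<theta> \<phi>))"
        using \<phi> by (simp add: continuous_on_eq_continuous_within)
      have "continuous (at \<phi> within {0..pi/2}) (\<lambda>\<phi>. if \<phi> = 0 then 2 * half_gauss * W 0 t else heat_mass t (\<theta> \<phi>))"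
      proof (cases "\<phi> = 0")
        case True
        have "((\<lambda>\<phi>. if \<phi> = 0 then 2 * half_gauss * W 0 t else heat_mass t (\<theta> \<phi>)) \<longlongrightarrow> 2 * half_gauss * W 0 t) (at 0 within {0..pi/2})"
          by (rule Lim_transform_eventually[OF heat_mass_tendsto[OF t]])
            (auto simp: eventually_at_filter \<theta>_def)
        then show ?thesis by (simp add: True continuous_within)
      next
        case False
        have "continuous_on {0..<t} (heat_mass t)"
          by (rule DERIV_continuous_on[OF heat_mass_deriv[OF tL]])
        then have "continuous_on {0<..pi/2} (\<lambda>\<phi>. heat_mass t (\<theta> \<phi>))"
          by (rule continuous_on_compose2[OF _ \<theta>c]) (use \<theta>lt in blast)
        then have "continuous_on {0<..pi/2} (\<lambda>\<phi>. if \<phi> = 0 then 2 * half_gauss * W 0 t else heat_mass t (\<theta> \<phi>))"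
          by (rule continuous_on_eq) simp
        moreover have "at \<phi> within {0<..pi/2} = at \<phi> within {0..pi/2}"
          by (rule at_within_nhd[of \<phi> "{0<..}"]) (use \<phi> False in auto)
        moreover have "\<phi> \<in> {0<..pi/2}" using \<phi> False by auto
        ultimately show ?thesis by (metis continuous_on_eq_continuous_within)
      qed
      from continuous_add[OF this cJ] show "continuous (at \<phi> within {0..pi/2}) f" by (simp add: f_def)
    qed
    fix \<phi> :: real assume \<phi>: "\<phi> \<in> {0<..<pi/2}"
    have \<theta>1: "\<theta> \<phi> \<in> {0<..<t}" using \<theta>lt[of \<phi>] \<phi> t cos_gt_zero_pi[of \<phi>] by (auto simp: \<theta>_def)
    have "at (\<theta> \<phi>) within {0..<t} = at (\<theta> \<phi>)"
      by (rule at_within_open_subset[OF \<theta>1]) auto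
    then have m: "(heat_mass t has_real_derivative flux t 0 (\<theta> \<phi>) - flux t (-d) (\<theta> \<phi>)) (at (\<theta> \<phi>))"
      using heat_mass_deriv[OF tL, of "\<theta> \<phi>"] \<theta>1 by simp
    have "at (\<theta> \<phi>) within {0..L} = at (\<theta> \<phi>)"
      by (rule at_within_open_subset[OF \<theta>1]) (use t in auto)
    then have j: "(J has_real_derivative flux t (-d) (\<theta> \<phi>)) (at (\<theta> \<phi>))"
      using J[OF \<theta>L, of \<phi>] by simp
    have th: "(\<theta> has_real_derivative - (2 * t * cos \<phi> * sin \<phi>)) (at \<phi>)"
      unfolding \<theta>_def by (auto intro!: derivative_eq_intros)
    have "((\<lambda>\<phi>. heat_mass t (\<theta> \<phi>) + J (\<theta> \<phi>)) has_real_derivative - ?h \<phi>) (at \<phi>)"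
      by (rule DERIV_cong[OF DERIV_add[OF DERIV_chain'[OF th m] DERIV_chain'[OF th j]]])
        (use flux_at_boundary[OF t \<phi>] in \<open>simp add: \<theta>_def algebra_simps\<close>)
    moreover have "\<forall>\<^sub>F x in nhds \<phi>. heat_mass t (\<theta> x) + J (\<theta> x) = f x"
    proof -
      have "\<forall>\<^sub>F x in nhds \<phi>. x \<in> {0<..}" using \<phi> by (intro eventually_nhds_in_open) auto
      then show ?thesis by eventually_elim (simp add: f_def)
    qed
    ultimately have "(f has_real_derivative - ?h \<phi>) (at \<phi>)"
      by (rule has_real_derivative_cong_nhds) simp
    then show "(f has_vector_derivative - ?h \<phi>) (at \<phi>)"
      by (simp only: has_real_derivative_iff_has_vector_derivative)
  qed auto
  from has_integral_neg[OF this] have "(?h has_integral f 0 - f (pi/2)) {0..pi/2}"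
    by (simp only: minus_minus minus_diff_eq)
  then have "integral {0..pi/2} ?h = f 0 - f (pi/2)" by (rule integral_unique)
  moreover have "f (pi/2) = heat_mass t 0" by (simp add: f_def \<theta>_def J_def)
  moreover have "f 0 = 2 * half_gauss * W 0 t + integral {0..t} (flux t (-d))" by (simp add: f_def \<theta>_def J_def)
  ultimately show ?thesis by (simp add: \<theta>_def)
qed

lemma flux_far_vanishes:
  assumes "t \<in> {0..L}"
  shows "integral {0..t} (flux t (-d)) = integral {0..L} (flux t (-d))"
proof -
  have "integral {t..L} (flux t (-d)) = integral {t..L} (\<lambda>_. 0)"
    by (rule Henstock_Kurzweil_Integration.integral_cong) (simp add: flux_def heat_ker_def)
  then have "integral {t..L} (flux t (-d)) = 0" by simp
  moreover have "integral {0..t} (flux t (-d)) + integral {t..L} (flux t (-d)) = integral {0..L} (flux t (-d))"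
    using assms by (intro Henstock_Kurzweil_Integration.integral_combine integrable_continuous_real flux_far_cont) auto
  ultimately show ?thesis by simp
qed

lemma C_diff_on_far_flux:
  assumes ck: "C_diff_on k c {0..L}"
  shows "C_diff_on k (\<lambda>t. integral {0..L} (flux t (-d))) {0..L}"
proof -
  let ?p = "\<lambda>i j w t. integral {0..L} (\<lambda>\<tau>. heat_ker i j (c t - c \<tau> + d) (t - \<tau>) * w \<tau>)"
  have w1: "continuous_on {0..L} (Wy (-d))" and w2: "continuous_on {0..L} (\<lambda>\<tau>. c' \<tau> * W (-d) \<tau>)"
    and w3: "continuous_on {0..L} (W (-d))"
    using d by (auto intro!: continuous_on_mult c'_cont slice_t[OF W_cont] slice_t[OF Wy_cont])
  have "C_diff_on k (\<lambda>t. ?p 0 1 (Wy (-d)) t + (?p 0 1 (\<lambda>\<tau>. c' \<tau> * W (-d) \<tau>) t - 1/2 * ?p 1 3 (W (-d)) t)) {0..L}"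
    by (intro C_diff_on_add C_diff_on_diff C_diff_on_cmult C_diff_on_far_potential[OF _ \<delta>(1) ck \<delta>(2)] w1 w2 w3)
  moreover have "?p 0 1 (Wy (-d)) t + (?p 0 1 (\<lambda>\<tau>. c' \<tau> * W (-d) \<tau>) t - 1/2 * ?p 1 3 (W (-d)) t)
      = integral {0..L} (flux t (-d))" if t: "t \<in> {0..L}" for t
  proof (rule integral_unique[symmetric])
    have i: "((\<lambda>\<tau>. heat_ker i j (c t - c \<tau> + d) (t - \<tau>) * w \<tau>) has_integral ?p i j w t) {0..L}"
      if w: "continuous_on {0..L} w" for i j w
    proof (intro integrable_integral integrable_continuous_real continuous_on_mult w)
      have "continuous_on {0..L} (\<lambda>\<tau>. (\<lambda>(z, r). heat_ker i j z r) (c t - c \<tau> + d, t - \<tau>))"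
        using \<delta>(2) t by (intro continuous_on_compose2[OF continuous_on_heat_ker[OF \<delta>(1)]] continuous_intros c_cont) auto
      then show "continuous_on {0..L} (\<lambda>\<tau>. heat_ker i j (c t - c \<tau> + d) (t - \<tau>))" by simp
    qed
    have "flux t (-d) = (\<lambda>\<tau>. heat_ker 0 1 (c t - c \<tau> + d) (t - \<tau>) * Wy (-d) \<tau>
        + (heat_ker 0 1 (c t - c \<tau> + d) (t - \<tau>) * (c' \<tau> * W (-d) \<tau>)
          - 1/2 * (heat_ker 1 3 (c t - c \<tau> + d) (t - \<tau>) * W (-d) \<tau>)))"
      by (auto simp: flux_def fun_eq_iff algebra_simps)
    then show "(flux t (-d) has_integral ?p 0 1 (Wy (-d)) t + (?p 0 1 (\<lambda>\<tau>. c' \<tau> * W (-d) \<tau>) t - 1/2 * ?p 1 3 (W (-d)) t)) {0..L}"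
      by (simp only:) (intro has_integral_add has_integral_diff has_integral_mult_right i w1 w2 w3)
  qed
  ultimately show ?thesis by (rule C_diff_on_cong[rotated])
qed

text \<open>Multiplied by \<open>sqrt t\<close>, the boundary identity is a Volterra equation for \<open>x t = sqrt t * W 0 t\<close> with smooth kernel and
  smooth data.  The last hypothesis makes the operator a contraction with constant 1/2.\<close>

theorem neumann_to_dirichlet:
  assumes c'k: "C_diff_on k c' {0..L}" and Wyk: "C_diff_on k (Wy 0) {0..L}"
    and B: "\<And>t. t \<in> {0..L} \<Longrightarrow> \<bar>c' t\<bar> \<le> B" and small: "3 * pi * B * sqrt L \<le> 2 * half_gauss"
  shows "C_diff_on k (W 0) {0<..L}"
proof -
  define \<kappa> where "\<kappa> = (\<lambda>t \<phi>. 1 / half_gauss * (gauss_fac t \<phi> * (c' (t * (cos \<phi>)\<^sup>2) - 1/2 * secant t \<phi>)))"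
  define \<nu> where "\<nu> = (\<lambda>t \<phi>. 1 / half_gauss * (sqrt t * (cos \<phi> * gauss_fac t \<phi>)))"
  define x where "x = (\<lambda>t. sqrt t * W 0 t)"
  define q where "q = (\<lambda>t. 1 / (2 * half_gauss) * (initial_layer c (\<lambda>y. W y 0) d 0 t
      - sqrt t * integral {0..L} (flux t (-d))) + volterra_op \<nu> (Wy 0) t)"
  have hg: "0 < half_gauss" by (rule half_gauss_pos)
  have ck: "C_diff_on k c {0..L}"
    using C_diff_on_Suc_imp[OF C_diff_on_SucI[OF c c'k]] .
  have W0: "continuous_on {0..L} (W 0)" using d by (intro slice_t[OF W_cont]) auto
  have Wy0: "continuous_on {0..L} (Wy 0)" using d by (intro slice_t[OF Wy_cont]) auto
  have xc: "continuous_on {0..L} x" unfolding x_def by (intro continuous_intros W0)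
  have \<kappa>C: "euler_C k L {0..pi/2} \<kappa>"
    unfolding \<kappa>_def
  proof (intro euler_C_mult euler_C_diff euler_C_const euler_C_gauss_fac euler_C_secant c'k)
    show "euler_C k L {0..pi/2} (\<lambda>t \<phi>. c' (t * (cos \<phi>)\<^sup>2))"
      by (rule euler_C_dilate[OF _ _ _ _ C_diff_on_imp_euler_C[OF c'k], where j="\<lambda>_. 0::real" and R'=UNIV])
        (auto intro!: continuous_intros cos_sq_le1)
  qed
  have \<nu>C: "euler_C k L {0..pi/2} \<nu>"
    unfolding \<nu>_def
    by (intro euler_C_mult euler_C_const euler_C_gauss_fac c'k euler_C_sqrt euler_C_const_in_time continuous_intros)
  have qC: "euler_C k L (UNIV::real set) (\<lambda>t _. q t)"
    unfolding q_def
    by (intro euler_C_add euler_C_diff euler_C_mult euler_C_const euler_C_sqrt euler_C_volterra \<nu>C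
        euler_C_initial_layer ck C_diff_on_imp_euler_C[OF C_diff_on_far_flux[OF ck]] C_diff_on_imp_euler_C[OF Wyk]
        slice_y[OF W_cont]) (use L in auto)
  have B0: "0 \<le> B" using B[of 0] L by auto
  have \<kappa>B: "\<bar>\<kappa> t \<phi>\<bar> \<le> 3 * B / (2 * half_gauss)" if t: "t \<in> {0..L}" for t \<phi>
  proof -
    have "\<bar>c' (t * (cos \<phi>)\<^sup>2) - 1/2 * secant t \<phi>\<bar> \<le> 3/2 * B"
      using B[OF dilate_mem[OF t], of \<phi>] secant_bound[OF t B, of \<phi>] by linarith
    moreover have "\<bar>gauss_fac t \<phi>\<bar> \<le> 1" using t by (simp add: gauss_fac_def)
    ultimately have "\<bar>gauss_fac t \<phi>\<bar> * \<bar>c' (t * (cos \<phi>)\<^sup>2) - 1/2 * secant t \<phi>\<bar> \<le> 1 * (3/2 * B)"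
      by (intro mult_mono) auto
    then have "1 / half_gauss * (\<bar>gauss_fac t \<phi>\<bar> * \<bar>c' (t * (cos \<phi>)\<^sup>2) - 1/2 * secant t \<phi>\<bar>) \<le> 1 / half_gauss * (3/2 * B)"
      using hg by (intro mult_left_mono) auto
    then show ?thesis using hg by (simp add: \<kappa>_def abs_mult)
  qed
  have smallB: "sqrt L * (pi/2) * (3 * B / (2 * half_gauss)) \<le> 1/2"
    using small hg by (simp add: field_simps)
  have eq: "x t = volterra_op \<kappa> x t + q t" if t: "t \<in> {0..L}" for t
  proof (cases "t = 0")
    case True
    then show ?thesis by (simp add: x_def q_def volterra_op_def initial_layer_def)
  next
    case False
    then have t0: "t \<in> {0<..L}" using t by simp
    have il: "initial_layer c (\<lambda>y. W y 0) d 0 t = sqrt t * heat_mass t 0"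
    proof -
      have "heat_mass t 0 = integral {-d..0} (\<lambda>y. 1 / sqrt t * (exp (- (((c t - c 0 - y) / sqrt t)\<^sup>2 / 4)) * W y 0))"
        unfolding heat_mass_def using t0
        by (intro Henstock_Kurzweil_Integration.integral_cong) (simp add: heat_ker_def power_divide mult.commute)
      then show ?thesis using t0 by (simp add: initial_layer_def)
    qed
    have cv: "continuous_on ({0..L} \<times> {0..pi/2}) (\<lambda>(t, \<phi>). \<kappa> t \<phi>)"
      and cn: "continuous_on ({0..L} \<times> {0..pi/2}) (\<lambda>(t, \<phi>). \<nu> t \<phi>)"
      using \<kappa>C \<nu>C euler_C_cont by blast+
    note ik = volterra_integrable[OF cv xc t] and "in" = volterra_integrable[OF cn Wy0 t]
    have "integral {0..pi/2} (\<lambda>\<phi>. 2 * sqrt t * cos \<phi> * gauss_fac t \<phi> * (Wy 0 (t * (cos \<phi>)\<^sup>2)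
        + (c' (t * (cos \<phi>)\<^sup>2) - secant t \<phi> / 2) * W 0 (t * (cos \<phi>)\<^sup>2)))
      = integral {0..pi/2} (\<lambda>\<phi>. 2 * half_gauss * (\<kappa> t \<phi> * x (t * (cos \<phi>)\<^sup>2) + \<nu> t \<phi> * Wy 0 (t * (cos \<phi>)\<^sup>2)))"
    proof (rule Henstock_Kurzweil_Integration.integral_cong)
      fix \<phi> :: real assume "\<phi> \<in> {0..pi/2}"
      then have "0 \<le> cos \<phi>" by (intro cos_ge_zero) auto
      then have "x (t * (cos \<phi>)\<^sup>2) = sqrt t * cos \<phi> * W 0 (t * (cos \<phi>)\<^sup>2)"
        by (simp add: x_def real_sqrt_mult)
      then show "2 * sqrt t * cos \<phi> * gauss_fac t \<phi> * (Wy 0 (t * (cos \<phi>)\<^sup>2)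
        + (c' (t * (cos \<phi>)\<^sup>2) - secant t \<phi> / 2) * W 0 (t * (cos \<phi>)\<^sup>2))
        = 2 * half_gauss * (\<kappa> t \<phi> * x (t * (cos \<phi>)\<^sup>2) + \<nu> t \<phi> * Wy 0 (t * (cos \<phi>)\<^sup>2))"
        using hg by (simp add: \<kappa>_def \<nu>_def field_simps)
    qed
    also have "\<dots> = 2 * half_gauss * (integral {0..pi/2} (\<lambda>\<phi>. \<kappa> t \<phi> * x (t * (cos \<phi>)\<^sup>2))
        + integral {0..pi/2} (\<lambda>\<phi>. \<nu> t \<phi> * Wy 0 (t * (cos \<phi>)\<^sup>2)))"
      using ik "in" by (simp add: Henstock_Kurzweil_Integration.integral_add)
    finally have "2 * half_gauss * W 0 t + integral {0..L} (flux t (-d)) = heat_mass t 0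
      + 2 * half_gauss * (integral {0..pi/2} (\<lambda>\<phi>. \<kappa> t \<phi> * x (t * (cos \<phi>)\<^sup>2))
        + integral {0..pi/2} (\<lambda>\<phi>. \<nu> t \<phi> * Wy 0 (t * (cos \<phi>)\<^sup>2)))"
      using boundary_identity[OF t0] flux_far_vanishes[OF t] by simp
    then have "sqrt t * (2 * half_gauss * W 0 t + integral {0..L} (flux t (-d))) = sqrt t * (heat_mass t 0
      + 2 * half_gauss * (integral {0..pi/2} (\<lambda>\<phi>. \<kappa> t \<phi> * x (t * (cos \<phi>)\<^sup>2))
        + integral {0..pi/2} (\<lambda>\<phi>. \<nu> t \<phi> * Wy 0 (t * (cos \<phi>)\<^sup>2))))" by simp
    then have "2 * half_gauss * x t = sqrt t * heat_mass t 0 - sqrt t * integral {0..L} (flux t (-d))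
      + 2 * half_gauss * (volterra_op \<kappa> x t + volterra_op \<nu> (Wy 0) t)"
      by (simp add: x_def volterra_op_def algebra_simps)
    then show ?thesis using hg by (simp add: q_def il field_simps)
  qed
  have "euler_C k L (UNIV::real set) (\<lambda>t _. x t)"
    by (rule volterra_regular[OF _ \<kappa>B smallB \<kappa>C qC xc eq]) (use L in auto)
  then have "C_diff_on k x {0<..L}" by (rule euler_C_imp_C_diff_on) simp
  then have "C_diff_on k (\<lambda>t. t powr (- (1/2)) * x t) {0<..L}"
    by (intro C_diff_on_mult C_diff_on_powr) auto
  then show ?thesis
    by (rule C_diff_on_cong[rotated]) (auto simp: x_def powr_minus powr_half_sqrt)
qed

end

section \<open>The free boundary problem\<close>

text \<open>The chain rule in two variables, from partial derivatives of which one is continuous.\<close>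

lemma derivative_along_path:
  fixes u ux ut :: "real \<Rightarrow> real \<Rightarrow> real"
  assumes G: "open G" "(\<xi> t, t) \<in> G"
    and ux: "\<And>x t. (x, t) \<in> G \<Longrightarrow> ((\<lambda>x. u x t) has_real_derivative ux x t) (at x)"
    and ut: "\<And>x t. (x, t) \<in> G \<Longrightarrow> (u x has_real_derivative ut x t) (at t)"
    and cont: "continuous_on G (\<lambda>(x, t). ut x t)"
    and \<xi>: "(\<xi> has_real_derivative \<xi>') (at t within S)"
  shows "((\<lambda>\<tau>. u (\<xi> \<tau>) \<tau>) has_real_derivative ux (\<xi> t) t * \<xi>' + ut (\<xi> t) t) (at t within S)"
proof -
  obtain A B where AB: "open A" "open B" "(\<xi> t, t) \<in> A \<times> B" "A \<times> B \<subseteq> G"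
    by (rule open_prod_elim[OF G])
  have A: "\<xi> t \<in> A" and B: "t \<in> B" using AB(3) by auto
  obtain e where e: "e > 0" "ball (\<xi> t) e \<subseteq> A" by (rule openE[OF AB(1) A])
  obtain e' where e': "e' > 0" "ball t e' \<subseteq> B" by (rule openE[OF AB(2) B])
  let ?X = "ball (\<xi> t) e" and ?Y = "ball t e'"
  have sub: "?X \<times> ?Y \<subseteq> G" using Sigma_mono[OF e(2)] e'(2) AB(4) by fast
  have "((\<lambda>(x, t). u x t) has_derivative (\<lambda>(tx, ty). ux (\<xi> t) t * tx + blinfun_mult_right (ut (\<xi> t) t) ty)) (at (\<xi> t, t) within ?X \<times> ?Y)"
  proof (rule has_derivative_partialsI)
    show "((\<lambda>x. u x t) has_derivative (*) (ux (\<xi> t) t)) (at (\<xi> t) within ?X)"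
      by (rule has_derivative_at_withinI[OF ux[OF G(2), unfolded has_field_derivative_def]])
    show "(u x has_derivative blinfun_apply (blinfun_mult_right (ut x y))) (at y within ?Y)" if "x \<in> ?X" "y \<in> ?Y" for x y
    proof -
      have "(u x has_real_derivative ut x y) (at y)" using ut sub that by blast
      then show ?thesis
        unfolding has_field_derivative_def blinfun_mult_right.rep_eq by (rule has_derivative_at_withinI)
    qed
    have "continuous_on (?X \<times> ?Y) (\<lambda>q. blinfun_mult_right ((\<lambda>(x, t). ut x t) q))"
      by (rule bounded_linear.continuous_on[OF bounded_linear_blinfun_mult_right continuous_on_subset[OF cont sub]])
    then show "continuous (at (\<xi> t, t) within ?X \<times> ?Y) (\<lambda>(x, y). blinfun_mult_right (ut x y))"
      using e e' by (auto simp: continuous_on_eq_continuous_within case_prod_unfold)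
  qed (use e' in auto)
  moreover have "at (\<xi> t, t) within ?X \<times> ?Y = at (\<xi> t, t)"
    by (rule at_within_open) (use e e' in \<open>auto intro: open_Times\<close>)
  ultimately have D: "((\<lambda>(x, t). u x t) has_derivative (\<lambda>(tx, ty). ux (\<xi> t) t * tx + ut (\<xi> t) t * ty)) (at (\<xi> t, t))"
    by (simp only: blinfun_mult_right.rep_eq)
  have "((\<lambda>\<tau>. (\<xi> \<tau>, \<tau>)) has_derivative (\<lambda>h. (\<xi>' * h, h))) (at t within S)"
    using \<xi> unfolding has_field_derivative_def by (intro has_derivative_Pair has_derivative_ident)
  from has_derivative_compose[OF this D]
  have "((\<lambda>\<tau>. u (\<xi> \<tau>) \<tau>) has_derivative (\<lambda>h. ux (\<xi> t) t * (\<xi>' * h) + ut (\<xi> t) t * h)) (at t within S)"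
    by (simp only: prod.case)
  then show ?thesis
    unfolding has_field_derivative_def by (rule has_derivative_eq_rhs) (simp add: fun_eq_iff algebra_simps)
qed

text \<open>A classical solution with its partial derivatives named.\<close>

locale heat_free_boundary =
  fixes lam sig :: real and u ux ut uxx :: "real \<Rightarrow> real \<Rightarrow> real" and s :: "real \<Rightarrow> real"
  assumes s_C1: "C_diff_on 1 s {0..}"
    and s_pos: "\<And>t. 0 \<le> t \<Longrightarrow> 0 < s t"
    and u_cont: "continuous_on (free_domain s) (\<lambda>(x, t). u x t)"
    and partials: "has_partials u s ux ut uxx"
    and heat: "\<And>x t. 0 < t \<Longrightarrow> 0 < x \<Longrightarrow> x < s t \<Longrightarrow> ut x t = uxx x t - lam * u x t"
    and no_flux: "\<And>t. 0 < t \<Longrightarrow> ux (s t) t = 0"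
    and stefan: "\<And>t. 0 < t \<Longrightarrow> (s has_real_derivative integral {0..s t} (\<lambda>x. u x t - sig)) (at t)"
begin

definition speed :: "real \<Rightarrow> real" where
  "speed t = integral {0..s t} (\<lambda>x. u x t - sig)"

lemma s_deriv: "0 < t \<Longrightarrow> (s has_real_derivative speed t) (at t within S)"
  using stefan unfolding speed_def by (rule has_field_derivative_at_within)

lemma s_cont: "continuous_on {0..} s"
  using s_C1 C_diff_on_cont by blast

lemma speed_cont: "continuous_on {0<..} speed"
proof -
  obtain s1 where s1: "\<forall>t\<in>{0..}. (s has_real_derivative s1 t) (at t within {0..})" "C_diff_on 0 s1 {0..}"
    using s_C1 unfolding One_nat_def C_diff_on_Suc_iff by blast
  have "s1 t = speed t" if "t \<in> {0<..}" for t
  proof -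
    have "at t within {0..} = at t" by (rule at_within_open_subset[of _ "{0<..}"]) (use that in auto)
    then have "(s has_real_derivative s1 t) (at t)" using s1(1) that by (metis atLeast_iff greaterThan_iff less_imp_le)
    then show ?thesis using s_deriv[of t UNIV] that by (auto dest: DERIV_unique)
  qed
  moreover have "continuous_on {0<..} s1"
    using s1(2) by (auto simp: C_diff_on_0_iff intro: continuous_on_subset)
  ultimately show ?thesis by (rule continuous_on_eq[rotated])
qed

lemma ux_cont: "continuous_on (free_domain s) (\<lambda>(x, t). ux x t)"
  and ut_cont: "continuous_on (free_domain s) (\<lambda>(x, t). ut x t)"
  and uxx_cont: "continuous_on (free_domain s) (\<lambda>(x, t). uxx x t)"
  using partials by (auto simp: has_partials_def)

lemma u_x: "x \<in> {0..s t} \<Longrightarrow> 0 \<le> t \<Longrightarrow> ((\<lambda>x. u x t) has_real_derivative ux x t) (at x within {0..s t})"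
  and u_xx: "x \<in> {0..s t} \<Longrightarrow> 0 \<le> t \<Longrightarrow> ((\<lambda>x. ux x t) has_real_derivative uxx x t) (at x within {0..s t})"
  and u_t: "x \<in> {0..s t} \<Longrightarrow> 0 \<le> t \<Longrightarrow> (u x has_real_derivative ut x t) (at t within {r. (x, r) \<in> free_domain s})"
proof -
  assume xt: "x \<in> {0..s t}" "0 \<le> t"
  then have "(x, t) \<in> free_domain s" "{y. (y, t) \<in> free_domain s} = {0..s t}"
    by (auto simp: free_domain_def)
  then show "((\<lambda>x. u x t) has_real_derivative ux x t) (at x within {0..s t})"
    "((\<lambda>x. ux x t) has_real_derivative uxx x t) (at x within {0..s t})"
    "(u x has_real_derivative ut x t) (at t within {r. (x, r) \<in> free_domain s})"
    using partials by (auto simp: has_partials_def)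
qed

lemma continuous_on_domain:
  assumes "continuous_on (free_domain s) (\<lambda>(x, t). V x t :: real)" "continuous_on A X" "continuous_on A \<tau>"
    and "\<And>q. q \<in> A \<Longrightarrow> 0 \<le> X q \<and> X q \<le> s (\<tau> q) \<and> 0 \<le> \<tau> q"
  shows "continuous_on A (\<lambda>q. V (X q) (\<tau> q))"
proof -
  have "continuous_on A (\<lambda>q. (\<lambda>(x, t). V x t) (X q, \<tau> q))"
    by (rule continuous_on_compose2[OF assms(1)])
      (use assms in \<open>auto simp: free_domain_def intro!: continuous_on_Pair\<close>)
  then show ?thesis by simp
qed

lemma open_interior_domain: "open {(x, t). 0 < x \<and> 0 < t \<and> x < s t}"
proof -
  let ?A = "{0<..} \<times> {0<..} :: (real \<times> real) set"
  have "continuous_on ?A (\<lambda>q. s (snd q) - fst q)"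
    by (auto intro!: continuous_intros continuous_on_compose2[OF s_cont])
  then have "open (?A \<inter> (\<lambda>q. s (snd q) - fst q) -` {0<..})"
    by (rule continuous_open_preimage) (auto intro: open_Times)
  moreover have "?A \<inter> (\<lambda>q. s (snd q) - fst q) -` {0<..} = {(x, t). 0 < x \<and> 0 < t \<and> x < s t}" by auto
  ultimately show ?thesis by simp
qed

lemma u_along_path:
  assumes "0 < \<xi> t" "\<xi> t < s t" "0 < t" "(\<xi> has_real_derivative \<xi>') (at t within S)"
  shows "((\<lambda>\<tau>. u (\<xi> \<tau>) \<tau>) has_real_derivative ux (\<xi> t) t * \<xi>' + (uxx (\<xi> t) t - lam * u (\<xi> t) t)) (at t within S)"
proof -
  let ?G = "{(x, t). 0 < x \<and> 0 < t \<and> x < s t}"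
  have "((\<lambda>\<tau>. u (\<xi> \<tau>) \<tau>) has_real_derivative ux (\<xi> t) t * \<xi>' + ut (\<xi> t) t) (at t within S)"
  proof (rule derivative_along_path[OF open_interior_domain, where u=u and ux=ux and ut=ut and \<xi>=\<xi>])
    show "continuous_on ?G (\<lambda>(x, t). ut x t)"
      by (rule continuous_on_subset[OF ut_cont]) (auto simp: free_domain_def)
    fix x t assume xt: "(x, t) \<in> ?G"
    have "at x within {0..s t} = at x" using xt by (intro at_within_interior) auto
    then show "((\<lambda>x. u x t) has_real_derivative ux x t) (at x)" using u_x[of x t] xt by auto
    have "open ((\<lambda>r. (x, r)) -` ?G)" by (intro open_vimage open_interior_domain continuous_intros)
    then have "at t within {r. (x, r) \<in> free_domain s} = at t"
      by (intro at_within_open_subset[where S="(\<lambda>r. (x, r)) -` ?G"]) (use xt in \<open>auto simp: free_domain_def\<close>)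
    then show "(u x has_real_derivative ut x t) (at t)" using u_t[of x t] xt by auto
  qed (use assms in auto)
  moreover have "ut (\<xi> t) t = uxx (\<xi> t) t - lam * u (\<xi> t) t" by (rule heat[OF assms(3,1,2)])
  ultimately show ?thesis by (simp only:)
qed

lemma mass_eq: "0 \<le> t \<Longrightarrow> integral {0..s t} (\<lambda>x. u x t) = speed t + sig * s t"
proof -
  assume t: "0 \<le> t"
  have "continuous_on {0..s t} (\<lambda>x. u x t)"
    using t by (intro continuous_on_domain[OF u_cont] continuous_intros) auto
  then have "(\<lambda>x. u x t) integrable_on {0..s t}" by (rule integrable_continuous_real)
  then have "integral {0..s t} (\<lambda>x. u x t - sig) = integral {0..s t} (\<lambda>x. u x t) - integral {0..s t} (\<lambda>x. sig)"
    by (rule Henstock_Kurzweil_Integration.integral_diff) (rule integrable_const_ivl)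
  then show ?thesis using s_pos[OF t] by (simp add: speed_def)
qed

text \<open>Rescaling the mass integral to \<open>[0, 1]\<close> avoids differentiating a moving limit, and the derivative of the integrand is
  \<open>d/dz (s' * z * u + ux)\<close> at \<open>(s * z, t)\<close>, minus \<open>lam\<close> times the integrand.\<close>

lemma mass_balance:
  assumes t: "0 < t"
  shows "((\<lambda>t. integral {0..s t} (\<lambda>x. u x t)) has_real_derivative
     speed t * u (s t) t - ux 0 t - lam * integral {0..s t} (\<lambda>x. u x t)) (at t)"
proof -
  define \<alpha> \<beta> where "\<alpha> = t / 2" and "\<beta> = t + 1"
  have \<alpha>: "0 < \<alpha>" "t \<in> {\<alpha><..<\<beta>}" using t by (auto simp: \<alpha>_def \<beta>_def)
  have pos: "0 < r" if "r \<in> {\<alpha>..\<beta>}" for r using that \<alpha> by auto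
  have dom: "0 \<le> s r * z \<and> s r * z \<le> s r \<and> 0 \<le> r" if "r \<in> {\<alpha>..\<beta>}" "z \<in> {0..1}" for r z
    using that pos[of r] s_pos[of r] mult_left_le[of z "s r"] by auto
  define F where "F = (\<lambda>z r. s r * u (s r * z) r)"
  define G where "G = (\<lambda>z r. speed r * u (s r * z) r + s r * (ux (s r * z) r * (speed r * z) + (uxx (s r * z) r - lam * u (s r * z) r)))"
  let ?Q = "{0..1} \<times> {\<alpha>..\<beta>} :: (real \<times> real) set"
  have sc: "continuous_on ?Q (\<lambda>q. s (snd q))" and vc: "continuous_on ?Q (\<lambda>q. speed (snd q))"
    by (auto intro!: continuous_on_compose2[OF s_cont] continuous_on_compose2[OF speed_cont] continuous_intros dest: pos)
  have V: "continuous_on ?Q (\<lambda>q. V (s (snd q) * fst q) (snd q))"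
    if "continuous_on (free_domain s) (\<lambda>(x, t). V x t)" for V :: "real \<Rightarrow> real \<Rightarrow> real"
    using dom by (intro continuous_on_domain[OF that] continuous_on_mult sc continuous_on_fst continuous_on_snd continuous_on_id) auto
  have Fc: "continuous_on ?Q (\<lambda>(z, r). F z r)" and Gc: "continuous_on ?Q (\<lambda>(z, r). G z r)"
    unfolding F_def G_def case_prod_unfold
    by (intro continuous_on_add continuous_on_diff continuous_on_mult sc vc V u_cont ux_cont uxx_cont
        continuous_on_const continuous_on_fst continuous_on_snd continuous_on_id)+
  have D: "(F z has_real_derivative G z r) (at r within {\<alpha>..\<beta>})" if "z \<in> {0..1}" "r \<in> {\<alpha>..\<beta>}" for z r
  proof (rule derivative_up_to_boundary[OF Fc Gc _ _ that])
    fix z r :: real assume z: "z \<in> {0<..<1}" and r: "r \<in> {\<alpha>..\<beta>}"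
    have s: "(s has_real_derivative speed r) (at r within {\<alpha>..\<beta>})" using s_deriv pos r by blast
    have "s r > 0" using s_pos pos[OF r] by simp
    then have "0 < s r * z" "s r * z < s r" using z by auto
    then have "((\<lambda>r. u (s r * z) r) has_real_derivative ux (s r * z) r * (speed r * z) + (uxx (s r * z) r - lam * u (s r * z) r)) (at r within {\<alpha>..\<beta>})"
      by (intro u_along_path pos[OF r] DERIV_cmult_right s)
    from DERIV_mult[OF s this]
    show "(F z has_real_derivative G z r) (at r within {\<alpha>..\<beta>})"
      by (simp add: F_def G_def mult.commute)
  qed auto
  have swap: "continuous_on ({\<alpha>..\<beta>} \<times> cbox 0 1) (\<lambda>(r, z). G z r)"
  proof -
    have "continuous_on ({\<alpha>..\<beta>} \<times> cbox 0 1) (\<lambda>q. (\<lambda>(z, r). G z r) (snd q, fst q))"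
      by (intro continuous_on_compose2[OF Gc] continuous_intros) auto
    then show ?thesis by (simp add: case_prod_unfold)
  qed
  have Fi: "(\<lambda>z. F z r) integrable_on cbox 0 1" if "r \<in> {\<alpha>..\<beta>}" for r
  proof -
    have "continuous_on (cbox 0 1) (\<lambda>z. (\<lambda>(z, r). F z r) (z, r))"
      using that by (intro continuous_on_compose2[OF Fc] continuous_intros) auto
    then show ?thesis by (intro integrable_continuous) simp
  qed
  have tab: "t \<in> {\<alpha>..\<beta>}" using \<alpha> by auto
  have "((\<lambda>r. integral (cbox 0 1) (\<lambda>z. F z r)) has_real_derivative integral (cbox 0 1) (\<lambda>z. G z t)) (at t within {\<alpha>..\<beta>})"
    by (rule leibniz_rule_field_derivative[OF _ Fi swap tab]) (use D in auto)
  moreover have "at t within {\<alpha>..\<beta>} = at t" by (rule at_within_interior) (use \<alpha> in auto)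
  ultimately have L: "((\<lambda>r. integral {0..1} (\<lambda>z. F z r)) has_real_derivative integral {0..1} (\<lambda>z. G z t)) (at t)" by simp
  have M: "integral {0..1} (\<lambda>z. F z r) = integral {0..s r} (\<lambda>x. u x r)" if "r \<in> {\<alpha>..\<beta>}" for r
  proof -
    have sr: "0 < s r" using s_pos pos[OF that] by simp
    have "continuous_on {0..s r} (\<lambda>x. u x r)"
      using pos[OF that] by (intro continuous_on_domain[OF u_cont] continuous_intros) auto
    then have "((\<lambda>x. u x r) has_integral integral {0..s r} (\<lambda>x. u x r)) {0..s r}"
      by (intro integrable_integral integrable_continuous_real)
    from has_integral_stretch_real[OF this, of "s r"]
    have "((\<lambda>z. u (s r * z) r) has_integral 1 / s r * integral {0..s r} (\<lambda>x. u x r)) ((\<lambda>x. x / s r) ` {0..s r})"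
      using sr by simp
    moreover have "(\<lambda>x. x / s r) ` {0..s r} = {0..1}"
      using sr image_divide_atLeastAtMost[of "s r" 0 "s r"] by (simp del: image_divide_atLeastAtMost)
    ultimately have "((\<lambda>z. s r * u (s r * z) r) has_integral s r * (1 / s r * integral {0..s r} (\<lambda>x. u x r))) {0..1}"
      by (intro has_integral_mult_right) simp
    then have "((\<lambda>z. s r * u (s r * z) r) has_integral integral {0..s r} (\<lambda>x. u x r)) {0..1}" using sr by simp
    then show ?thesis unfolding F_def by (rule integral_unique)
  qed
  have "((\<lambda>z. G z t) has_integral (speed t * 1 * u (s t * 1) t + ux (s t * 1) t) - (speed t * 0 * u (s t * 0) t + ux (s t * 0) t)
      - lam * integral {0..1} (\<lambda>z. F z t)) {0..1}"
  proof -
    let ?p = "\<lambda>z. speed t * z * u (s t * z) t + ux (s t * z) t"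
    have "((\<lambda>z. G z t + lam * F z t) has_integral ?p 1 - ?p 0) {0..1}"
    proof (rule fundamental_theorem_of_calculus)
      fix z :: real assume z: "z \<in> {0..1}"
      have im: "(\<lambda>z. s t * z) ` {0..1} \<subseteq> {0..s t}" using dom[OF tab] by auto
      have m: "s t * z \<in> {0..s t}" using im z by blast
      have l: "((\<lambda>z. s t * z) has_real_derivative s t) (at z within {0..1})" by (auto intro!: derivative_eq_intros)
      have d1: "((\<lambda>z. u (s t * z) t) has_real_derivative ux (s t * z) t * s t) (at z within {0..1})"
        using DERIV_image_chain[OF DERIV_subset[OF u_x[OF m] im] l] t by (simp add: o_def)
      have d2: "((\<lambda>z. ux (s t * z) t) has_real_derivative uxx (s t * z) t * s t) (at z within {0..1})"
        using DERIV_image_chain[OF DERIV_subset[OF u_xx[OF m] im] l] t by (simp add: o_def)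
      have d3: "((\<lambda>z. speed t * z) has_real_derivative speed t) (at z within {0..1})" by (auto intro!: derivative_eq_intros)
      have "(?p has_real_derivative G z t + lam * F z t) (at z within {0..1})"
        by (rule DERIV_cong[OF DERIV_add[OF DERIV_mult[OF d3 d1] d2]]) (simp add: G_def F_def algebra_simps)
      then show "(?p has_vector_derivative G z t + lam * F z t) (at z within {0..1})"
        by (simp only: has_real_derivative_iff_has_vector_derivative)
    qed auto
    moreover have "((\<lambda>z. lam * F z t) has_integral lam * integral {0..1} (\<lambda>z. F z t)) {0..1}"
      using Fi[OF tab] by (intro has_integral_mult_right integrable_integral) simp
    ultimately have "((\<lambda>z. G z t + lam * F z t - lam * F z t) has_integral ?p 1 - ?p 0 - lam * integral {0..1} (\<lambda>z. F z t)) {0..1}"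
      by (rule has_integral_diff)
    then show ?thesis by simp
  qed
  then have "integral {0..1} (\<lambda>z. G z t) = speed t * u (s t) t - ux 0 t - lam * integral {0..s t} (\<lambda>x. u x t)"
    using no_flux[OF t] M[OF tab] by (simp add: integral_unique)
  with L have L': "((\<lambda>r. integral {0..1} (\<lambda>z. F z r)) has_real_derivative
      speed t * u (s t) t - ux 0 t - lam * integral {0..s t} (\<lambda>x. u x t)) (at t)" by simp
  have ev: "\<forall>\<^sub>F r in nhds t. integral {0..1} (\<lambda>z. F z r) = integral {0..s r} (\<lambda>x. u x r)"
  proof -
    have "\<forall>\<^sub>F r in nhds t. r \<in> {\<alpha><..<\<beta>}" using \<alpha> by (intro eventually_nhds_in_open) auto
    then show ?thesis by eventually_elim (use M in auto)
  qed
  show ?thesis by (rule has_real_derivative_cong_nhds[OF L' ev]) simp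
qed

text \<open>Each short window of time gives a strip behind the boundary curve \<open>\<gamma>\<close>, to which the local theory applies after
  multiplication by \<open>exp (lam * t)\<close>.  The sign \<open>\<sigma>\<close> says on which side of the curve the solution
  lies; a reflection reduces \<open>\<sigma> = -1\<close> to \<open>\<sigma> = 1\<close>.\<close>

lemma boundary_value_regular:
  fixes \<sigma> :: real and \<gamma> \<gamma>' :: "real \<Rightarrow> real"
  assumes T: "0 < T" and \<sigma>: "\<bar>\<sigma>\<bar> = 1"
    and \<gamma>: "\<And>t. 0 < t \<Longrightarrow> (\<gamma> has_real_derivative \<gamma>' t) (at t)"
    and \<gamma>'k: "C_diff_on k \<gamma>' {0<..T}"
    and strip: "\<And>a. 0 < a \<Longrightarrow> \<exists>d>0. \<forall>t\<in>{a..T}. \<forall>y\<in>{-d..0}. 0 \<le> \<gamma> t + \<sigma> * y \<and> \<gamma> t + \<sigma> * y \<le> s t \<and>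
        (-d < y \<and> y < 0 \<longrightarrow> 0 < \<gamma> t + \<sigma> * y \<and> \<gamma> t + \<sigma> * y < s t)"
    and nk: "C_diff_on k (\<lambda>t. ux (\<gamma> t) t) {0<..T}"
  shows "C_diff_on k (\<lambda>t. u (\<gamma> t) t) {0<..T}"
proof -
  have "\<bar>\<sigma>\<bar> * \<bar>\<sigma>\<bar> = 1" using \<sigma> by simp
  then have \<sigma>2: "\<sigma> * \<sigma> = 1" by (simp only: abs_mult_self_eq)
  have "C_diff_on k (\<lambda>t. exp (lam * t) * u (\<gamma> t) t) {0<..T}"
  proof (rule C_diff_on_from_windows[OF T])
    fix a :: real assume a: "0 < a"
    obtain d where d: "0 < d" and st: "\<And>t y. t \<in> {a..T} \<Longrightarrow> y \<in> {-d..0} \<Longrightarrow> 0 \<le> \<gamma> t + \<sigma> * y \<and> \<gamma> t + \<sigma> * y \<le> s t"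
      and st': "\<And>t y. t \<in> {a..T} \<Longrightarrow> y \<in> {-d<..<0} \<Longrightarrow> 0 < \<gamma> t + \<sigma> * y \<and> \<gamma> t + \<sigma> * y < s t"
    proof -
      obtain d where "0 < d" and *: "\<forall>t\<in>{a..T}. \<forall>y\<in>{-d..0}. 0 \<le> \<gamma> t + \<sigma> * y \<and> \<gamma> t + \<sigma> * y \<le> s t \<and>
        (-d < y \<and> y < 0 \<longrightarrow> 0 < \<gamma> t + \<sigma> * y \<and> \<gamma> t + \<sigma> * y < s t)"
        using strip[OF a] by blast
      then show thesis by (intro that[of d]) (auto dest!: bspec)
    qed
    have \<gamma>'c: "continuous_on {a..T} \<gamma>'"
      by (rule continuous_on_subset[OF C_diff_on_cont[OF \<gamma>'k]]) (use a in auto)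
    have "bounded (\<gamma>' ` {a..T})" by (intro compact_imp_bounded compact_continuous_image \<gamma>'c) auto
    then obtain B where B: "0 < B" and B\<gamma>: "\<And>t. t \<in> {a..T} \<Longrightarrow> \<bar>\<gamma>' t\<bar> \<le> B" unfolding bounded_pos by auto
    \<comment> \<open>The first bound keeps the curve within \<open>d / 2\<close> of its other positions in the window, the second one makes the Volterra
  operator a contraction.\<close>
    define \<epsilon> where "\<epsilon> = min (d / (2 * B)) ((2 * half_gauss / (3 * pi * B))\<^sup>2)"
    have hg: "0 < half_gauss" by (rule half_gauss_pos)
    have \<epsilon>: "0 < \<epsilon>" using d B hg by (simp add: \<epsilon>_def)
    have "C_diff_on k (\<lambda>\<tau>. exp (lam * (t0 + \<tau>)) * u (\<gamma> (t0 + \<tau>)) (t0 + \<tau>)) {0<..L}"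
      if t0: "a \<le> t0" and L: "0 < L" "L \<le> \<epsilon>" "t0 + L \<le> T" for t0 L
    proof -
      have mem: "t0 + \<tau> \<in> {a..T}" "0 < t0 + \<tau>" if "\<tau> \<in> {0..L}" for \<tau> using that t0 L a by auto
      define p where "p = (\<lambda>y \<tau>. \<gamma> (t0 + \<tau>) + \<sigma> * y)"
      define c where "c = (\<lambda>\<tau>. \<sigma> * \<gamma> (t0 + \<tau>))"
      define c' where "c' = (\<lambda>\<tau>. \<sigma> * \<gamma>' (t0 + \<tau>))"
      define E where "E = (\<lambda>\<tau>. exp (lam * (t0 + \<tau>)))"
      let ?Q = "{-d..0} \<times> {0..L} :: (real \<times> real) set"
      have dom: "p y \<tau> \<in> {0..s (t0 + \<tau>)}" if "y \<in> {-d..0}" "\<tau> \<in> {0..L}" for y \<tau>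
        using st[OF mem(1)[OF that(2)] that(1)] by (simp add: p_def)
      have sh: "((\<lambda>\<tau>. t0 + \<tau>) has_real_derivative 1) (at \<tau> within S)" for \<tau> S
        by (auto intro!: derivative_eq_intros)
      have \<gamma>d: "((\<lambda>\<tau>. \<gamma> (t0 + \<tau>)) has_real_derivative \<gamma>' (t0 + \<tau>)) (at \<tau> within S)" if "\<tau> \<in> {0..L}" for \<tau> S
        using DERIV_chain'[OF sh \<gamma>[OF mem(2)[OF that]]] by simp
      have cd: "(c has_real_derivative c' \<tau>) (at \<tau> within S)" if "\<tau> \<in> {0..L}" for \<tau> S
        unfolding c_def c'_def by (rule DERIV_cmult[OF \<gamma>d[OF that]])
      have cc: "continuous_on {0..L} c'"
        unfolding c'_def
      proof (intro continuous_on_mult continuous_on_const continuous_on_compose2[OF \<gamma>'c])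
        show "(\<lambda>\<tau>. t0 + \<tau>) ` {0..L} \<subseteq> {a..T}" by (intro image_subsetI mem(1))
      qed (intro continuous_intros)
      have cB: "\<bar>c' \<tau>\<bar> \<le> B" if "\<tau> \<in> {0..L}" for \<tau>
        using B\<gamma>[OF mem(1)[OF that]] \<sigma> by (simp add: c'_def abs_mult)
      have osc: "d / 2 \<le> c t - c \<tau> + d" if "t \<in> {0..L}" "\<tau> \<in> {0..L}" for t \<tau>
      proof -
        have "norm (c t - c \<tau>) \<le> B * norm (t - \<tau>)"
          by (rule field_differentiable_bound[of "{0..L}" c c' B]) (use cd cB that in auto)
        also have "\<dots> \<le> B * (d / (2 * B))"
        proof (rule mult_left_mono)
          show "norm (t - \<tau>) \<le> d / (2 * B)" using that L(2) unfolding \<epsilon>_def by auto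
        qed (use B in auto)
        also have "\<dots> = d / 2" using B by simp
        finally show ?thesis unfolding real_norm_def by linarith
      qed
      have V: "continuous_on ?Q (\<lambda>(y, \<tau>). E \<tau> * V (p y \<tau>) (t0 + \<tau>))"
        if "continuous_on (free_domain s) (\<lambda>(x, t). V x t)" for V :: "real \<Rightarrow> real \<Rightarrow> real"
        unfolding case_prod_unfold E_def
      proof (intro continuous_on_mult continuous_on_domain[OF that])
        have "continuous_on {0..L} (\<lambda>\<tau>. \<gamma> (t0 + \<tau>))" by (rule DERIV_continuous_on[OF \<gamma>d])
        then show "continuous_on ?Q (\<lambda>q. p (fst q) (snd q))"
          unfolding p_def by (intro continuous_intros continuous_on_compose2[of "{0..L}" "\<lambda>\<tau>. \<gamma> (t0 + \<tau>)" ?Q snd]) auto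
        show "0 \<le> p (fst q) (snd q) \<and> p (fst q) (snd q) \<le> s (t0 + snd q) \<and> 0 \<le> t0 + snd q" if "q \<in> ?Q" for q
          using dom[of "fst q" "snd q"] mem(2)[of "snd q"] that by (auto simp: mem_Times_iff)
      qed (intro continuous_intros)+
      have V': "continuous_on ?Q (\<lambda>(y, \<tau>). \<sigma> * (E \<tau> * ux (p y \<tau>) (t0 + \<tau>)))"
        using continuous_on_mult[OF continuous_on_const V[OF ux_cont]] by (simp only: case_prod_unfold)
      interpret layer: boundary_layer d L "d / 2" c c' "\<lambda>y \<tau>. E \<tau> * u (p y \<tau>) (t0 + \<tau>)"
        "\<lambda>y \<tau>. \<sigma> * (E \<tau> * ux (p y \<tau>) (t0 + \<tau>))" "\<lambda>y \<tau>. E \<tau> * uxx (p y \<tau>) (t0 + \<tau>)"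
      proof
        show "d / 2 \<le> c t - c \<tau> + d" if "t \<in> {0..L}" "\<tau> \<in> {0..L}" for t \<tau> by (rule osc[OF that])
        fix y \<tau> assume \<tau>: "\<tau> \<in> {0..L}"
        { assume y: "y \<in> {-d..0}"
          have l: "((\<lambda>y. p y \<tau>) has_real_derivative \<sigma>) (at y within {-d..0})"
            unfolding p_def by (auto intro!: derivative_eq_intros)
          have im: "(\<lambda>y. p y \<tau>) ` {-d..0} \<subseteq> {0..s (t0 + \<tau>)}" by (intro image_subsetI dom \<tau>)
          have 0: "0 \<le> t0 + \<tau>" using mem(2)[OF \<tau>] by simp
          show "((\<lambda>y. E \<tau> * u (p y \<tau>) (t0 + \<tau>)) has_real_derivative \<sigma> * (E \<tau> * ux (p y \<tau>) (t0 + \<tau>))) (at y within {-d..0})"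
            by (rule DERIV_cong[OF DERIV_cmult[OF DERIV_image_chain[OF DERIV_subset[OF u_x[OF dom[OF y \<tau>] 0] im] l],
                    unfolded o_def]]) simp
          show "((\<lambda>y. \<sigma> * (E \<tau> * ux (p y \<tau>) (t0 + \<tau>))) has_real_derivative E \<tau> * uxx (p y \<tau>) (t0 + \<tau>)) (at y within {-d..0})"
            by (rule DERIV_cong[OF DERIV_cmult[OF DERIV_cmult[OF DERIV_image_chain[OF DERIV_subset[OF u_xx[OF dom[OF y \<tau>] 0] im] l],
                    unfolded o_def]]]) (simp add: \<sigma>2 mult.left_commute[of \<sigma>] flip: mult.assoc) }
        assume y: "y \<in> {-d<..<0}"
        have "((\<lambda>t. \<gamma> t + \<sigma> * y) has_real_derivative \<gamma>' (t0 + \<tau>)) (at (t0 + \<tau>))"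
          using DERIV_add[OF \<gamma>[OF mem(2)[OF \<tau>]] DERIV_const[of "\<sigma> * y"]] by simp
        with st'[OF mem(1)[OF \<tau>] y] mem(2)[OF \<tau>]
        have D: "((\<lambda>t. u (\<gamma> t + \<sigma> * y) t) has_real_derivative ux (p y \<tau>) (t0 + \<tau>) * \<gamma>' (t0 + \<tau>)
            + (uxx (p y \<tau>) (t0 + \<tau>) - lam * u (p y \<tau>) (t0 + \<tau>))) (at (t0 + \<tau>))"
          unfolding p_def by (intro u_along_path) auto
        have Ed: "(E has_real_derivative lam * E \<tau>) (at \<tau> within {0..L})"
          unfolding E_def by (auto intro!: derivative_eq_intros)
        have "c' \<tau> * (\<sigma> * (E \<tau> * ux (p y \<tau>) (t0 + \<tau>))) = (\<sigma> * \<sigma>) * (\<gamma>' (t0 + \<tau>) * (E \<tau> * ux (p y \<tau>) (t0 + \<tau>)))"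
          by (simp only: c'_def mult_ac)
        then have drift: "c' \<tau> * (\<sigma> * (E \<tau> * ux (p y \<tau>) (t0 + \<tau>))) = \<gamma>' (t0 + \<tau>) * (E \<tau> * ux (p y \<tau>) (t0 + \<tau>))"
          by (simp only: \<sigma>2 mult_1)
        show "((\<lambda>\<tau>. E \<tau> * u (p y \<tau>) (t0 + \<tau>)) has_real_derivative E \<tau> * uxx (p y \<tau>) (t0 + \<tau>)
            + c' \<tau> * (\<sigma> * (E \<tau> * ux (p y \<tau>) (t0 + \<tau>)))) (at \<tau> within {0..L})"
          using DERIV_mult[OF Ed DERIV_chain'[OF sh D]] unfolding drift by (simp add: p_def algebra_simps)
      qed (use d L cd cc V[OF u_cont] V' V[OF uxx_cont] in auto)
      have shift: "C_diff_on k (\<lambda>\<tau>. h (t0 + \<tau>)) {0..L}" if "C_diff_on k h {0<..T}" for h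
      proof -
        have "C_diff_on k (\<lambda>\<tau>. h (\<tau> + t0)) {0..L}"
          by (rule C_diff_on_subset[OF C_diff_on_shift[OF that]])
            (use mem in \<open>auto intro!: image_eqI[where x="_ + t0"] simp: add.commute\<close>)
        then show ?thesis by (simp only: add.commute)
      qed
      have "C_diff_on k (\<lambda>\<tau>. E \<tau> * u (p 0 \<tau>) (t0 + \<tau>)) {0<..L}"
      proof (rule layer.neumann_to_dirichlet[where B=B])
        show "C_diff_on k c' {0..L}" unfolding c'_def by (intro C_diff_on_cmult shift \<gamma>'k)
        have "C_diff_on k E {0..L}" unfolding E_def by (intro shift[of "\<lambda>t. exp (lam * t)"] C_diff_on_exp_linear)
        then show "C_diff_on k (\<lambda>\<tau>. \<sigma> * (E \<tau> * ux (p 0 \<tau>) (t0 + \<tau>))) {0..L}"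
          using shift[OF nk] by (simp add: p_def C_diff_on_cmult C_diff_on_mult)
        have "sqrt L \<le> 2 * half_gauss / (3 * pi * B)"
          using L(2) B hg unfolding \<epsilon>_def by (intro real_le_lsqrt) auto
        moreover have "0 < 3 * pi * B" using B by simp
        ultimately show "3 * pi * B * sqrt L \<le> 2 * half_gauss"
          by (simp only: pos_le_divide_eq mult.commute)
      qed (use cB in auto)
      then show ?thesis by (simp add: E_def p_def)
    qed
    then show "\<exists>\<epsilon>>0. \<forall>t0 L. a \<le> t0 \<longrightarrow> 0 < L \<longrightarrow> L \<le> \<epsilon> \<longrightarrow> t0 + L \<le> T \<longrightarrow>
      C_diff_on k (\<lambda>\<tau>. exp (lam * (t0 + \<tau>)) * u (\<gamma> (t0 + \<tau>)) (t0 + \<tau>)) {0<..L}"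
      using \<epsilon> by blast
  qed
  then have "C_diff_on k (\<lambda>t. exp ((- lam) * t) * (exp (lam * t) * u (\<gamma> t) t)) {0<..T}"
    by (rule C_diff_on_mult[OF C_diff_on_exp_linear])
  moreover have "exp ((- lam) * t) * (exp (lam * t) * u (\<gamma> t) t) = u (\<gamma> t) t" for t
    by (simp add: exp_minus flip: mult.assoc)
  ultimately show ?thesis by (simp only:)
qed

lemma s_lower_bound:
  assumes a: "0 < a"
  obtains d where "0 < d" "\<And>t. t \<in> {a..T} \<Longrightarrow> d \<le> s t"
proof -
  have pos: "0 < s t" if "t \<in> {a..T}" for t using s_pos[of t] that a by auto
  have "continuous_on {a..T} s" by (rule continuous_on_subset[OF s_cont]) (use a in auto)
  then have "continuous_on {a..T} (\<lambda>t. 1 / s t)" using pos by (intro continuous_on_divide continuous_on_const) force+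
  then have "bounded ((\<lambda>t. 1 / s t) ` {a..T})" by (intro compact_imp_bounded compact_continuous_image) auto
  then obtain M where M: "M > 0" "\<And>t. t \<in> {a..T} \<Longrightarrow> \<bar>1 / s t\<bar> \<le> M" unfolding bounded_pos by auto
  have "1 / M \<le> s t" if "t \<in> {a..T}" for t
    using M(1) M(2)[OF that] pos[OF that] by (simp add: field_simps)
  then show ?thesis using that[of "1 / M"] M by auto
qed

text \<open>Since the flux vanishes at the front, only the regularity of its speed matters.\<close>

lemma front_value_regular:
  assumes T: "0 < T" and vk: "C_diff_on k speed {0<..T}"
  shows "C_diff_on k (\<lambda>t. u (s t) t) {0<..T}"
proof (rule boundary_value_regular[OF T, where \<sigma>=1 and \<gamma>'=speed])
  fix a :: real assume "0 < a"
  then obtain d where d: "0 < d" "\<And>t. t \<in> {a..T} \<Longrightarrow> d \<le> s t" using s_lower_bound by blast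
  then show "\<exists>d>0. \<forall>t\<in>{a..T}. \<forall>y\<in>{-d..0}. 0 \<le> s t + 1 * y \<and> s t + 1 * y \<le> s t \<and>
      (-d < y \<and> y < 0 \<longrightarrow> 0 < s t + 1 * y \<and> s t + 1 * y < s t)"
    by (intro exI[of _ d] conjI ballI impI) force+
next
  show "C_diff_on k (\<lambda>t. ux (s t) t) {0<..T}"
    by (rule C_diff_on_cong[OF _ C_diff_on_const[of k 0]]) (simp add: no_flux)
  show "(s has_real_derivative speed t) (at t)" if "0 < t" for t by (rule s_deriv[OF that])
qed (simp_all add: vk)

lemma wall_value_regular:
  assumes T: "0 < T" and nk: "C_diff_on k (ux 0) {0<..T}"
  shows "C_diff_on k (u 0) {0<..T}"
proof (rule boundary_value_regular[OF T, where \<sigma>="-1" and \<gamma>="\<lambda>_. 0" and \<gamma>'="\<lambda>_. 0"])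
  fix a :: real assume "0 < a"
  then obtain d where d: "0 < d" "\<And>t. t \<in> {a..T} \<Longrightarrow> d \<le> s t" using s_lower_bound by blast
  then show "\<exists>d>0. \<forall>t\<in>{a..T}. \<forall>y\<in>{-d..0}. 0 \<le> 0 + -1 * y \<and> 0 + -1 * y \<le> s t \<and>
      (-d < y \<and> y < 0 \<longrightarrow> 0 < 0 + -1 * y \<and> 0 + -1 * y < s t)"
    by (intro exI[of _ d] conjI ballI impI) force+
qed (simp_all add: nk C_diff_on_const)

text \<open>The flux at the wall can be read off the mass balance, where the mass is \<open>s' + sig * s\<close>.  One derivative of
  \<open>s'\<close> is lost there; the front and the wall lose none.\<close>

theorem wall_regular_of_front_regular:
  assumes T: "0 < T" and s: "C_diff_on (k + 2) s {0<..T}"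
  shows "C_diff_on k (u 0) {0<..T}"
proof (rule wall_value_regular[OF T])
  have lim: "at t within {0<..T} \<noteq> bot" if "t \<in> {0<..T}" for t
    using that by (auto simp: trivial_limit_within)
  have "C_diff_on (Suc (Suc k)) s {0<..T}" using s by simp
  then obtain s1 where s1: "\<forall>t\<in>{0<..T}. (s has_real_derivative s1 t) (at t within {0<..T})" "C_diff_on (Suc k) s1 {0<..T}"
    unfolding C_diff_on_Suc_iff[of "Suc k"] by blast
  have "s1 t = speed t" if "t \<in> {0<..T}" for t
    by (rule has_field_derivative_unique[OF s1(1)[rule_format, OF that] s_deriv lim]) (use that in auto)
  from C_diff_on_cong[OF this s1(2)] have v: "C_diff_on (Suc k) speed {0<..T}" by simp
  then obtain v' where v': "\<forall>t\<in>{0<..T}. (speed has_real_derivative v' t) (at t within {0<..T})" "C_diff_on k v' {0<..T}"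
    unfolding C_diff_on_Suc_iff by blast
  have vk: "C_diff_on k speed {0<..T}" by (rule C_diff_on_Suc_imp[OF v])
  have sk: "C_diff_on k s {0<..T}" by (rule C_diff_on_le[OF s]) simp
  have g: "C_diff_on k (\<lambda>t. u (s t) t) {0<..T}" by (rule front_value_regular[OF T vk])
  have "C_diff_on k (\<lambda>t. speed t * u (s t) t - lam * (speed t + sig * s t) - (v' t + sig * speed t)) {0<..T}"
    by (intro C_diff_on_diff C_diff_on_add C_diff_on_mult C_diff_on_const vk g sk v'(2))
  moreover have "speed t * u (s t) t - lam * (speed t + sig * s t) - (v' t + sig * speed t) = ux 0 t" if t: "t \<in> {0<..T}" for t
  proof -
    have t0: "0 < t" using t by simp
    let ?D = "speed t * u (s t) t - ux 0 t - lam * integral {0..s t} (\<lambda>x. u x t)"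
    have "((\<lambda>t. integral {0..s t} (\<lambda>x. u x t)) has_real_derivative ?D) (at t within {0<..T})"
      by (rule has_field_derivative_at_within[OF mass_balance[OF t0]])
    then have "((\<lambda>t. speed t + sig * s t) has_real_derivative ?D) (at t within {0<..T})"
      by (rule has_field_derivative_transform_within[where d=1]) (use t mass_eq in auto)
    moreover have "((\<lambda>t. speed t + sig * s t) has_real_derivative v' t + sig * speed t) (at t within {0<..T})"
      using v'(1) t by (intro DERIV_add DERIV_cmult s_deriv t0) auto
    ultimately have "?D = v' t + sig * speed t" using lim[OF t] by (rule has_field_derivative_unique)
    then show ?thesis using mass_eq[of t] t0 by simp
  qed
  ultimately show "C_diff_on k (ux 0) {0<..T}" by (rule C_diff_on_cong[rotated])
qed

end

theorem theorem3p3: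
  fixes lam sig b :: real and f \<phi> s :: "real \<Rightarrow> real" and u :: "real \<Rightarrow> real \<Rightarrow> real"
  assumes "lam > 0" and "sig > 0" and "b > 0" and "\<phi> 0 = f 0"
    and "classical_solution lam sig b f \<phi> u s"
  shows "(\<forall>(m::nat) T. m \<ge> 1 \<longrightarrow> (T::real) > 0 \<longrightarrow>
            C_diff_on (m + 2) s {0<..T} \<longrightarrow> C_diff_on m f {0<..T}) \<and>
         (C_infinity_on s {0<..} \<longrightarrow> C_infinity_on f {0<..})"
proof -
  note sol = assms(5)[unfolded classical_solution_def]
  obtain ux ut uxx where p: "has_partials u s ux ut uxx"
    and h: "\<forall>t>0. \<forall>x. 0 < x \<and> x < s t \<longrightarrow> ut x t = uxx x t - lam * u x t" and n: "\<forall>t>0. ux (s t) t = 0"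
    using sol by (elim conjE exE)
  have f: "\<And>t. 0 \<le> t \<Longrightarrow> u 0 t = f t" using sol by simp
  interpret heat_free_boundary lam sig u ux ut uxx s
    by unfold_locales (use sol p h n in simp_all)
  have fin: "C_diff_on m f {0<..T}" if "0 < T" "C_diff_on (m + 2) s {0<..T}" for m T
    by (rule C_diff_on_cong[OF _ wall_regular_of_front_regular[OF that]]) (use f in auto)
  have "C_infinity_on f {0<..}" if s: "C_infinity_on s {0<..}"
    unfolding C_infinity_on_def
  proof
    fix m
    show "C_diff_on m f {0<..}"
    proof (rule C_diff_on_local)
      fix t :: real assume t: "t \<in> {0<..}"
      have "C_diff_on (m + 2) s {0<..t+1}"
        using s unfolding C_infinity_on_def by (auto intro: C_diff_on_subset)
      then have "C_diff_on m f {0<..t+1}" using t by (intro fin) auto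
      then have "C_diff_on m f ({0<..} \<inter> {0<..<t+1})" by (rule C_diff_on_subset) auto
      then show "\<exists>U. open U \<and> t \<in> U \<and> C_diff_on m f ({0<..} \<inter> U)"
        using t by (intro exI[of _ "{0<..<t+1}"]) auto
      have "at t within {0<..} = at t" using t by (intro at_within_open) auto
      then show "at t within {0<..} \<noteq> bot" by simp
    qed
  qed
  with fin show ?thesis by blast
qed

end
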